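(* Let $X$ be a Banach space and let $\Gamma:[0,1]\to cwk(X)$ be a multifunction. Then the following conditions are equivalent: (i) $\Gamma$ is Henstock integrable; (ii) $\mathcal{S}_H(\Gamma)\neq\emptyset$ and for every $f\in\mathcal{S}_H(\Gamma)$ the multifunction $\Gamma-f$ is McShane integrable; (iii) there exists $f\in\mathcal{S}_H(\Gamma)$ such that the multifunction $G:=\Gamma-f$ is McShane integrable.
   Context: $X$ is an arbitrary (not necessarily separable) real Banach space and $cwk(X)$ is the family of all non-empty convex weakly compact subsets of $X$, with Minkowski addition, multiplication by positive scalars, and the Hausdorff distance $d_H$. A multifunction is a map $\Gamma:[0,1]\to cwk(X)$; a selection of $\Gamma$ is a function $f:[0,1]\to X$ with $f(t)\in\Gamma(t)$ for every $t\in[0,1]$. For a function $f$, $(\Gamma-f)(t)=\{x-f(t):x\in\Gamma(t)\}$. A gauge is any strictly positive function $\delta$ on $[0,1]$. A partition of $[0,1]$ is a finite collection $\{(I_1,t_1),\dots,(I_p,t_p)\}$ of nonoverlapping closed subintervals $I_i$ with union $[0,1]$ and points $t_i\in[0,1]$; it is a Perron partition if $t_i\in I_i$ for all $i$; it is $\delta$-fine if $I_i\subset(t_i-\delta(t_i),t_i+\delta(t_i))$ for all $i$. $\Gamma$ is Henstock (resp. McShane) integrable on $[0,1]$ if there is $\Phi_\Gamma([0,1])\in cwk(X)$ such that for every $\varepsilon>0$ there is a gauge $\delta$ with $d_H\big(\Phi_\Gamma([0,1]),\sum_{i=1}^p\Gamma(t_i)|I_i|\big)<\varepsilon$ for every $\delta$-fine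 Perron partition (resp. every $\delta$-fine partition) of $[0,1]$. For functions $f:[0,1]\to X$ these notions are applied to $t\mapsto\{f(t)\}$ (with integral in $X$ and norm distance). $\mathcal{S}_H(\Gamma)$ is the set of Henstock integrable selections of $\Gamma$. *)

theory Defs
  imports "HOL-Analysis.Analysis" "HOL-Library.Set_Algebras"
begin

definition weak_topology :: "'a::real_normed_vector topology" where
  "weak_topology =
     topology_generated_by {f -` U | (f :: 'a \<Rightarrow> real) U. bounded_linear f \<and> open U}"

definition cwk :: "'a::real_normed_vector set set" where
  "cwk = {A. A \<noteq> {} \<and> convex A \<and> compactin weak_topology A}"

text \<open>
  Only used for non-empty bounded sets, where the suprema are finite: weakly compact
  sets are norm bounded, and so are their finite Minkowski combinations.
\<close>
definition hausdorff_dist :: "'a::metric_space set \<Rightarrow> 'a set \<Rightarrow> real" where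
  "hausdorff_dist A B = max (SUP a\<in>A. infdist a B) (SUP b\<in>B. infdist b A)"

text \<open>
  Pairs are written (tag, interval), as in \<^const>\<open>tagged_division_of\<close>, but the tag need not
  lie in the interval. Degenerate intervals are admitted, as in the library; they contribute
  \<^term>\<open>{0}\<close> to a Riemann sum.
\<close>
definition partition01 :: "(real \<times> real set) set \<Rightarrow> bool" where
  "partition01 P \<longleftrightarrow>
     finite P \<and>
     (\<forall>(t, K)\<in>P. t \<in> {0..1} \<and> (\<exists>a b. a \<le> b \<and> K = {a..b})) \<and>
     (\<forall>(t, K)\<in>P. \<forall>(s, L)\<in>P. (t, K) \<noteq> (s, L) \<longrightarrow> interior K \<inter> interior L = {}) \<and>
     (\<Union>(t, K)\<in>P. K) = {0..1}"

definition perron_partition01 :: "(real \<times> real set) set \<Rightarrow> bool" where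
  "perron_partition01 P \<longleftrightarrow> partition01 P \<and> (\<forall>(t, K)\<in>P. t \<in> K)"

definition gauge01 :: "(real \<Rightarrow> real) \<Rightarrow> bool" where
  "gauge01 \<delta> \<longleftrightarrow> (\<forall>t\<in>{0..1}. 0 < \<delta> t)"

definition delta_fine :: "(real \<Rightarrow> real) \<Rightarrow> (real \<times> real set) set \<Rightarrow> bool" where
  "delta_fine \<delta> P \<longleftrightarrow> (\<forall>(t, K)\<in>P. K \<subseteq> {t - \<delta> t <..< t + \<delta> t})"

text \<open>Sums of sets are Minkowski sums (\<^theory>\<open>HOL-Library.Set_Algebras\<close>).\<close>
definition riemann_sum :: "(real \<Rightarrow> 'a::real_normed_vector set) \<Rightarrow> (real \<times> real set) set \<Rightarrow> 'a set" where
  "riemann_sum \<Gamma> P = (\<Sum>(t, K)\<in>P. (\<lambda>x. measure lborel K *\<^sub>R x) ` \<Gamma> t)"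

definition henstock_integrable :: "(real \<Rightarrow> 'a::real_normed_vector set) \<Rightarrow> bool" where
  "henstock_integrable \<Gamma> \<longleftrightarrow>
     (\<exists>\<Phi>\<in>cwk. \<forall>\<epsilon>>0. \<exists>\<delta>. gauge01 \<delta> \<and>
        (\<forall>P. perron_partition01 P \<and> delta_fine \<delta> P \<longrightarrow>
           hausdorff_dist \<Phi> (riemann_sum \<Gamma> P) < \<epsilon>))"

definition mcshane_integrable :: "(real \<Rightarrow> 'a::real_normed_vector set) \<Rightarrow> bool" where
  "mcshane_integrable \<Gamma> \<longleftrightarrow>
     (\<exists>\<Phi>\<in>cwk. \<forall>\<epsilon>>0. \<exists>\<delta>. gauge01 \<delta> \<and>
        (\<forall>P. partition01 P \<and> delta_fine \<delta> P \<longrightarrow>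
           hausdorff_dist \<Phi> (riemann_sum \<Gamma> P) < \<epsilon>))"

text \<open>
  The library's \<^const>\<open>integrable_on\<close> is the Henstock integral for functions; see
  \<open>integrable_on_iff_gauge01\<close> below.
\<close>
definition henstock_selections :: "(real \<Rightarrow> 'a::real_normed_vector set) \<Rightarrow> (real \<Rightarrow> 'a) set" where
  "henstock_selections \<Gamma> = {f. (\<forall>t\<in>{0..1}. f t \<in> \<Gamma> t) \<and> f integrable_on {0..1}}"

definition multi_diff ::
  "(real \<Rightarrow> 'a::real_normed_vector set) \<Rightarrow> (real \<Rightarrow> 'a) \<Rightarrow> real \<Rightarrow> 'a set" where
  "multi_diff \<Gamma> f = (\<lambda>t. {x - f t | x. x \<in> \<Gamma> t})"

lemma perron_partition01_iff: "perron_partition01 P \<longleftrightarrow> P tagged_division_of {0..1}"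
proof
  assume P: "perron_partition01 P"
  then have U: "(\<Union>(t, K)\<in>P. K) = {0..1}"
    by (simp add: perron_partition01_def partition01_def)
  show "P tagged_division_of {0..1}"
    unfolding tagged_division_of
  proof (intro conjI allI impI)
    show "finite P" using P by (simp add: perron_partition01_def partition01_def)
    show "\<Union>{K. \<exists>x. (x, K) \<in> P} = {0..1}" unfolding U[symmetric] by auto
    fix x K assume xK: "(x, K) \<in> P"
    show "x \<in> K" using P xK by (auto simp: perron_partition01_def)
    show "K \<subseteq> {0..1}" unfolding U[symmetric] using xK by auto
    show "\<exists>a b. K = cbox a b"
      using P xK unfolding perron_partition01_def partition01_def by fastforce
  next
    fix x1 K1 x2 K2
    assume "(x1, K1) \<in> P \<and> (x2, K2) \<in> P \<and> (x1, K1) \<noteq> (x2, K2)"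
    moreover have "\<forall>(t, K)\<in>P. \<forall>(s, L)\<in>P. (t, K) \<noteq> (s, L) \<longrightarrow> interior K \<inter> interior L = {}"
      using P by (simp add: perron_partition01_def partition01_def)
    ultimately show "interior K1 \<inter> interior K2 = {}" by fast
  qed
next
  assume P: "P tagged_division_of {0..1}"
  note D = tagged_division_ofD[OF P]
  have tags: "t \<in> {0..1} \<and> (\<exists>a b. a \<le> b \<and> K = {a..b})" if tK: "(t, K) \<in> P" for t K
  proof -
    obtain a b where ab: "K = {a..b}" using D(4)[OF tK] by auto
    moreover have "t \<in> K" "K \<subseteq> {0..1}" using D(2,3)[OF tK] .
    ultimately show ?thesis by (intro conjI exI[of _ a] exI[of _ b]) auto
  qed
  have "\<forall>(t, K)\<in>P. t \<in> {0..1} \<and> (\<exists>a b. a \<le> b \<and> K = {a..b})"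
    using tags by fast
  moreover have "(\<Union>(t, K)\<in>P. K) = {0..1}"
    using D(6) by blast
  moreover have "\<forall>(t, K)\<in>P. \<forall>(s, L)\<in>P. (t, K) \<noteq> (s, L) \<longrightarrow> interior K \<inter> interior L = {}"
    using D(5) by fast
  moreover have "\<forall>(t, K)\<in>P. t \<in> K"
    using D(2) by fast
  ultimately show "perron_partition01 P"
    using D(1) unfolding perron_partition01_def partition01_def by simp
qed

lemma integrable_on_iff_gauge01:
  fixes f :: "real \<Rightarrow> 'a::real_normed_vector"
  shows "f integrable_on {0..1} \<longleftrightarrow>
     (\<exists>y. \<forall>\<epsilon>>0. \<exists>\<delta>. gauge01 \<delta> \<and>
        (\<forall>P. perron_partition01 P \<and> delta_fine \<delta> P \<longrightarrow>
           norm (y - (\<Sum>(t, K)\<in>P. measure lborel K *\<^sub>R f t)) < \<epsilon>))"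
proof -
  have "(f has_integral y) {0..1} \<longleftrightarrow>
     (\<forall>\<epsilon>>0. \<exists>\<delta>. gauge01 \<delta> \<and>
        (\<forall>P. perron_partition01 P \<and> delta_fine \<delta> P \<longrightarrow>
           norm (y - (\<Sum>(t, K)\<in>P. measure lborel K *\<^sub>R f t)) < \<epsilon>))" (is "_ \<longleftrightarrow> ?R") for y
  proof
    assume I: "(f has_integral y) {0..1}"
    show ?R
    proof (intro allI impI)
      fix \<epsilon> :: real assume "\<epsilon> > 0"
      then obtain \<gamma> where \<gamma>: "gauge \<gamma>" and
        D: "\<And>P. P tagged_division_of {0..1} \<Longrightarrow> \<gamma> fine P \<Longrightarrow>
              norm ((\<Sum>(x, k)\<in>P. measure lborel k *\<^sub>R f x) - y) < \<epsilon>"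
        using I[unfolded has_integral[of f y 0 1, unfolded box_real]] by metis
      have "\<exists>d>0. ball t d \<subseteq> \<gamma> t" for t
        using \<gamma> by (meson gauge_def open_contains_ball)
      then obtain \<delta> where \<delta>: "\<And>t. \<delta> t > 0" "\<And>t. ball t (\<delta> t) \<subseteq> \<gamma> t"
        by metis
      have "\<gamma> fine P" if "delta_fine \<delta> P" for P
        unfolding fine_def
      proof clarify
        fix t K s assume "(t, K) \<in> P" "s \<in> K"
        then have "s \<in> ball t (\<delta> t)"
          using that by (fastforce simp: delta_fine_def ball_eq_greaterThanLessThan)
        then show "s \<in> \<gamma> t" using \<delta>(2) by blast
      qed
      then show "\<exists>\<delta>. gauge01 \<delta> \<and> (\<forall>P. perron_partition01 P \<and> delta_fine \<delta> P \<longrightarrow>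
           norm (y - (\<Sum>(t, K)\<in>P. measure lborel K *\<^sub>R f t)) < \<epsilon>)"
        using \<delta>(1) D by (intro exI[of _ \<delta>])
          (simp add: gauge01_def norm_minus_commute[of y] perron_partition01_iff)
    qed
  next
    assume R: ?R
    have "\<exists>\<gamma>. gauge \<gamma> \<and> (\<forall>P. P tagged_division_of {0..1} \<and> \<gamma> fine P \<longrightarrow>
           norm ((\<Sum>(x, k)\<in>P. measure lborel k *\<^sub>R f x) - y) < \<epsilon>)" if "\<epsilon> > 0" for \<epsilon>
    proof -
      obtain \<delta> where \<delta>: "gauge01 \<delta>" and
        D: "\<And>P. perron_partition01 P \<Longrightarrow> delta_fine \<delta> P \<Longrightarrow>
              norm (y - (\<Sum>(t, K)\<in>P. measure lborel K *\<^sub>R f t)) < \<epsilon>"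
        using R \<open>\<epsilon> > 0\<close> by blast
      define \<gamma> where "\<gamma> t = ball t (if t \<in> {0..1} then \<delta> t else 1)" for t :: real
      have "gauge \<gamma>"
        using \<delta> unfolding gauge_def gauge01_def \<gamma>_def by auto
      moreover have "delta_fine \<delta> P" if P: "perron_partition01 P" "\<gamma> fine P" for P
        unfolding delta_fine_def
      proof clarify
        fix t K s assume "(t, K) \<in> P" "s \<in> K"
        then have "t \<in> {0..1}" "s \<in> \<gamma> t"
          using P by (auto simp: perron_partition01_def partition01_def fine_def)
        then show "s \<in> {t - \<delta> t<..<t + \<delta> t}"
          by (simp add: \<gamma>_def ball_eq_greaterThanLessThan)
      qed
      ultimately show ?thesis
        using D by (intro exI[of _ \<gamma>])
          (simp add: norm_minus_commute[of _ y] perron_partition01_iff)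
    qed
    then show "(f has_integral y) {0..1}"
      unfolding has_integral[of f y 0 1, unfolded box_real] by simp
  qed
  then show ?thesis unfolding integrable_on_def by simp
qed

end

theory Submission
  imports Defs
begin

text \<open>
  Selections: a weakly compact convex set has a strongly exposed point. If \<open>y\<close> strongly exposes the
  integral of \<open>\<Gamma>\<close>, any selection maximising \<open>y\<close> pointwise has Riemann sums that converge to the exposed
  point.

  Henstock to McShane: with \<open>f\<close> a Henstock integrable selection, the support functions of \<open>\<Gamma> - f\<close> form
  a family of nonnegative functions that is Henstock integrable uniformly over the dual unit ball.
  For two tags of large gauge in one short window, the Henstock lemma bounds the effect of exchanging
  them, and a McShane sum with free tags is a mixture of such exchanges over windows that do not
  overlap. Windows are dyadic, so that the ones overused by a given partition are short in total.
  This bounds McShane sums from above; positivity turns the bound into uniform absolute continuity of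
  the integrals, which gives convergence.
\<close>

section \<open>The Hahn-Banach theorem\<close>

text \<open>The difficulty is uniformity. A single support function of \<open>\<Gamma> - f\<close>
  is nonnegative and Henstock integrable, hence Lebesgue integrable, and classical theory would
  suffice for it. But the dual ball is uncountable, \<open>X\<close> is not separable, and the only
  common bound, the pointwise supremum of the norms in \<open>\<Gamma> t - f t\<close>, need not be
  measurable. The sets of tags sorted by that bound and by gauge size are therefore arbitrary, and
  estimates on them are combinatorial or use outer measure (\<open>almost_outer_open\<close>).

  An exchange needs a second tag inside the given interval, of the same class as the free tag.
  Intervals without one are short in total, because the open set around each class has nearly
  minimal measure. Dyadic windows are either nested or nonoverlapping, so the weights of overlapping
  ones can be stacked and cut into levels free of overlaps.

  For selections the obstacle is norm convergence: maximising one functional controls only its own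
  values, and strong exposure turns this into a norm estimate.\<close>

definition sublinear :: "('a::real_vector \<Rightarrow> real) \<Rightarrow> bool" where
  "sublinear p \<longleftrightarrow> (\<forall>x y. p (x + y) \<le> p x + p y) \<and> (\<forall>c\<ge>0. \<forall>x. p (c *\<^sub>R x) = c * p x)"

lemma sublinear_add: "sublinear p \<Longrightarrow> p (x + y) \<le> p x + p y"
  by (simp add: sublinear_def)

lemma sublinear_scale: "sublinear p \<Longrightarrow> c \<ge> 0 \<Longrightarrow> p (c *\<^sub>R x) = c * p x"
  by (simp add: sublinear_def)

lemma sublinear_zero: "sublinear p \<Longrightarrow> p 0 = 0"
  using sublinear_scale[of p 0 0] by simp

lemma sublinear_neg: "sublinear p \<Longrightarrow> - p (- x) \<le> p x"
  using sublinear_add[of p x "- x"] sublinear_zero[of p] by simp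

text \<open>Any linear \<open>l\<close> below \<open>q\<close> is at least \<open>\<theta>\<close>
  on \<open>C\<close>, because \<open>l (- c) \<le> q (- c)\<close>. The witness is the largest
  candidate: sublinearity and the bound on \<open>- C\<close> force a value at \<open>v\<close> of
  at most \<open>p (v + s *\<^sub>R c) - s * \<theta>\<close> for all \<open>c\<close> in
  \<open>C\<close> and \<open>s \<ge> 0\<close>, and \<open>q v\<close> is the infimum of
  these.\<close>

lemma sublinear_below_on_convex:
  fixes p :: "'a::real_vector \<Rightarrow> real"
  assumes p: "sublinear p" and C: "convex C" "C \<noteq> {}" and \<theta>: "\<And>c. c \<in> C \<Longrightarrow> \<theta> \<le> p c"
  obtains q where "sublinear q" "\<And>v. q v \<le> p v" "\<And>c. c \<in> C \<Longrightarrow> q (- c) \<le> - \<theta>"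
proof -
  define g where "g v = (\<lambda>(c, s). p (v + s *\<^sub>R c) - s * \<theta>)" for v
  define q where "q v = (INF z\<in>C \<times> {0..}. g v z)" for v
  have lb: "- p (- v) \<le> g v (c, s)" if "c \<in> C" "s \<ge> 0" for v c s
  proof -
    have "s * \<theta> \<le> p (s *\<^sub>R c)"
      using \<theta>[OF that(1)] that(2) p by (simp add: sublinear_scale mult_left_mono)
    also have "\<dots> \<le> p (v + s *\<^sub>R c) + p (- v)"
      using sublinear_add[OF p, of "v + s *\<^sub>R c" "- v"] by simp
    finally show ?thesis by (simp add: g_def)
  qed
  have bdd: "bdd_below (g v ` (C \<times> {0..}))" for v
    by (rule bdd_belowI2[of _ "- p (- v)"]) (use lb in auto)
  have ne: "C \<times> {0::real..} \<noteq> {}" using C by auto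
  have le: "q v \<le> p (v + s *\<^sub>R c) - s * \<theta>" if "c \<in> C" "s \<ge> 0" for v c s
    using cINF_lower[OF bdd[of v], of "(c, s)"] that unfolding q_def by (simp add: g_def)
  have ge: "b \<le> q v" if "\<And>c s. c \<in> C \<Longrightarrow> s \<ge> 0 \<Longrightarrow> b \<le> p (v + s *\<^sub>R c) - s * \<theta>" for b v
    unfolding q_def by (rule cINF_greatest[OF ne]) (use that in \<open>auto simp: g_def\<close>)
  obtain c0 where c0: "c0 \<in> C" using C by auto
  have sub: "q (v + w) \<le> (p (v + s *\<^sub>R c) - s * \<theta>) + (p (w + t *\<^sub>R d) - t * \<theta>)"
    if A: "c \<in> C" "s \<ge> 0" "d \<in> C" "t \<ge> 0" for v w c s d t
  proof -
    \<comment> \<open>Convexity of \<open>C\<close> is used here: two displacements along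
      \<open>C\<close> combine into one, which makes \<open>q\<close> subadditive.\<close>
    obtain e where e: "e \<in> C" "(s + t) *\<^sub>R e = s *\<^sub>R c + t *\<^sub>R d"
    proof (cases "s + t = 0")
      case True
      then have "s = 0" "t = 0" using A by auto
      then show ?thesis using that[OF c0] by simp
    next
      case False
      then have st: "s + t > 0" using A by auto
      let ?e = "(s / (s + t)) *\<^sub>R c + (t / (s + t)) *\<^sub>R d"
      have "s / (s + t) + t / (s + t) = 1"
        using st by (simp add: add_divide_distrib[symmetric])
      then have "?e \<in> C"
        using C(1) A st by (intro convexD) auto
      moreover have "(s + t) *\<^sub>R ?e = s *\<^sub>R c + t *\<^sub>R d"
        using st by (simp add: scaleR_add_right)
      ultimately show ?thesis using that by blast
    qed
    have "q (v + w) \<le> p (v + w + (s + t) *\<^sub>R e) - (s + t) * \<theta>"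
      using le[OF e(1), of "s + t" "v + w"] A by simp
    also have "v + w + (s + t) *\<^sub>R e = (v + s *\<^sub>R c) + (w + t *\<^sub>R d)"
      by (simp add: e(2))
    also have "p \<dots> \<le> p (v + s *\<^sub>R c) + p (w + t *\<^sub>R d)"
      by (rule sublinear_add[OF p])
    finally show ?thesis by (simp add: algebra_simps)
  qed
  have add: "q (v + w) \<le> q v + q w" for v w
  proof -
    have "q (v + w) - (p (w + t *\<^sub>R d) - t * \<theta>) \<le> q v" if "d \<in> C" "t \<ge> 0" for d t
      by (rule ge) (use sub that in \<open>smt (verit)\<close>)
    then have "q (v + w) - q v \<le> q w"
      by (intro ge) (smt (verit))
    then show ?thesis by simp
  qed
  have le_k: "q (k *\<^sub>R v) \<le> k * q v" if k: "k > 0" for k v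
  proof -
    have "q (k *\<^sub>R v) / k \<le> q v"
    proof (rule ge)
      fix c s assume cs: "c \<in> C" "(s::real) \<ge> 0"
      have "q (k *\<^sub>R v) \<le> p (k *\<^sub>R v + (k * s) *\<^sub>R c) - k * s * \<theta>"
        using le[OF cs(1), of "k * s"] k cs by simp
      also have "k *\<^sub>R v + (k * s) *\<^sub>R c = k *\<^sub>R (v + s *\<^sub>R c)"
        by (simp add: scaleR_add_right)
      also have "p \<dots> = k * p (v + s *\<^sub>R c)"
        using k by (simp add: sublinear_scale[OF p])
      finally show "q (k *\<^sub>R v) / k \<le> p (v + s *\<^sub>R c) - s * \<theta>"
        using k by (simp add: field_simps)
    qed
    then show ?thesis using k by (simp add: field_simps)
  qed
  have scale: "q (k *\<^sub>R v) = k * q v" if k: "k \<ge> 0" for k v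
  proof (cases "k = 0")
    case True
    have "q 0 \<le> 0" using le[OF c0, of 0 0] sublinear_zero[OF p] by simp
    moreover have "0 \<le> q 0"
      by (rule ge) (use lb[of _ _ 0] sublinear_zero[OF p] in \<open>auto simp: g_def\<close>)
    ultimately show ?thesis using True by simp
  next
    case False
    then have k: "k > 0" using k by simp
    have "k * q v \<le> q (k *\<^sub>R v)"
      using le_k[of "1 / k" "k *\<^sub>R v"] k by (simp add: field_simps)
    with le_k[OF k, of v] show ?thesis by simp
  qed
  show ?thesis
  proof
    show "sublinear q" unfolding sublinear_def using add scale by blast
    show "q v \<le> p v" for v using le[OF c0, of 0 v] by simp
    show "q (- c) \<le> - \<theta>" if "c \<in> C" for c
      using le[OF that, of 1 "- c"] sublinear_zero[OF p] by simp
  qed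
qed

text \<open>Comparability replaces two members of the chain by one that is below both, so
  subadditivity passes to the infimum; the common bound \<open>p\<close> keeps the infimum finite.
  Zorn's lemma needs this lower bound.\<close>

lemma sublinear_Inf_chain:
  assumes ne: "Q \<noteq> {}" and sub: "\<And>q. q \<in> Q \<Longrightarrow> sublinear q \<and> (\<forall>v. q v \<le> p v)"
    and p: "sublinear p"
    and chain: "\<And>q r. q \<in> Q \<Longrightarrow> r \<in> Q \<Longrightarrow> (\<forall>v. q v \<le> r v) \<or> (\<forall>v. r v \<le> q v)"
  obtains u where "sublinear u" "\<And>q v. q \<in> Q \<Longrightarrow> u v \<le> q v"
proof -
  define u where "u v = (INF q\<in>Q. q v)" for v
  have lb: "- p (- v) \<le> q v" if "q \<in> Q" for q v
    using sublinear_neg[of q v] sub[OF that] by (smt (verit))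
  have bdd: "bdd_below ((\<lambda>q. q v) ` Q)" for v
    by (rule bdd_belowI2[of _ "- p (- v)"]) (use lb in auto)
  have le: "u v \<le> q v" if "q \<in> Q" for q v
    unfolding u_def by (rule cINF_lower[OF bdd that])
  have ge: "b \<le> u v" if "\<And>q. q \<in> Q \<Longrightarrow> b \<le> q v" for b v
    unfolding u_def by (rule cINF_greatest[OF ne]) (use that in auto)
  have add: "u (v + w) \<le> u v + u w" for v w
  proof -
    have *: "u (v + w) \<le> q v + r w" if A: "q \<in> Q" "r \<in> Q" for q r
    proof -
      obtain s where "s \<in> Q" "s v \<le> q v" "s w \<le> r w"
        using chain[OF A] A order_refl by metis
      then show ?thesis
        using le[of s "v + w"] sub[of s] sublinear_add[of s v w] by fastforce
    qed
    have "u (v + w) - r w \<le> u v" if "r \<in> Q" for r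
      by (rule ge) (use * that in fastforce)
    then have "u (v + w) - u v \<le> u w"
      by (intro ge) (smt (verit))
    then show ?thesis by simp
  qed
  have scale: "u (k *\<^sub>R v) = k * u v" if k: "k \<ge> 0" for k v
  proof (cases "k = 0")
    case True
    have "(\<lambda>q. q (0::'a)) ` Q = {0}" using ne sub sublinear_zero by (auto simp: image_iff)
    then show ?thesis using True by (simp add: u_def)
  next
    case False
    then have k: "k > 0" using k by simp
    have "u (k *\<^sub>R v) / k \<le> u v"
      by (rule ge) (use le[of _ "k *\<^sub>R v"] sub k in \<open>fastforce simp: field_simps sublinear_scale\<close>)
    moreover have "k * u v \<le> u (k *\<^sub>R v)"
      by (rule ge) (use le[of _ v] sub k in \<open>simp add: sublinear_scale\<close>)
    ultimately show ?thesis using k by (simp add: field_simps)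
  qed
  show ?thesis
    by (rule that[of u]) (use add scale le in \<open>auto simp: sublinear_def\<close>)
qed

text \<open>Odd sublinear functions are linear. Oddness comes from
  \<open>sublinear_below_on_convex\<close> for the singleton \<open>{c}\<close> at height
  \<open>q c\<close>: it pushes the value at \<open>- c\<close> down to \<open>- q c\<close>, and by
  minimality nothing was changed.\<close>

lemma minimal_sublinear_linear:
  assumes q: "sublinear q" and min: "\<And>r. sublinear r \<Longrightarrow> (\<forall>v. r v \<le> q v) \<Longrightarrow> r = q"
  shows "linear q"
proof -
  have neg: "q (- c) = - q c" for c
  proof -
    obtain r where r: "sublinear r" "\<And>v. r v \<le> q v" "r (- c) \<le> - q c"
      using sublinear_below_on_convex[OF q, of "{c}" "q c"] by auto
    then have "r = q" using min by blast
    with r(3) sublinear_neg[OF q, of "- c"] show ?thesis by simp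
  qed
  show ?thesis
  proof (rule linearI)
    show "q (x + y) = q x + q y" for x y
      using sublinear_add[OF q, of x y] sublinear_add[OF q, of "- x" "- y"] neg[of "x + y"]
      by (simp add: neg)
    show "q (k *\<^sub>R x) = k *\<^sub>R q x" for k x
    proof (cases "k \<ge> 0")
      case False
      then show ?thesis
        using sublinear_scale[OF q, of "- k" x] neg[of "k *\<^sub>R x"] by simp
    qed (simp add: sublinear_scale[OF q])
  qed
qed

lemma exists_linear_below_sublinear:
  fixes p :: "'a::real_vector \<Rightarrow> real"
  assumes p: "sublinear p"
  obtains l where "linear l" "\<And>v. l v \<le> p v"
proof -
  define A where "A = {q. sublinear q \<and> (\<forall>v. q v \<le> p v)}"
  define P where "P q r \<longleftrightarrow> (\<forall>v. r v \<le> (q v::real))" for q r :: "'a \<Rightarrow> real"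
  have "\<exists>m\<in>A. \<forall>a\<in>A. P m a \<longrightarrow> a = m"
  proof (rule predicate_Zorn)
    show "partial_order_on A (relation_of P A)"
    proof (intro partial_order_on_relation_ofI)
      show "P q s" if "P q r" "P r s" for q r s
        using that unfolding P_def by (meson order_trans)
      show "q = r" if "P q r" "P r q" for q r
        using that unfolding P_def by (intro ext order_antisym) auto
    qed (simp add: P_def)
    fix C assume "C \<in> Chains (relation_of P A)"
    then have C: "q \<in> A" "P q r \<or> P r q" if "q \<in> C" "r \<in> C" for q r
      using that unfolding Chains_def relation_of_def by blast+
    show "\<exists>u\<in>A. \<forall>a\<in>C. P a u"
    proof (cases "C = {}")
      case True
      then show ?thesis using p by (auto simp: A_def)
    next
      case False
      obtain u where u: "sublinear u" "\<And>q v. q \<in> C \<Longrightarrow> u v \<le> q v"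
        using sublinear_Inf_chain[OF False _ p] C unfolding A_def P_def by (smt (verit) mem_Collect_eq)
      have "u \<in> A" using u False C unfolding A_def
        by (smt (verit, best) equals0I mem_Collect_eq)
      then show ?thesis using u by (auto simp: P_def)
    qed
  qed
  then obtain q where q: "q \<in> A" "\<And>r. r \<in> A \<Longrightarrow> P q r \<Longrightarrow> r = q" by blast
  have "r = q" if "sublinear r" "\<forall>v. r v \<le> q v" for r
    using q that unfolding A_def P_def by (smt (verit) mem_Collect_eq)
  with q have "linear q" unfolding A_def by (intro minimal_sublinear_linear) auto
  then show ?thesis using q that by (auto simp: A_def)
qed

lemma Mazur_Orlicz:
  fixes p :: "'a::real_vector \<Rightarrow> real"
  assumes "sublinear p" "convex C" "C \<noteq> {}" "\<And>c. c \<in> C \<Longrightarrow> \<theta> \<le> p c"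
  obtains l where "linear l" "\<And>v. l v \<le> p v" "\<And>c. c \<in> C \<Longrightarrow> \<theta> \<le> l c"
proof -
  obtain q where q: "sublinear q" "\<And>v. q v \<le> p v" "\<And>c. c \<in> C \<Longrightarrow> q (- c) \<le> - \<theta>"
    using sublinear_below_on_convex[OF assms] by blast
  obtain l where l: "linear l" "\<And>v. l v \<le> q v"
    using exists_linear_below_sublinear[OF q(1)] by blast
  show ?thesis
  proof
    show "linear l" by fact
    show "l v \<le> p v" for v using l q by (meson order_trans)
    show "\<theta> \<le> l c" if "c \<in> C" for c
      using l(2)[of "- c"] q(3)[OF that] linear_neg[OF l(1), of c] by simp
  qed
qed

text \<open>Mazur-Orlicz with \<open>p = norm\<close>: domination by the norm gives
  \<open>norm y \<le> 1\<close> and with it continuity. In this form the theorem yields norming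
  functionals, weak closedness of closed convex sets, and the Hausdorff distance through support
  functions.\<close>

lemma separation_by_blinfun:
  fixes C :: "'a::real_normed_vector set"
  assumes "convex C" "C \<noteq> {}" "\<And>c. c \<in> C \<Longrightarrow> \<theta> \<le> norm c"
  obtains y :: "'a \<Rightarrow>\<^sub>L real" where "norm y \<le> 1" "\<And>c. c \<in> C \<Longrightarrow> \<theta> \<le> y c"
proof -
  have "sublinear (norm :: 'a \<Rightarrow> real)"
    by (simp add: sublinear_def norm_triangle_ineq)
  then obtain l where l: "linear l" "\<And>v::'a. l v \<le> norm v" "\<And>c. c \<in> C \<Longrightarrow> \<theta> \<le> l c"
    using Mazur_Orlicz[of norm C \<theta>] assms by blast
  have abs: "\<bar>l v\<bar> \<le> norm v" for v
    using l(2)[of v] l(2)[of "- v"] linear_neg[OF l(1), of v] by simp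
  have "bounded_linear l"
    using l(1) abs by (intro bounded_linear_intro[of _ 1]) (auto simp: linear_add linear_scale)
  then have app: "blinfun_apply (Blinfun l) = l"
    by (rule bounded_linear_Blinfun_apply)
  show ?thesis
  proof
    show "norm (Blinfun l) \<le> 1"
      by (rule norm_blinfun_bound) (use abs app in auto)
    show "\<theta> \<le> Blinfun l c" if "c \<in> C" for c
      using l(3)[OF that] app by simp
  qed
qed

lemma norming_blinfun:
  fixes v :: "'a::real_normed_vector"
  obtains y :: "'a \<Rightarrow>\<^sub>L real" where "norm y \<le> 1" "y v = norm v"
proof -
  obtain y :: "'a \<Rightarrow>\<^sub>L real" where y: "norm y \<le> 1" "norm v \<le> y v"
    using separation_by_blinfun[of "{v}" "norm v"] by auto
  have "y v \<le> norm y * norm v"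
    using norm_blinfun[of y v] by simp
  also have "\<dots> \<le> 1 * norm v"
    using y by (intro mult_right_mono) auto
  finally show ?thesis using y that by force
qed

lemma norm_le_if_blinfun_le:
  fixes v :: "'a::real_normed_vector"
  assumes "\<And>y :: 'a \<Rightarrow>\<^sub>L real. norm y \<le> 1 \<Longrightarrow> blinfun_apply y v \<le> b"
  shows "norm v \<le> b"
proof -
  obtain y :: "'a \<Rightarrow>\<^sub>L real" where "norm y \<le> 1" "y v = norm v"
    by (rule norming_blinfun)
  then show ?thesis using assms[of y] by simp
qed

lemma abs_blinfun_le:
  fixes v :: "'a::real_normed_vector" and y :: "'a \<Rightarrow>\<^sub>L real"
  assumes "norm y \<le> c" "norm v \<le> b"
  shows "\<bar>y v\<bar> \<le> c * b"
proof -
  have "\<bar>y v\<bar> \<le> norm y * norm v" using norm_blinfun[of y v] by simp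
  also have "\<dots> \<le> c * b" using assms order_trans[OF norm_ge_zero assms(1)] by (intro mult_mono) auto
  finally show ?thesis .
qed

lemma abs_blinfun_le_norm:
  fixes v :: "'a::real_normed_vector" and y :: "'a \<Rightarrow>\<^sub>L real"
  assumes "norm y \<le> 1"
  shows "\<bar>y v\<bar> \<le> norm v"
  using abs_blinfun_le[OF assms order_refl, of v] by simp

section \<open>Weakly compact sets\<close>

lemma topspace_weak_topology [simp]: "topspace weak_topology = UNIV"
proof -
  have "UNIV \<in> {f -` U | (f :: 'a \<Rightarrow> real) U. bounded_linear f \<and> open U}"
    by (rule CollectI, rule exI[of _ "\<lambda>_. 0"], rule exI[of _ UNIV]) simp
  then show ?thesis unfolding weak_topology_def topology_generated_by_topspace by blast
qed

lemma openin_weak_vimage: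
  fixes y :: "'a::real_normed_vector \<Rightarrow>\<^sub>L real"
  assumes "open U"
  shows "openin weak_topology (blinfun_apply y -` U)"
  unfolding weak_topology_def
  by (rule topology_generated_by_Basis) (use assms blinfun.bounded_linear_right in blast)

lemma openin_weak_halfspace:
  fixes y :: "'a::real_normed_vector \<Rightarrow>\<^sub>L real"
  shows "openin weak_topology {v. y v < a}" "openin weak_topology {v. a < y v}"
  using openin_weak_vimage[of "{..<a}" y] openin_weak_vimage[of "{a<..}" y]
  by (auto simp: vimage_def)

lemma closedin_weak_halfspace:
  fixes y :: "'a::real_normed_vector \<Rightarrow>\<^sub>L real"
  shows "closedin weak_topology {v. y v \<le> a}" "closedin weak_topology {v. a \<le> y v}"
proof -
  have *: "UNIV - {v. y v \<le> a} = {v. a < y v}" "UNIV - {v. a \<le> y v} = {v. y v < a}" by auto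
  show "closedin weak_topology {v. y v \<le> a}"
    unfolding closedin_def topspace_weak_topology *(1) using openin_weak_halfspace(2) by blast
  show "closedin weak_topology {v. a \<le> y v}"
    unfolding closedin_def topspace_weak_topology *(2) using openin_weak_halfspace(1) by blast
qed

lemma continuous_map_weak_blinfun:
  fixes y :: "'a::real_normed_vector \<Rightarrow>\<^sub>L real"
  shows "continuous_map weak_topology euclidean (blinfun_apply y)"
proof -
  have "openin weak_topology {x. blinfun_apply y x \<in> U}" if "open U" for U
    using openin_weak_vimage[OF that, of y] by (simp add: vimage_def)
  then show ?thesis by (simp add: continuous_map_def)
qed

text \<open>Mazur's theorem: separating \<open>C - v\<close> from a ball around 0 gives a weakly
  open half-space that contains \<open>v\<close> and misses \<open>C\<close>.\<close>

lemma closed_convex_imp_weakly_closed: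
  fixes C :: "'a::real_normed_vector set"
  assumes "closed C" "convex C"
  shows "closedin weak_topology C"
proof (cases "C = {}")
  case False
  have "\<exists>T. openin weak_topology T \<and> v \<in> T \<and> T \<subseteq> UNIV - C" if v: "v \<in> UNIV - C" for v
  proof -
    obtain e where e: "e > 0" "ball v e \<subseteq> - C"
      using assms(1) v by (metis Compl_eq_Diff_UNIV open_Compl open_contains_ball)
    have "e \<le> norm (c - v)" if "c \<in> C" for c
      using e(2) that by (metis ComplD dist_commute dist_norm in_mono mem_ball not_le)
    then have "\<And>d. d \<in> (\<lambda>c. c - v) ` C \<Longrightarrow> e \<le> norm d" by blast
    moreover have "convex ((\<lambda>c. c - v) ` C)"
      by (rule convex_translation_subtract[OF assms(2)])
    ultimately obtain y :: "'a \<Rightarrow>\<^sub>L real" where "\<And>d. d \<in> (\<lambda>c. c - v) ` C \<Longrightarrow> e \<le> y d"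
      using separation_by_blinfun[of "(\<lambda>c. c - v) ` C" e] False by blast
    then have y: "e \<le> y (c - v)" if "c \<in> C" for c using that by blast
    have "{u. y u < y v + e} \<subseteq> UNIV - C"
      using y by (fastforce simp: blinfun.diff_right)
    then show ?thesis
      using openin_weak_halfspace(1)[of y "y v + e"] e(1) by (intro exI[of _ "{u. y u < y v + e}"]) auto
  qed
  then have "openin weak_topology (UNIV - C)" by (subst openin_subopen) blast
  then show ?thesis by (simp add: closedin_def)
qed simp

lemma weakly_compact_attains_sup:
  fixes y :: "'a::real_normed_vector \<Rightarrow>\<^sub>L real"
  assumes "compactin weak_topology K" "K \<noteq> {}"
  obtains m where "m \<in> K" "\<And>k. k \<in> K \<Longrightarrow> y k \<le> y m"
proof -
  have "compact (blinfun_apply y ` K)"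
    using image_compactin[OF assms(1) continuous_map_weak_blinfun] by simp
  then obtain s where "s \<in> blinfun_apply y ` K" "\<forall>t\<in>blinfun_apply y ` K. t \<le> s"
    using compact_attains_sup[of "blinfun_apply y ` K"] assms(2) by auto
  then show ?thesis using that by auto
qed

text \<open>Uniform boundedness through Baire's theorem in the dual, which is complete: the closed
  sets \<open>B n\<close> cover it since every functional is bounded on \<open>K\<close>, so one of
  them contains a ball.\<close>

lemma weakly_compact_imp_bounded:
  fixes K :: "'a::real_normed_vector set"
  assumes K: "compactin weak_topology K"
  shows "bounded K"
proof -
  define B where "B n = (\<Inter>k\<in>K. {y :: 'a \<Rightarrow>\<^sub>L real. \<bar>y k\<bar> \<le> real n})" for n :: nat
  have clB: "closed (B n)" for n
    unfolding B_def by (intro closed_INT ballI closed_Collect_le continuous_intros)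
  have un: "(\<Union>n. B n) = UNIV"
  proof -
    have "\<exists>n. y \<in> B n" for y
    proof -
      have "compact (blinfun_apply y ` K)"
        using image_compactin[OF K continuous_map_weak_blinfun] by simp
      then obtain b where b: "\<And>k. k \<in> K \<Longrightarrow> \<bar>y k\<bar> \<le> b"
        using compact_imp_bounded bounded_iff by (metis image_eqI real_norm_def)
      obtain n where "b \<le> real n" using real_arch_simple by blast
      then have "y \<in> B n" using b unfolding B_def by fastforce
      then show ?thesis ..
    qed
    then show ?thesis by auto
  qed
  have "\<exists>n. interior (B n) \<noteq> {}"
  proof (rule ccontr)
    assume "\<not> ?thesis"
    then have "Met_TC.mtopology interior_of \<Union>(range B) = {}"
      using clB complete_UNIV
      by (intro Met_TC.metric_Baire_category_alt) (auto simp: mcomplete_iff_complete)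
    then show False by (simp add: un)
  qed
  then obtain n y0 where y0: "y0 \<in> interior (B n)" by blast
  then obtain r where r: "r > 0" "cball y0 r \<subseteq> B n"
    by (meson mem_interior_cball)
  have "norm k \<le> 2 * real n / r" if k: "k \<in> K" for k
  proof (rule norm_le_if_blinfun_le)
    fix y :: "'a \<Rightarrow>\<^sub>L real" assume y: "norm y \<le> 1"
    have "y0 + r *\<^sub>R y \<in> B n" "y0 \<in> B n"
      using r y by (auto intro!: subsetD[OF r(2)] simp: dist_norm)
    then have "\<bar>y0 k + r * y k\<bar> \<le> n" "\<bar>y0 k\<bar> \<le> n"
      using k unfolding B_def by (auto simp: blinfun.add_left blinfun.scaleR_left)
    then have "r * y k \<le> 2 * n" by linarith
    then show "y k \<le> 2 * real n / r" using r(1) by (simp add: field_simps)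
  qed
  then show ?thesis unfolding bounded_iff by blast
qed

lemma weakly_compact_translation:
  fixes K :: "'a::real_normed_vector set"
  assumes "compactin weak_topology K"
  shows "compactin weak_topology ((\<lambda>x. x + c) ` K)"
proof (rule image_compactin[OF assms])
  show "continuous_map weak_topology weak_topology (\<lambda>x. x + c)"
    
  proof (subst (2) weak_topology_def, rule continuous_on_generated_topo, goal_cases)
    case (1 U)
    then obtain f :: "'a \<Rightarrow> real" and V where U: "U = f -` V" "bounded_linear f" "open V" by auto
    have "(\<lambda>x. x + c) -` U = f -` ((\<lambda>t. t - f c) ` V)"
    proof -
      have "f (x + c) \<in> V \<longleftrightarrow> f x \<in> (\<lambda>t. t - f c) ` V" for x
        using linear_add[OF bounded_linear.linear[OF U(2)], of x c]
        by (auto simp: image_iff) (metis add_diff_cancel_right')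
      then show ?thesis unfolding U(1) by auto
    qed
    moreover have "open ((\<lambda>t. t - f c) ` V)"
      using open_translation_subtract[OF U(3)] .
    ultimately show ?case
      using openin_weak_vimage[of "(\<lambda>t. t - f c) ` V" "Blinfun f"] U(2)
      by (simp add: bounded_linear_Blinfun_apply)
  next
    case 2
    show ?case
      using topspace_weak_topology[where 'a = 'a] unfolding weak_topology_def topology_generated_by_topspace by simp
  qed
qed

lemma weakly_compact_nest:
  assumes C: "\<And>n::nat. compactin weak_topology (C n)" "\<And>n. closedin weak_topology (C n)"
    and ne: "\<And>n. C n \<noteq> {}" and dec: "\<And>m n. m \<le> n \<Longrightarrow> C n \<subseteq> C m"
  shows "(\<Inter>n. C n) \<noteq> {}"
proof -
  have "compact_space (subtopology weak_topology (C 0))"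
    using C(1)[of 0] by (simp add: compact_space_subtopology)
  moreover have "closedin (subtopology weak_topology (C 0)) (C n)" for n
    using C(2)[of n] dec[of 0 n] by (simp add: closedin_closed_subtopology[OF C(2)])
  ultimately show ?thesis
    by (intro compact_space_imp_nest) (use ne dec in \<open>auto simp: decseq_def\<close>)
qed

lemma cwk_convex: "A \<in> cwk \<Longrightarrow> convex A"
  and cwk_nonempty: "A \<in> cwk \<Longrightarrow> A \<noteq> {}"
  and cwk_weakly_compact: "A \<in> cwk \<Longrightarrow> compactin weak_topology A"
  by (simp_all add: cwk_def)

lemma cwk_bounded: "A \<in> cwk \<Longrightarrow> bounded A"
  by (simp add: cwk_def weakly_compact_imp_bounded)

lemma cwk_translation:
  assumes "A \<in> cwk"
  shows "(\<lambda>x. x + c) ` A \<in> cwk"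
proof -
  have "convex ((\<lambda>x. x + c) ` A)"
    using convex_translation[OF cwk_convex[OF assms], of c] by (simp add: add.commute[of _ c])
  then show ?thesis
    using assms weakly_compact_translation[of A c] by (simp add: cwk_def)
qed

section \<open>Strongly exposed points\<close>

text \<open>Lists make countability immediate for countable \<open>S\<close>. The closure is then
  norm separable and convex, hence weakly closed, so weak cluster points of countably many points
  stay in a separable set.\<close>

definition rational_span :: "'a::real_vector set \<Rightarrow> 'a set" where
  "rational_span S = (\<lambda>l. \<Sum>(q, s)\<leftarrow>l. q *\<^sub>R s) ` lists (\<rat> \<times> S)"

lemma countable_rational_span: "countable S \<Longrightarrow> countable (rational_span S)"
  unfolding rational_span_def
  by (intro countable_image countable_lists countable_SIGMA countable_rat)

lemma rational_span_superset: "S \<subseteq> rational_span S"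
proof
  fix s assume "s \<in> S"
  then show "s \<in> rational_span S"
    unfolding rational_span_def by (intro image_eqI[of _ _ "[(1, s)]"]) auto
qed

lemma rational_span_add:
  assumes "u \<in> rational_span S" "v \<in> rational_span S"
  shows "u + v \<in> rational_span S"
proof -
  obtain k l where "k \<in> lists (\<rat> \<times> S)" "l \<in> lists (\<rat> \<times> S)"
    "u = (\<Sum>(q, s)\<leftarrow>k. q *\<^sub>R s)" "v = (\<Sum>(q, s)\<leftarrow>l. q *\<^sub>R s)"
    using assms unfolding rational_span_def by auto
  then show ?thesis
    unfolding rational_span_def by (intro image_eqI[of _ _ "k @ l"]) auto
qed

lemma rational_span_scale:
  assumes "u \<in> rational_span S" "r \<in> \<rat>"
  shows "r *\<^sub>R u \<in> rational_span S"
proof -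
  have "\<exists>k\<in>lists (\<rat> \<times> S). r *\<^sub>R (\<Sum>(q, s)\<leftarrow>l. q *\<^sub>R s) = (\<Sum>(q, s)\<leftarrow>k. q *\<^sub>R s)"
    if "l \<in> lists (\<rat> \<times> S)" for l
    using that
  proof (induction l)
    case Nil
    then show ?case by (intro bexI[of _ "[]"]) auto
  next
    case (Cons a l)
    then obtain k where k: "k \<in> lists (\<rat> \<times> S)"
      "r *\<^sub>R (\<Sum>(q, s)\<leftarrow>l. q *\<^sub>R s) = (\<Sum>(q, s)\<leftarrow>k. q *\<^sub>R s)" by auto
    show ?case
      using Cons.hyps k assms(2)
      by (intro bexI[of _ "(r * fst a, snd a) # k"]) (auto simp: scaleR_add_right)
  qed
  then show ?thesis using assms(1) unfolding rational_span_def image_iff by metis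
qed

lemma convex_closure_rational_span:
  fixes S :: "'a::real_normed_vector set"
  shows "convex (closure (rational_span S))"
proof (rule convexI)
  fix x y :: 'a and u v :: real
  assume xy: "x \<in> closure (rational_span S)" "y \<in> closure (rational_span S)"
  obtain X Y where X: "\<And>n. X n \<in> rational_span S" "X \<longlonglongrightarrow> x"
    and Y: "\<And>n. Y n \<in> rational_span S" "Y \<longlonglongrightarrow> y"
    using xy unfolding closure_sequential by metis
  have rat: "\<exists>R. (\<forall>n. R n \<in> \<rat>) \<and> R \<longlonglongrightarrow> t" for t :: real
    using Rats_closure_real by (metis UNIV_I closure_sequential)
  obtain U where U: "\<And>n. U n \<in> \<rat>" "U \<longlonglongrightarrow> u" using rat by blast
  obtain V where V: "\<And>n. V n \<in> \<rat>" "V \<longlonglongrightarrow> v" using rat by blast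
  have "(\<lambda>n. U n *\<^sub>R X n + V n *\<^sub>R Y n) \<longlonglongrightarrow> u *\<^sub>R x + v *\<^sub>R y"
    using X Y U V by (intro tendsto_intros)
  moreover have "U n *\<^sub>R X n + V n *\<^sub>R Y n \<in> rational_span S" for n
    using X Y U V by (intro rational_span_add rational_span_scale)
  ultimately show "u *\<^sub>R x + v *\<^sub>R y \<in> closure (rational_span S)"
    unfolding closure_sequential
    by (intro exI[of _ "\<lambda>n. U n *\<^sub>R X n + V n *\<^sub>R Y n"]) simp
qed

lemma countable_if_separated:
  fixes D :: "'a::metric_space set"
  assumes D: "countable D" and T: "T \<subseteq> closure D" and e: "e > 0"
    and sep: "\<And>x y. x \<in> T \<Longrightarrow> y \<in> T \<Longrightarrow> x \<noteq> y \<Longrightarrow> e \<le> dist x y"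
  shows "countable T"
proof -
  have "\<exists>d\<in>D. dist d x < e / 2" if "x \<in> T" for x
    using that T e closure_approachable[of x D] by (meson half_gt_zero subsetD)
  then obtain g where g: "\<And>x. x \<in> T \<Longrightarrow> g x \<in> D" "\<And>x. x \<in> T \<Longrightarrow> dist (g x) x < e / 2" by metis
  have "inj_on g T"
  proof (rule inj_onI, rule ccontr)
    fix x y assume xy: "x \<in> T" "y \<in> T" "g x = g y" "x \<noteq> y"
    have "dist x y \<le> dist (g x) x + dist (g y) y"
      using dist_triangle[of x y "g x"] xy(3) by (simp add: dist_commute)
    with g(2)[OF xy(1)] g(2)[OF xy(2)] sep[OF xy(1,2,4)] show False by simp
  qed
  moreover have "countable (g ` T)"
    using g(1) D by (meson countable_subset image_subsetI)
  ultimately show ?thesis by (rule countable_image_inj_on[rotated])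
qed

lemma uncountable_bool_seq: "\<not> countable (UNIV :: (nat \<Rightarrow> bool) set)"
proof
  assume "countable (UNIV :: (nat \<Rightarrow> bool) set)"
  then have "countable (range (\<lambda>A::nat set. (\<lambda>n. n \<in> A)))"
    by (rule countable_subset[rotated]) simp
  then have "countable (UNIV :: nat set set)"
    by (rule countable_image_inj_on) (auto simp: inj_on_def fun_eq_iff)
  then obtain f :: "nat \<Rightarrow> nat set" where "range f = UNIV"
    by (metis UNIV_not_empty uncountable_def)
  then show False using Cantors_theorem[of "UNIV :: nat set"] by (metis Pow_UNIV)
qed

text \<open>If every nonempty relatively weakly open piece of \<open>E\<close> had diameter above \<open>\<epsilon>\<close>, a Cantor
  scheme of such pieces would give, for every 0-1 sequence, a weak cluster point of countably many
  chosen points. These cluster points are \<open>\<epsilon>\<close>-separated and lie in one norm separable set.\<close>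

lemma weakly_compact_fragmented:
  fixes E :: "'a::real_normed_vector set"
  assumes E: "compactin weak_topology E" "closedin weak_topology E" "E \<noteq> {}" and \<epsilon>: "\<epsilon> > 0"
  obtains V where "openin weak_topology V" "E \<inter> V \<noteq> {}"
    "\<And>u v. u \<in> E \<inter> V \<Longrightarrow> v \<in> E \<inter> V \<Longrightarrow> norm (u - v) \<le> \<epsilon>"
proof (rule ccontr)
  note found = that
  assume no: "\<not> thesis"
  have big: "\<exists>u\<in>E \<inter> V. \<exists>v\<in>E \<inter> V. \<epsilon> < norm (u - v)"
    if V: "openin weak_topology V" "E \<inter> V \<noteq> {}" for V
    by (rule ccontr) (use no found[OF V] in \<open>auto simp: not_less\<close>)
  let ?cl = "\<lambda>V. weak_topology closure_of V"
  define good where "good V \<longleftrightarrow> openin weak_topology V \<and> E \<inter> V \<noteq> {}" for V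
  \<comment> \<open>One splitting step of the scheme. The two pieces are cut off by half-spaces
    whose weakly closed versions contain the weak closures of the pieces, so the separation by
    \<open>\<epsilon>\<close> survives the passage to cluster points.\<close>
  have "\<exists>S. (\<forall>b. good (S b) \<and> S b \<subseteq> V) \<and>
      (\<forall>u\<in>?cl (S True). \<forall>v\<in>?cl (S False). \<epsilon> \<le> norm (u - v))" if V: "good V" for V
  proof -
    obtain u v where uv: "u \<in> E \<inter> V" "v \<in> E \<inter> V" "\<epsilon> < norm (u - v)"
      using big V unfolding good_def by blast
    obtain y :: "'a \<Rightarrow>\<^sub>L real" where y: "norm y \<le> 1" "y (u - v) = norm (u - v)"
      by (rule norming_blinfun)
    \<comment> \<open>The surplus of \<open>y u - y v\<close> over \<open>\<epsilon>\<close> is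
      split equally, so that both inequalities in \<open>yuv\<close> are strict.\<close>
    define a where "a = (y u + y v - \<epsilon>) / 2"
    have yuv: "y u > a + \<epsilon>" "y v < a"
      using uv(3) y(2) by (auto simp: a_def blinfun.diff_right field_simps)
    define S where "S b = (if b then V \<inter> {z. a + \<epsilon> < y z} else V \<inter> {z. y z < a})" for b
    have "good (S b) \<and> S b \<subseteq> V" for b
      using V uv yuv openin_weak_halfspace unfolding good_def S_def by (auto intro!: openin_Int)
    moreover have "\<epsilon> \<le> norm (p - q)" if "p \<in> ?cl (S True)" "q \<in> ?cl (S False)" for p q
    proof -
      have "?cl (S True) \<subseteq> {z. a + \<epsilon> \<le> y z}" "?cl (S False) \<subseteq> {z. y z \<le> a}"
        by (rule closure_of_minimal; auto simp: S_def closedin_weak_halfspace)+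
      then have "\<epsilon> \<le> y (p - q)"
        using that by (force simp: blinfun.diff_right)
      also have "\<dots> \<le> norm (p - q)" using abs_blinfun_le_norm[OF y(1), of "p - q"] by simp
      finally show ?thesis .
    qed
    ultimately show ?thesis by blast
  qed
  then obtain S where S: "\<And>V b. good V \<Longrightarrow> good (S V b) \<and> S V b \<subseteq> V"
    "\<And>V u v. good V \<Longrightarrow> u \<in> ?cl (S V True) \<Longrightarrow> v \<in> ?cl (S V False) \<Longrightarrow> \<epsilon> \<le> norm (u - v)"
    by metis
  define N where "N bs = foldl S UNIV bs" for bs :: "bool list"
  have goodN: "good (N bs)" for bs
  proof (induction bs rule: rev_induct)
    case Nil
    have "openin weak_topology (UNIV :: 'a set)"
      using openin_topspace[of "weak_topology :: 'a topology"] by simp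
    then show ?case using E by (simp add: N_def good_def)
  qed (use S in \<open>simp add: N_def\<close>)
  have Nsnoc: "N (bs @ [b]) = S (N bs) b" for bs b by (simp add: N_def)
  have Nmono: "N (bs @ cs) \<subseteq> N bs" for bs cs
  proof (induction cs rule: rev_induct)
    case (snoc c cs)
    then show ?case using S(1)[OF goodN, of "bs @ cs" c] Nsnoc[of "bs @ cs" c] by auto
  qed simp
  have "\<exists>p. p \<in> E \<inter> N bs" for bs
    using goodN[of bs] unfolding good_def by blast
  then obtain x where x: "\<And>bs. x bs \<in> E \<inter> N bs" by metis
  define D where "D = rational_span (range x)"
  have D: "countable D" "closedin weak_topology (closure D)" "\<And>bs. x bs \<in> closure D"
    using rational_span_superset[of "range x"] closure_subset[of D]
    by (auto simp: D_def intro!: countable_rational_span closed_convex_imp_weakly_closed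
        convex_closure_rational_span)
  define br where "br \<sigma> n = map \<sigma> [0..<n]" for \<sigma> :: "nat \<Rightarrow> bool" and n
  have br_le: "\<exists>cs. br \<sigma> n = br \<sigma> m @ cs" if "m \<le> n" for \<sigma> m n
    using that unfolding br_def by (metis le_Suc_ex map_append upt_add_eq_append zero_le)
  have "\<exists>z. z \<in> closure D \<and> (\<forall>n. z \<in> ?cl (N (br \<sigma> n)))" for \<sigma>
  proof -
    \<comment> \<open>\<open>closure D\<close> joins the nest so that the limit point lies in a norm
      separable set. It is weakly closed and contains every \<open>x (br \<sigma> n)\<close>, hence
      the nest stays nonempty.\<close>
    define C where "C n = E \<inter> closure D \<inter> ?cl (N (br \<sigma> n))" for n
    have "closedin weak_topology (C n)" for n
      unfolding C_def using E D by (intro closedin_Int closedin_closure_of)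
    moreover have "compactin weak_topology (C n)" for n
      by (rule closed_compactin[OF E(1)]) (use calculation in \<open>auto simp: C_def\<close>)
    moreover have "x (br \<sigma> n) \<in> C n" for n
      using x D closure_of_subset[of "N (br \<sigma> n)" weak_topology] by (auto simp: C_def)
    moreover have "C n \<subseteq> C m" if mn: "m \<le> n" for m n
    proof -
      have "N (br \<sigma> n) \<subseteq> N (br \<sigma> m)" using br_le[OF mn, of \<sigma>] Nmono by metis
      then show ?thesis using closure_of_mono unfolding C_def by blast
    qed
    ultimately have "(\<Inter>n. C n) \<noteq> {}" by (intro weakly_compact_nest) blast+
    then show ?thesis by (auto simp: C_def)
  qed
  then have "\<exists>z. \<forall>\<sigma>. z \<sigma> \<in> closure D \<and> (\<forall>n. z \<sigma> \<in> ?cl (N (br \<sigma> n)))"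
    by (intro choice allI)
  then obtain z where "\<forall>\<sigma>. z \<sigma> \<in> closure D \<and> (\<forall>n. z \<sigma> \<in> ?cl (N (br \<sigma> n)))" ..
  then have z: "z \<sigma> \<in> closure D" "z \<sigma> \<in> ?cl (N (br \<sigma> n))" for \<sigma> n by blast+
  have sep: "\<epsilon> \<le> norm (z \<sigma> - z \<tau>)" if "\<sigma> \<noteq> \<tau>" for \<sigma> \<tau>
  proof -
    \<comment> \<open>At the first index where the sequences differ, both branches leave the same
      node, so the limit points lie in the weak closures of its two children.\<close>
    define n where "n = (LEAST n. \<sigma> n \<noteq> \<tau> n)"
    have "\<exists>n. \<sigma> n \<noteq> \<tau> n" using that by (simp add: fun_eq_iff)
    then have n: "\<sigma> n \<noteq> \<tau> n" unfolding n_def by (rule LeastI_ex)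
    have n_less: "\<sigma> k = \<tau> k" if "k < n" for k
      using not_less_Least[OF that[unfolded n_def]] by simp
    have eq: "br \<tau> n = br \<sigma> n" using n_less by (simp add: br_def)
    have "z \<rho> \<in> ?cl (S (N (br \<rho> n)) (\<rho> n))" for \<rho>
      using z(2)[of \<rho> "Suc n"] Nsnoc[of "br \<rho> n" "\<rho> n"] by (simp add: br_def)
    note m = this[of \<sigma>] this[of \<tau>, unfolded eq]
    show ?thesis
    proof (cases "\<sigma> n")
      case True
      then have "z \<sigma> \<in> ?cl (S (N (br \<sigma> n)) True)" "z \<tau> \<in> ?cl (S (N (br \<sigma> n)) False)"
        using m n by auto
      then show ?thesis by (rule S(2)[OF goodN])
    next
      case False
      then have "z \<tau> \<in> ?cl (S (N (br \<sigma> n)) True)" "z \<sigma> \<in> ?cl (S (N (br \<sigma> n)) False)"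
        using m n by auto
      then have "\<epsilon> \<le> norm (z \<tau> - z \<sigma>)" by (rule S(2)[OF goodN])
      then show ?thesis by (simp only: norm_minus_commute)
    qed
  qed
  have "countable (range z)"
  proof (rule countable_if_separated[OF D(1) _ \<epsilon>])
    fix u v assume "u \<in> range z" "v \<in> range z" "u \<noteq> v"
    then obtain \<sigma> \<tau> where "u = z \<sigma>" "v = z \<tau>" "\<sigma> \<noteq> \<tau>" by blast
    then show "\<epsilon> \<le> dist u v" using sep by (simp add: dist_norm)
  qed (use z in auto)
  moreover have "inj z"
  proof (rule injI, rule ccontr)
    fix \<sigma> \<tau> assume "z \<sigma> = z \<tau>" "\<sigma> \<noteq> \<tau>"
    then show False using sep[of \<sigma> \<tau>] \<epsilon> by simp
  qed
  ultimately have "countable (UNIV :: (nat \<Rightarrow> bool) set)"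
    by (rule countable_image_inj_on)
  then show False using uncountable_bool_seq by simp
qed

section \<open>Minimal norming sets, small slices and strong exposure\<close>

lemma Hausdorff_weak_topology: "Hausdorff_space (weak_topology :: 'a::real_normed_vector topology)"
  unfolding Hausdorff_space_def
proof (intro allI impI)
  fix u v :: 'a assume "u \<in> topspace weak_topology \<and> v \<in> topspace weak_topology \<and> u \<noteq> v"
  moreover obtain y :: "'a \<Rightarrow>\<^sub>L real" where "y (u - v) = norm (u - v)"
    using norming_blinfun by blast
  ultimately have "y u - y v > 0" by (simp add: blinfun.diff_right)
  then have "y u > y v" by simp
  then obtain a where "y v < a" "a < y u" using dense by blast
  then show "\<exists>U V. openin weak_topology U \<and> openin weak_topology V \<and> u \<in> U \<and> v \<in> V \<and> disjnt U V"
    by (intro exI[of _ "{w. a < y w}"] exI[of _ "{w. y w < a}"])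
      (auto simp: openin_weak_halfspace disjnt_def)
qed

lemma weakly_compact_imp_weakly_closed: "compactin weak_topology K \<Longrightarrow> closedin weak_topology K"
  by (rule compactin_imp_closedin[OF Hausdorff_weak_topology])

text \<open>Relativised to a set \<open>U\<close> of functionals: with \<open>U\<close> a small ball
  around \<open>y0\<close>, failure of the property produces a functional near \<open>y0\<close>,
  which is what density needs.\<close>

definition norming_subset :: "('a::real_normed_vector \<Rightarrow>\<^sub>L real) set \<Rightarrow> 'a set \<Rightarrow> 'a set \<Rightarrow> bool" where
  "norming_subset U K E \<longleftrightarrow>
     E \<subseteq> K \<and> closedin weak_topology E \<and> (\<forall>y\<in>U. \<exists>e\<in>E. \<forall>k\<in>K. y k \<le> y e)"

text \<open>The face of \<open>K\<close> on which \<open>y\<close> is maximal is weakly compact and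
  meets every member of the chain, so by the finite intersection property it meets the
  intersection.\<close>

lemma norming_subset_Inter_chain:
  fixes K :: "'a::real_normed_vector set"
  assumes K: "compactin weak_topology K" "K \<noteq> {}"
    and C: "C \<noteq> {}" "\<And>E. E \<in> C \<Longrightarrow> norming_subset U K E"
    and chain: "\<And>E F. E \<in> C \<Longrightarrow> F \<in> C \<Longrightarrow> E \<subseteq> F \<or> F \<subseteq> E"
  shows "norming_subset U K (\<Inter>C)"
  unfolding norming_subset_def
proof (intro conjI ballI)
  show "\<Inter>C \<subseteq> K" using C unfolding norming_subset_def by blast
  show "closedin weak_topology (\<Inter>C)"
    using C unfolding norming_subset_def by (intro closedin_Inter) auto
  fix y assume y: "y \<in> U"
  obtain m where m: "m \<in> K" "\<And>k. k \<in> K \<Longrightarrow> y k \<le> y m"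
    using weakly_compact_attains_sup[OF K] by blast
  define M where "M = K \<inter> {v. y m \<le> y v}"
  have "compactin weak_topology M"
    unfolding M_def using K(1) closedin_weak_halfspace(2)[of "y m" y]
    by (rule compact_Int_closedin)
  moreover have "\<exists>E\<in>C. E \<subseteq> \<Inter>\<F>" if "finite \<F>" "\<F> \<subseteq> C" for \<F>
    using that
  proof (induction \<F> rule: finite_induct)
    case empty
    then show ?case using C by auto
  next
    case (insert F \<F>)
    then obtain E where "E \<in> C" "E \<subseteq> \<Inter>\<F>" by auto
    then show ?case using chain[of E F] insert.prems by (metis Inter_insert insert_subset le_inf_iff order_refl order_trans)
  qed
  moreover have "M \<inter> E \<noteq> {}" if "E \<in> C" for E
    using C(2)[OF that] y m unfolding norming_subset_def M_def by fastforce
  ultimately have "M \<inter> \<Inter>C \<noteq> {}"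
    using C(2) unfolding compactin_fip norming_subset_def
    by (metis (no_types, lifting) Int_mono order_refl subset_empty)
  then obtain e where "e \<in> \<Inter>C" "y m \<le> y e" unfolding M_def by blast
  then show "\<exists>e\<in>\<Inter>C. \<forall>k\<in>K. y k \<le> y e" using m by (meson order_trans)
qed

lemma exists_minimal_norming_subset:
  fixes K :: "'a::real_normed_vector set"
  assumes K: "compactin weak_topology K" "K \<noteq> {}"
  obtains E where "norming_subset U K E" "\<And>F. norming_subset U K F \<Longrightarrow> F \<subseteq> E \<Longrightarrow> F = E"
proof -
  define A where "A = Collect (norming_subset U K)"
  have "\<exists>e\<in>K. \<forall>k\<in>K. y k \<le> y e" for y :: "'a \<Rightarrow>\<^sub>L real"
    using weakly_compact_attains_sup[OF K, of y] by metis
  then have "K \<in> A"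
    using weakly_compact_imp_weakly_closed[OF K(1)] unfolding A_def norming_subset_def by simp
  have "\<exists>E\<in>A. \<forall>F\<in>A. E \<supseteq> F \<longrightarrow> F = E"
  proof (rule predicate_Zorn)
    show "partial_order_on A (relation_of (\<supseteq>) A)"
      by (rule partial_order_on_relation_ofI) auto
    fix C assume "C \<in> Chains (relation_of (\<supseteq>) A)"
    then have C: "E \<in> A" "E \<subseteq> F \<or> F \<subseteq> E" if "E \<in> C" "F \<in> C" for E F
      using that unfolding Chains_def relation_of_def by blast+
    show "\<exists>u\<in>A. \<forall>a\<in>C. u \<subseteq> a"
    proof (cases "C = {}")
      case False
      have "norming_subset U K (\<Inter>C)"
        using C False by (intro norming_subset_Inter_chain[OF K]) (auto simp: A_def)
      then show ?thesis by (auto simp: A_def)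
    qed (use \<open>K \<in> A\<close> in auto)
  qed
  then show ?thesis using that unfolding A_def by auto
qed

text \<open>A minimal norming set \<open>E\<close> has a small weakly open piece. Removing the piece leaves a set
  that is no longer norming, so some functional in the ball attains its maximum over \<open>K\<close> only
  within that piece, with a gap; small perturbations of it do so as well, and this confines a
  whole slice of \<open>K\<close>.\<close>

lemma small_slices_dense:
  fixes K :: "'a::real_normed_vector set"
  assumes K: "compactin weak_topology K" "K \<noteq> {}" and "\<rho> > 0" "\<eta> > 0"
  obtains y :: "'a \<Rightarrow>\<^sub>L real" and \<alpha> z where "y \<in> ball y0 \<eta>" "\<alpha> > 0"
    "\<And>u. u \<in> K \<Longrightarrow> (\<And>k. k \<in> K \<Longrightarrow> y k \<le> y u + \<alpha>) \<Longrightarrow> norm (u - z) \<le> 2 * \<rho>"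
proof -
  let ?U = "ball y0 \<eta>"
  obtain E where E: "norming_subset ?U K E"
    and min: "\<And>F. norming_subset ?U K F \<Longrightarrow> F \<subseteq> E \<Longrightarrow> F = E"
    using exists_minimal_norming_subset[OF K] by blast
  have EK: "E \<subseteq> K" "closedin weak_topology E" using E by (auto simp: norming_subset_def)
  have cE: "compactin weak_topology E" using closed_compactin[OF K(1) EK] .
  have "E \<noteq> {}" using E \<open>\<eta> > 0\<close> unfolding norming_subset_def by (metis centre_in_ball empty_iff)
  obtain V where V: "openin weak_topology V" "E \<inter> V \<noteq> {}"
    "\<And>u v. u \<in> E \<inter> V \<Longrightarrow> v \<in> E \<inter> V \<Longrightarrow> norm (u - v) \<le> \<rho>"
    using weakly_compact_fragmented[OF cE EK(2) \<open>E \<noteq> {}\<close> \<open>\<rho> > 0\<close>] by blast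
  obtain z where z: "z \<in> E \<inter> V" using V(2) by blast
  have clEV: "closedin weak_topology (E - V)" using EK(2) V(1) by (rule closedin_diff)
  have "\<not> norming_subset ?U K (E - V)" using min[of "E - V"] V(2) by blast
  then obtain y where y: "y \<in> ?U" "\<And>e. e \<in> E - V \<Longrightarrow> \<exists>k\<in>K. y e < y k"
    using EK clEV unfolding norming_subset_def by (meson Diff_subset order_trans not_le)
  obtain m where m: "m \<in> K" "\<And>k. k \<in> K \<Longrightarrow> y k \<le> y m"
    using weakly_compact_attains_sup[OF K] by blast
  have "\<exists>\<alpha>>0. \<forall>e\<in>E - V. y e \<le> y m - \<alpha>"
  proof (cases "E - V = {}")
    case False
    have "compactin weak_topology (E - V)" using closed_compactin[OF cE _ clEV] by blast
    then obtain e0 where e0: "e0 \<in> E - V" "\<And>e. e \<in> E - V \<Longrightarrow> y e \<le> y e0"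
      using weakly_compact_attains_sup False by blast
    have "y e0 < y m" using y(2)[OF e0(1)] m(2) by fastforce
    then show ?thesis using e0 by (intro exI[of _ "y m - y e0"]) auto
  qed (auto intro: exI[of _ 1])
  then obtain \<alpha> where \<alpha>: "\<alpha> > 0" "\<And>e. e \<in> E - V \<Longrightarrow> y e \<le> y m - \<alpha>" by blast
  obtain b where b: "b > 0" "\<And>k. k \<in> K \<Longrightarrow> norm k \<le> b"
    using weakly_compact_imp_bounded[OF K(1)] bounded_pos by blast
  obtain d where d: "d > 0" "ball y d \<subseteq> ?U" using y(1) open_ball open_contains_ball by blast
  \<comment> \<open>\<open>d / 2\<close> keeps \<open>y + w\<close> in the ball, for which
    \<open>E\<close> is norming; \<open>\<alpha> / (4 * b)\<close> makes the change of values on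
    \<open>K\<close> too small to close the gap \<open>\<alpha>\<close>, so the maximiser of
    \<open>y + w\<close> found in \<open>E\<close> lies in \<open>V\<close>.\<close>
  define r where "r = min (d / 2) (\<alpha> / (4 * b))"
  have r: "r > 0" "r < d" "2 * r * b < \<alpha>"
    using d \<alpha>(1) b(1) by (auto simp: r_def min_def field_simps)
  have pert: "(y + w) u \<le> y m + w z + r * \<rho>" if w: "norm w \<le> r" and u: "u \<in> K" for w u
  proof -
    have wb: "\<bar>w k\<bar> \<le> r * b" if "k \<in> K" for k using abs_blinfun_le[OF w b(2)[OF that]] .
    have "y + w \<in> ?U" using w r by (intro subsetD[OF d(2)]) (auto simp: dist_norm)
    then obtain e where e: "e \<in> E" "\<And>k. k \<in> K \<Longrightarrow> (y + w) k \<le> (y + w) e"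
      using E unfolding norming_subset_def by blast
    have "e \<in> V"
    proof (rule ccontr)
      assume "e \<notin> V"
      then have "y e \<le> y m - \<alpha>" using \<alpha>(2) e(1) by blast
      moreover have "\<bar>w m\<bar> \<le> r * b" "\<bar>w e\<bar> \<le> r * b" using wb m(1) e(1) EK by auto
      ultimately show False using e(2)[OF m(1)] r(3) by (simp add: blinfun.add_left)
    qed
    then have "norm (e - z) \<le> \<rho>" using V(3) e(1) z by blast
    then have "w (e - z) \<le> r * \<rho>" using abs_blinfun_le[OF w, of "e - z" \<rho>] by simp
    moreover have "y e \<le> y m" using m(2) e(1) EK by blast
    ultimately show ?thesis using e(2)[OF u] by (simp add: blinfun.add_left blinfun.diff_right)
  qed
  show ?thesis
  proof
    show "y \<in> ?U" by fact
    \<comment> \<open>The slice has width \<open>r * \<rho>\<close>, and perturbing by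
      \<open>r *\<^sub>R x\<close> costs another \<open>r * \<rho>\<close> in \<open>pert\<close>.
      Dividing by \<open>r\<close> leaves \<open>2 * \<rho>\<close>, uniformly in
      \<open>x\<close>.\<close>
    show "r * \<rho> > 0" using r \<open>\<rho> > 0\<close> by simp
    fix u assume u: "u \<in> K" "\<And>k. k \<in> K \<Longrightarrow> y k \<le> y u + r * \<rho>"
    show "norm (u - z) \<le> 2 * \<rho>"
    proof (rule norm_le_if_blinfun_le)
      fix x :: "'a \<Rightarrow>\<^sub>L real" assume x: "norm x \<le> 1"
      have "(y + r *\<^sub>R x) u \<le> y m + (r *\<^sub>R x) z + r * \<rho>"
        using pert[of "r *\<^sub>R x" u] x r u(1) by simp
      then have "r * x (u - z) \<le> r * (2 * \<rho>)"
        using u(2)[OF m(1)] by (simp add: blinfun.add_left blinfun.scaleR_left blinfun.diff_right algebra_simps)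
      then show "x (u - z) \<le> 2 * \<rho>" using r(1) by simp
    qed
  qed
qed

text \<open>The functionals with a slice of radius \<open>1 / real (Suc n)\<close> form an open set,
  dense by \<open>small_slices_dense\<close>. By Baire's theorem in the dual some \<open>y\<close>
  lies in all of them; each of its slices contains its maximiser, so the slices shrink to that point
  in norm.\<close>

lemma exists_strongly_exposing:
  fixes K :: "'a::real_normed_vector set"
  assumes K: "compactin weak_topology K" "K \<noteq> {}"
  obtains y :: "'a \<Rightarrow>\<^sub>L real" and p where "p \<in> K" "\<And>k. k \<in> K \<Longrightarrow> y k \<le> y p"
    "\<And>\<epsilon>. \<epsilon> > 0 \<Longrightarrow> \<exists>\<alpha>>0. \<forall>u\<in>K. y p \<le> y u + \<alpha> \<longrightarrow> norm (u - p) \<le> \<epsilon>"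
proof -
  define G :: "nat \<Rightarrow> ('a \<Rightarrow>\<^sub>L real) set" where
    "G n = {y. \<exists>\<alpha>>0. \<exists>z. \<forall>u\<in>K. (\<forall>k\<in>K. blinfun_apply y k \<le> y u + \<alpha>) \<longrightarrow>
      norm (u - z) \<le> 1 / real (Suc n)}" for n
  obtain b where b: "b > 0" "\<And>k. k \<in> K \<Longrightarrow> norm k \<le> b"
    using weakly_compact_imp_bounded[OF K(1)] bounded_pos by blast
  have openG: "open (G n)" for n
    unfolding open_contains_ball
  proof (intro ballI)
    fix y assume "y \<in> G n"
    then obtain \<alpha> z where \<alpha>: "\<alpha> > 0"
      "\<And>u. u \<in> K \<Longrightarrow> (\<forall>k\<in>K. y k \<le> y u + \<alpha>) \<Longrightarrow> norm (u - z) \<le> 1 / real (Suc n)"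
      unfolding G_def by blast
    \<comment> \<open>Moving \<open>y\<close> by less than \<open>r\<close> changes its values on
      \<open>K\<close> by at most \<open>\<alpha> / 4\<close>, so the slice of \<open>x\<close> of
      width \<open>\<alpha> / 2\<close> lies in the slice of \<open>y\<close> of width
      \<open>\<alpha>\<close>.\<close>
    define r where "r = \<alpha> / (4 * b)"
    have "x \<in> G n" if x: "x \<in> ball y r" for x
    proof -
      have diff: "\<bar>x k - y k\<bar> \<le> \<alpha> / 4" if "k \<in> K" for k
        using abs_blinfun_le[OF _ b(2)[OF that], of "x - y" r] x b(1)
        by (simp add: dist_norm norm_minus_commute blinfun.diff_left r_def)
      have "norm (u - z) \<le> 1 / real (Suc n)" if u: "u \<in> K" "\<forall>k\<in>K. x k \<le> x u + \<alpha> / 2" for u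
      proof (rule \<alpha>(2)[OF u(1)], intro ballI)
        fix k assume k: "k \<in> K"
        have "x k \<le> x u + \<alpha> / 2" using u(2) k by blast
        then show "y k \<le> y u + \<alpha>" using diff[OF k] diff[OF u(1)] \<alpha>(1) by argo
      qed
      then show ?thesis unfolding G_def using \<alpha>(1)
        by (intro CollectI exI[of _ "\<alpha> / 2"] conjI exI[of _ z]) auto
    qed
    then show "\<exists>e>0. ball y e \<subseteq> G n"
      using \<alpha>(1) b(1) by (intro exI[of _ r]) (auto simp: r_def)
  qed
  have denseG: "closure (G n) = UNIV" for n
  proof -
    have "y0 \<in> closure (G n)" for y0
      unfolding closure_approachable
    proof (intro allI impI)
      fix e :: real assume e: "e > 0"
      define \<rho> where "\<rho> = 1 / (2 * real (Suc n))"
      have "\<rho> > 0" "2 * \<rho> = 1 / real (Suc n)" by (simp_all add: \<rho>_def field_simps)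
      obtain y :: "'a \<Rightarrow>\<^sub>L real" and \<alpha> z where y: "y \<in> ball y0 e" "\<alpha> > 0"
        "\<And>u. u \<in> K \<Longrightarrow> (\<And>k. k \<in> K \<Longrightarrow> y k \<le> y u + \<alpha>) \<Longrightarrow> norm (u - z) \<le> 2 * \<rho>"
        by (rule small_slices_dense[OF K \<open>\<rho> > 0\<close> e, of y0]) blast
      have "y \<in> G n"
        unfolding G_def \<open>2 * \<rho> = 1 / real (Suc n)\<close>[symmetric] using y(2,3) by blast
      moreover have "dist y y0 < e" using y(1) by (simp add: dist_commute)
      ultimately show "\<exists>y\<in>G n. dist y y0 < e" by blast
    qed
    then show ?thesis by blast
  qed
  have "Met_TC.mtopology closure_of \<Inter>(range G) = (UNIV :: ('a \<Rightarrow>\<^sub>L real) set)"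
    using openG denseG complete_UNIV
    by (intro Met_TC.metric_Baire_category) (auto simp: mcomplete_iff_complete)
  then have "\<Inter>(range G) \<noteq> {}" by force
  then obtain y where y: "\<And>n. y \<in> G n" by blast
  obtain p where p: "p \<in> K" "\<And>k. k \<in> K \<Longrightarrow> y k \<le> y p"
    using weakly_compact_attains_sup[OF K] by blast
  have "\<exists>\<alpha>>0. \<forall>u\<in>K. y p \<le> y u + \<alpha> \<longrightarrow> norm (u - p) \<le> \<epsilon>" if pos: "\<epsilon> > 0" for \<epsilon>
  proof -
    obtain n where n: "1 / real (Suc n) < \<epsilon> / 2" using nat_approx_posE[of "\<epsilon> / 2"] pos by (metis half_gt_zero)
    obtain \<alpha> z where \<alpha>: "\<alpha> > 0"
      "\<And>u. u \<in> K \<Longrightarrow> (\<forall>k\<in>K. y k \<le> y u + \<alpha>) \<Longrightarrow> norm (u - z) \<le> 1 / real (Suc n)"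
      using y[of n] unfolding G_def by blast
    have near: "norm (u - z) \<le> 1 / real (Suc n)" if "u \<in> K" "y p \<le> y u + \<alpha>" for u
      using \<alpha>(2)[OF that(1)] p(2) that(2) by (meson order_trans)
    have "norm (u - p) \<le> \<epsilon>" if "u \<in> K" "y p \<le> y u + \<alpha>" for u
      using near[OF that] near[OF p(1)] \<alpha>(1) n norm_triangle_ineq4[of "u - z" "p - z"] by simp
    then show ?thesis using \<alpha>(1) by blast
  qed
  then show ?thesis using that p by blast
qed

section \<open>Nonoverlapping families and dyadic windows\<close>

abbreviation len :: "real set \<Rightarrow> real" where
  "len \<equiv> measure lborel"

definition nonoverlapping :: "(real \<times> real set) set \<Rightarrow> bool" where
  "nonoverlapping Q \<longleftrightarrow> finite Q \<and> (\<forall>q\<in>Q. \<exists>a b. a \<le> b \<and> snd q = {a..b}) \<and>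
     (\<forall>q\<in>Q. \<forall>r\<in>Q. q \<noteq> r \<longrightarrow> interior (snd q) \<inter> interior (snd r) = {})"

lemma nonoverlapping_finite: "nonoverlapping Q \<Longrightarrow> finite Q"
  by (simp add: nonoverlapping_def)

lemma nonoverlapping_interval: "nonoverlapping Q \<Longrightarrow> q \<in> Q \<Longrightarrow> \<exists>a b. a \<le> b \<and> snd q = {a..b}"
  by (simp add: nonoverlapping_def)

lemma nonoverlapping_disjoint:
  "nonoverlapping Q \<Longrightarrow> q \<in> Q \<Longrightarrow> r \<in> Q \<Longrightarrow> q \<noteq> r \<Longrightarrow> interior (snd q) \<inter> interior (snd r) = {}"
  by (simp add: nonoverlapping_def)

lemma nonoverlapping_image: "nonoverlapping Q \<Longrightarrow> K \<in> snd ` Q \<Longrightarrow> \<exists>a b. a \<le> b \<and> K = {a..b}"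
  unfolding nonoverlapping_def by auto

lemma nonoverlapping_subset: "nonoverlapping Q \<Longrightarrow> R \<subseteq> Q \<Longrightarrow> nonoverlapping R"
  unfolding nonoverlapping_def by (meson finite_subset subsetD)

lemma partition01_nonoverlapping: "partition01 P \<Longrightarrow> nonoverlapping P"
  unfolding partition01_def nonoverlapping_def case_prod_unfold by simp

lemma Union_intervals: "(\<Union>(t, K)\<in>P. K) = \<Union>(snd ` P)"
  by force

lemma partition01_Union: "partition01 P \<Longrightarrow> \<Union>(snd ` P) = {0..1}"
  unfolding partition01_def Union_intervals by blast

lemma partition01_tag: "partition01 P \<Longrightarrow> q \<in> P \<Longrightarrow> fst q \<in> {0..1}"
  unfolding partition01_def case_prod_unfold by simp

lemma partition01I:
  assumes "nonoverlapping P" "\<And>q. q \<in> P \<Longrightarrow> fst q \<in> {0..1}" "\<Union>(snd ` P) = {0..1}"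
  shows "partition01 P"
  using assms nonoverlapping_interval[OF assms(1)]
  unfolding partition01_def nonoverlapping_def Union_intervals unfolding case_prod_unfold by simp

lemma nonoverlapping_division: "nonoverlapping Q \<Longrightarrow> snd ` Q division_of \<Union>(snd ` Q)"
proof (rule division_ofI)
  assume Q: "nonoverlapping Q"
  show "finite (snd ` Q)" using Q by (simp add: nonoverlapping_finite)
  show "K \<noteq> {}" "\<exists>a b. K = cbox a b" if "K \<in> snd ` Q" for K
    using nonoverlapping_image[OF Q that] by (auto simp: box_real)
  show "interior K \<inter> interior L = {}" if "K \<in> snd ` Q" "L \<in> snd ` Q" "K \<noteq> L" for K L
  proof -
    obtain q r where "q \<in> Q" "r \<in> Q" "K = snd q" "L = snd r" using \<open>K \<in> snd ` Q\<close> \<open>L \<in> snd ` Q\<close> by blast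
    moreover from this have "q \<noteq> r" using \<open>K \<noteq> L\<close> by blast
    ultimately show ?thesis using nonoverlapping_disjoint[OF Q] by simp
  qed
qed auto

text \<open>Pairs with different tags may carry the same interval, but only a degenerate one;
  \<open>\<phi>\<close> has to vanish there for the sum over pairs to equal the sum over
  intervals.\<close>

lemma nonoverlapping_sum_snd:
  assumes Q: "nonoverlapping Q" and 0: "\<And>K. interior K = {} \<Longrightarrow> K \<in> snd ` Q \<Longrightarrow> \<phi> K = 0"
  shows "(\<Sum>q\<in>Q. \<phi> (snd q)) = sum \<phi> (snd ` Q)"
proof -
  have "sum \<phi> (snd ` Q) = sum (\<phi> \<circ> snd) Q"
  proof (rule sum.reindex_nontrivial[OF nonoverlapping_finite[OF Q]])
    fix q r assume "q \<in> Q" "r \<in> Q" "q \<noteq> r" "snd q = snd r"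
    then show "\<phi> (snd q) = 0" using nonoverlapping_disjoint[OF Q, of q r] 0[of "snd q"] by simp
  qed
  then show ?thesis by simp
qed

lemma content_interior_empty:
  assumes "nonoverlapping Q" "K \<in> snd ` Q" "interior K = {}"
  shows "len K = 0"
proof -
  obtain a b where "K = cbox a b"
    using nonoverlapping_image[OF assms(1,2)] by (auto simp: box_real)
  then show ?thesis using assms(3) by (simp add: content_eq_0_interior)
qed

lemma nonoverlapping_sum_content_le:
  assumes Q: "nonoverlapping Q" and V: "V \<in> lmeasurable" "\<And>q. q \<in> Q \<Longrightarrow> snd q \<subseteq> V"
  shows "(\<Sum>q\<in>Q. len (snd q)) \<le> measure lebesgue V"
proof -
  note D = nonoverlapping_division[OF Q]
  have "(\<Sum>q\<in>Q. len (snd q)) = sum len (snd ` Q)"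
    by (rule nonoverlapping_sum_snd[OF Q]) (rule content_interior_empty[OF Q])
  also have "\<dots> = measure lebesgue (\<Union>(snd ` Q))"
  proof -
    have "len K = measure lebesgue K" if K: "K \<in> snd ` Q" for K
    proof -
      obtain a b where "K = {a..b}" using nonoverlapping_image[OF Q K] by blast
      then show ?thesis by simp
    qed
    then have "sum len (snd ` Q) = sum (measure lebesgue) (snd ` Q)" by (rule sum.cong[OF refl])
    then show ?thesis using content_division[OF D] by simp
  qed
  also have "\<dots> \<le> measure lebesgue V"
  proof (rule measure_mono_fmeasurable[OF _ _ V(1)])
    show "\<Union>(snd ` Q) \<subseteq> V" using V(2) by blast
    show "\<Union>(snd ` Q) \<in> sets lebesgue" using lmeasurable_division[OF D] by (rule fmeasurableD)
  qed
  finally show ?thesis .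
qed

lemma nonoverlapping_sum_integral:
  fixes f :: "real \<Rightarrow> real"
  assumes Q: "nonoverlapping Q" and f: "f integrable_on {0..1}" and sub: "\<And>q. q \<in> Q \<Longrightarrow> snd q \<subseteq> {0..1}"
  shows "(f has_integral (\<Sum>q\<in>Q. integral (snd q) f)) (\<Union>(snd ` Q))"
proof -
  have "integral K f = 0" if K: "interior K = {}" "K \<in> snd ` Q" for K
  proof -
    obtain a b where "K = cbox a b"
      using nonoverlapping_image[OF Q K(2)] by (auto simp: box_real)
    then show ?thesis using K(1) integral_null[of a b f] by (simp add: content_eq_0_interior)
  qed
  then have "(\<Sum>q\<in>Q. integral (snd q) f) = (\<Sum>K\<in>snd ` Q. integral K f)"
    by (rule nonoverlapping_sum_snd[OF Q])
  moreover have "\<Union>(snd ` Q) \<subseteq> {0..1}" using sub by blast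
  ultimately show ?thesis
    using has_integral_combine_division_topdown[OF f nonoverlapping_division[OF Q]] by simp
qed

lemma nonoverlapping_sum_integral_le:
  fixes f :: "real \<Rightarrow> real"
  assumes Q: "nonoverlapping Q" and f: "f integrable_on {0..1}" and sub: "\<And>q. q \<in> Q \<Longrightarrow> snd q \<subseteq> {0..1}"
    and nonneg: "\<And>t. t \<in> {0..1} \<Longrightarrow> 0 \<le> f t"
  shows "(\<Sum>q\<in>Q. integral (snd q) f) \<le> integral {0..1} f"
  by (rule has_integral_subset_le[OF _ nonoverlapping_sum_integral[OF Q f sub] integrable_integral[OF f]])
    (use sub nonneg in auto)

lemma sum_le_sum_fibres:
  fixes \<phi> :: "'q \<Rightarrow> real" and \<beta> :: "'c \<Rightarrow> real"
  assumes "finite Q" "\<And>c. c \<in> g ` Q \<Longrightarrow> (\<Sum>q | q \<in> Q \<and> g q = c. \<phi> q) \<le> \<beta> c"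
  shows "(\<Sum>q\<in>Q. \<phi> q) \<le> (\<Sum>c\<in>g ` Q. \<beta> c)"
  unfolding sum.image_gen[OF assms(1), of \<phi> g] by (rule sum_mono) (rule assms(2))

lemma sum_power_half_le:
  assumes "finite A"
  shows "(\<Sum>k\<in>A. (1/2)^k) \<le> (2::real)"
proof -
  have "(\<Sum>k\<in>A. (1/2::real)^k) \<le> (\<Sum>k. (1/2)^k)"
    using assms by (intro sum_le_suminf summable_geometric) auto
  then show ?thesis by (simp add: suminf_geometric)
qed

lemma has_bochner_integral_le:
  fixes f g :: "'b \<Rightarrow> real"
  assumes "has_bochner_integral M f x" "has_bochner_integral M g y" "\<And>s. f s \<le> g s"
  shows "x \<le> y"
  using integral_mono[of M f g] assms by (simp add: has_bochner_integral_iff)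

section \<open>Dyadic windows and their stacked weights\<close>

type_synonym window = "nat \<times> int"

definition win :: "window \<Rightarrow> real set" where
  "win w = {real_of_int (snd w) / 2 ^ fst w .. (real_of_int (snd w) + 1) / 2 ^ fst w}"

definition win_at :: "nat \<Rightarrow> real \<Rightarrow> window" where
  "win_at n t = (n, \<lfloor>2 ^ n * t\<rfloor>)"

lemma content_win: "len (win w) = 1 / 2 ^ fst w"
  unfolding win_def by (subst content_real) (auto simp: field_simps)

lemma interior_win:
  "interior (win w) = {real_of_int (snd w) / 2 ^ fst w <..< (real_of_int (snd w) + 1) / 2 ^ fst w}"
  unfolding win_def by (rule interior_atLeastAtMost_real)

lemma interior_win_nonempty: "interior (win w) \<noteq> {}"
proof -
  have "real_of_int (snd w) / 2 ^ fst w < (real_of_int (snd w) + 1) / 2 ^ fst w"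
    by (rule divide_strict_right_mono) auto
  then show ?thesis unfolding interior_win greaterThanLessThan_empty_iff by linarith
qed

lemma win_at_fst [simp]: "fst (win_at n t) = n"
  by (simp add: win_at_def)

lemma in_win_at: "t \<in> win (win_at n t)"
  unfolding win_def win_at_def by (auto simp: field_simps) linarith+

lemma interior_win_at:
  assumes "2 ^ n * t \<notin> \<int>"
  shows "t \<in> interior (win (win_at n t))"
proof -
  have "real_of_int \<lfloor>2 ^ n * t\<rfloor> < 2 ^ n * t"
    using assms by (metis Ints_of_int of_int_floor_le order_le_less)
  moreover have "2 ^ n * t < real_of_int \<lfloor>2 ^ n * t\<rfloor> + 1" by linarith
  ultimately show ?thesis unfolding interior_win win_at_def by (simp add: field_simps)
qed

lemma mem_interior_win:
  "t \<in> interior (win (n, j)) \<longleftrightarrow> real_of_int j < 2 ^ n * t \<and> 2 ^ n * t < real_of_int j + 1"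
  unfolding interior_win by (auto simp: field_simps)

text \<open>A common interior point gives, after scaling by \<open>2 ^ m\<close>, strict
  inequalities between integers; strictness sharpens each by one, and together they become
  containment.\<close>

lemma win_laminar_le:
  assumes n: "fst v \<le> fst w" and meet: "interior (win v) \<inter> interior (win w) \<noteq> {}"
  shows "win w \<subseteq> win v"
proof -
  obtain n j m i where vw: "v = (n, j)" "w = (m, i)" by fastforce
  then have nm: "n \<le> m" using n by simp
  define k where "k = m - n"
  have pow: "(2::real) ^ m = 2 ^ k * 2 ^ n" using nm by (simp add: k_def power_add[symmetric])
  obtain t where "t \<in> interior (win v)" "t \<in> interior (win w)" using meet by blast
  then have t: "real_of_int j < 2 ^ n * t" "2 ^ n * t < real_of_int j + 1"
    "real_of_int i < 2 ^ m * t" "2 ^ m * t < real_of_int i + 1"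
    unfolding vw mem_interior_win by auto
  have "2 ^ k * real_of_int j < 2 ^ m * t" "2 ^ m * t < 2 ^ k * (real_of_int j + 1)"
    using t(1,2) unfolding pow by (simp_all add: mult.assoc)
  with t have "real_of_int (2 ^ k * j) < real_of_int (i + 1)" "real_of_int i < real_of_int (2 ^ k * (j + 1))"
    by simp_all
  then have ij: "2 ^ k * j \<le> i" "i + 1 \<le> 2 ^ k * (j + 1)" by linarith+
  have "real_of_int j / 2 ^ n = real_of_int (2 ^ k * j) / 2 ^ m" unfolding pow by simp
  also have "\<dots> \<le> real_of_int i / 2 ^ m" using ij(1) by (intro divide_right_mono) (linarith, simp)
  finally have 1: "real_of_int j / 2 ^ n \<le> real_of_int i / 2 ^ m" .
  have "(real_of_int i + 1) / 2 ^ m \<le> real_of_int (2 ^ k * (j + 1)) / 2 ^ m"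
    using ij(2) by (intro divide_right_mono) (linarith, simp)
  also have "\<dots> = (real_of_int j + 1) / 2 ^ n" unfolding pow by simp
  finally show ?thesis using 1 unfolding vw win_def by auto
qed

lemma win_subset_eq:
  assumes "fst v = fst w" "win w \<subseteq> win v"
  shows "v = w"
proof -
  obtain n j i where vw: "v = (n, j)" "w = (n, i)" using assms(1) by (metis prod.collapse)
  have "real_of_int i / 2 ^ n \<le> (real_of_int i + 1) / 2 ^ n" by (simp add: divide_right_mono)
  then have "real_of_int j / 2 ^ n \<le> real_of_int i / 2 ^ n"
    "(real_of_int i + 1) / 2 ^ n \<le> (real_of_int j + 1) / 2 ^ n"
    using assms(2) unfolding vw win_def by auto
  then have "real_of_int j \<le> real_of_int i" "real_of_int i \<le> real_of_int j"
    by (simp_all add: divide_le_cancel)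
  then show ?thesis using vw by simp
qed

definition win_above :: "window \<Rightarrow> window \<Rightarrow> bool" where
  "win_above v w \<longleftrightarrow> fst v < fst w \<and> win w \<subseteq> win v"

lemma win_above_trans: "win_above u v \<Longrightarrow> win_above v w \<Longrightarrow> win_above u w"
  by (auto simp: win_above_def)

lemma windows_trichotomy:
  assumes "v \<noteq> w" "interior (win v) \<inter> interior (win w) \<noteq> {}"
  shows "win_above v w \<or> win_above w v"
proof -
  consider "fst v < fst w" | "fst w < fst v" | "fst v = fst w" by linarith
  then show ?thesis
  proof cases
    case 3
    then have "win w \<subseteq> win v" using win_laminar_le assms(2) by simp
    then show ?thesis using win_subset_eq[OF 3] assms(1) by simp
  qed (use win_laminar_le assms(2) in \<open>auto simp: win_above_def Int_commute\<close>)
qed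

text \<open>Weights of nested windows are stacked, coarse ones at the bottom: \<open>w\<close>
  occupies the levels from \<open>before \<W> p w\<close> up to
  \<open>before \<W> p w + p w\<close>, and \<open>heavy\<close> collects the windows whose slot
  reaches above \<open>C\<close>.\<close>

definition before :: "window set \<Rightarrow> (window \<Rightarrow> real) \<Rightarrow> window \<Rightarrow> real" where
  "before \<W> p w = (\<Sum>v | v \<in> \<W> \<and> win_above v w. p v)"

definition heavy :: "window set \<Rightarrow> (window \<Rightarrow> real) \<Rightarrow> real \<Rightarrow> window set" where
  "heavy \<W> p C = {w \<in> \<W>. C < before \<W> p w + p w}"

lemma before_nonneg: "(\<And>w. w \<in> \<W> \<Longrightarrow> 0 \<le> p w) \<Longrightarrow> 0 \<le> before \<W> p w"
  unfolding before_def by (rule sum_nonneg) auto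

lemma before_above:
  assumes fin: "finite \<W>" and p: "\<And>w. w \<in> \<W> \<Longrightarrow> 0 \<le> p w" and v: "v \<in> \<W>" "win_above v w"
  shows "before \<W> p v + p v \<le> before \<W> p w"
proof -
  let ?A = "{u. u \<in> \<W> \<and> win_above u v}"
  have "v \<notin> ?A" by (simp add: win_above_def)
  then have "before \<W> p v + p v = sum p (insert v ?A)"
    using fin by (simp add: before_def)
  also have "\<dots> \<le> before \<W> p w"
    unfolding before_def using fin p v win_above_trans[OF _ v(2)] by (intro sum_mono2) auto
  finally show ?thesis .
qed

text \<open>Markov's inequality for \<open>s \<mapsto> \<Sum>w\<ni>s. p w\<close>, which is at least \<open>C\<close> on every heavy window.\<close>

lemma measure_heavy_le:
  assumes fin: "finite \<W>" and p: "\<And>w. w \<in> \<W> \<Longrightarrow> 0 \<le> p w"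
  shows "C * measure lebesgue (\<Union>(win ` heavy \<W> p C)) \<le> (\<Sum>w\<in>\<W>. p w * len (win w))"
proof -
  let ?H = "\<Union>(win ` heavy \<W> p C)"
  define f where "f s = (\<Sum>w\<in>\<W>. p w * indicat_real (win w) s)" for s
  have win_m: "win w \<in> lmeasurable" for w by (simp add: win_def)
  have finH: "finite (heavy \<W> p C)" using fin by (simp add: heavy_def)
  have H: "?H \<in> lmeasurable" using finH win_m by (intro fmeasurable.finite_UN) auto
  have f: "has_bochner_integral lebesgue f (\<Sum>w\<in>\<W>. p w * measure lebesgue (win w))"
    unfolding f_def
  proof (intro has_bochner_integral_sum has_bochner_integral_mult_right)
    show "has_bochner_integral lebesgue (indicat_real (win w)) (measure lebesgue (win w))" for w
      using win_m[of w] by (intro has_bochner_integral_real_indicator) (auto simp only: fmeasurable_def mem_Collect_eq)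
  qed
  have g: "has_bochner_integral lebesgue (\<lambda>s. C * indicat_real ?H s) (C * measure lebesgue ?H)"
    using H by (intro has_bochner_integral_mult_right has_bochner_integral_real_indicator)
      (auto simp only: fmeasurable_def mem_Collect_eq)
  have "C * indicat_real ?H s \<le> f s" for s
  proof (cases "s \<in> ?H")
    case True
    then obtain w where w: "w \<in> \<W>" "C < before \<W> p w + p w" "s \<in> win w"
      by (auto simp: heavy_def)
    let ?A = "{v. v \<in> \<W> \<and> win_above v w}"
    have "w \<notin> ?A" by (simp add: win_above_def)
    then have "before \<W> p w + p w = sum p (insert w ?A)"
      using fin by (simp add: before_def)
    also have "\<dots> = (\<Sum>v\<in>insert w ?A. p v * indicat_real (win v) s)"
      using w by (intro sum.cong) (auto simp: win_above_def)
    also have "\<dots> \<le> f s"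
      unfolding f_def using fin p w by (intro sum_mono2) auto
    finally show ?thesis using w(2) True by simp
  next
    case False
    then show ?thesis using p by (auto simp: f_def intro!: sum_nonneg)
  qed
  then have "C * measure lebesgue ?H \<le> (\<Sum>w\<in>\<W>. p w * measure lebesgue (win w))"
    using has_bochner_integral_le[OF g f] by blast
  then show ?thesis by (simp add: win_def)
qed

text \<open>For each level \<open>u\<close> the windows \<open>w\<close> with \<open>before w \<le> u < before w + p w\<close> do not overlap;
  integrating over \<open>u\<close> writes the weighted sum as a mixture of sums over such families.\<close>

lemma light_sum_le:
  assumes fin: "finite \<W>" and p: "\<And>w. w \<in> \<W> \<Longrightarrow> 0 \<le> p w" and "0 \<le> C" "0 \<le> M"
    and a: "\<And>A. A \<subseteq> \<W> \<Longrightarrow>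
      (\<And>v w. v \<in> A \<Longrightarrow> w \<in> A \<Longrightarrow> v \<noteq> w \<Longrightarrow> interior (win v) \<inter> interior (win w) = {}) \<Longrightarrow>
      (\<Sum>w\<in>A. a w) \<le> M"
  shows "(\<Sum>w\<in>\<W> - heavy \<W> p C. p w * a w) \<le> C * M"
proof -
  let ?L = "\<W> - heavy \<W> p C"
  define J where "J w = {before \<W> p w ..< before \<W> p w + p w}" for w
  define g where "g u = (\<Sum>w\<in>?L. a w * indicat_real (J w) u)" for u
  have finL: "finite ?L" using fin by simp
  have bef: "before \<W> p v + p v \<le> before \<W> p w" if "v \<in> \<W>" "win_above v w" for v w
    by (rule before_above[OF fin _ that]) (rule p)
  have bef0: "0 \<le> before \<W> p w" for w
    by (rule before_nonneg) (rule p)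
  have g: "has_bochner_integral lborel g (\<Sum>w\<in>?L. a w * measure lborel (J w))"
    unfolding g_def
  proof (intro has_bochner_integral_sum has_bochner_integral_mult_right)
    fix w assume "w \<in> ?L"
    then have "0 \<le> p w" using p by simp
    then show "has_bochner_integral lborel (indicat_real (J w)) (measure lborel (J w))"
      unfolding J_def by (intro has_bochner_integral_real_indicator) simp_all
  qed
  have c: "has_bochner_integral lborel (\<lambda>u. M * indicat_real {0..C} u) (M * measure lborel {0..C})"
    using \<open>0 \<le> C\<close> by (intro has_bochner_integral_mult_right has_bochner_integral_real_indicator) auto
  have le: "g u \<le> M * indicat_real {0..C} u" for u
  proof (cases "u \<in> {0..C}")
    case True
    let ?A = "{w \<in> ?L. u \<in> J w}"
    have disj: "interior (win v) \<inter> interior (win w) = {}" if "v \<in> ?A" "w \<in> ?A" "v \<noteq> w" for v w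
    proof (rule ccontr)
      assume "interior (win v) \<inter> interior (win w) \<noteq> {}"
      then have "win_above v w \<or> win_above w v" using windows_trichotomy that by blast
      then show False
        using bef[of v w] bef[of w v] that by (auto simp: J_def)
    qed
    have "g u = (\<Sum>w\<in>?A. a w)"
      unfolding g_def using finL by (intro sum.mono_neutral_cong_right) (auto simp: indicator_def)
    also have "\<dots> \<le> M" by (rule a) (use disj in auto)
    finally show ?thesis using True by simp
  next
    case False
    \<comment> \<open>Windows that are not heavy have their slots inside \<open>{0..C}\<close>; the
      factor \<open>C\<close> of the bound comes from here.\<close>
    have "u \<notin> J w" if "w \<in> ?L" for w
      using that False bef0[of w] by (auto simp: J_def heavy_def)
    then have "g u = 0" unfolding g_def by (intro sum.neutral) auto
    then show ?thesis using False by simp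
  qed
  have "(\<Sum>w\<in>?L. a w * measure lborel (J w)) \<le> M * measure lborel {0..C}"
    using has_bochner_integral_le[OF g c] le by blast
  moreover have "(\<Sum>w\<in>?L. a w * measure lborel (J w)) = (\<Sum>w\<in>?L. p w * a w)"
    using p by (intro sum.cong) (auto simp: J_def)
  ultimately show ?thesis using \<open>0 \<le> C\<close> by (simp add: mult.commute)
qed

section \<open>From uniform Henstock to uniform McShane integrability\<close>

definition henstock_gauge ::
  "'i set \<Rightarrow> ('i \<Rightarrow> real \<Rightarrow> real) \<Rightarrow> (real \<Rightarrow> real) \<Rightarrow> real \<Rightarrow> bool" where
  "henstock_gauge T h \<delta> \<epsilon> \<longleftrightarrow> gauge01 \<delta> \<and>
     (\<forall>P. perron_partition01 P \<and> delta_fine \<delta> P \<longrightarrow>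
       (\<forall>x\<in>T. \<bar>(\<Sum>q\<in>P. len (snd q) * h x (fst q)) - integral {0..1} (h x)\<bar> < \<epsilon>))"

lemma delta_fine_iff:
  "delta_fine \<delta> P \<longleftrightarrow> (\<forall>q\<in>P. snd q \<subseteq> {fst q - \<delta> (fst q) <..< fst q + \<delta> (fst q)})"
  unfolding delta_fine_def case_prod_unfold by simp

lemma delta_fine_mono:
  assumes "delta_fine \<delta> P" "\<And>q. q \<in> P \<Longrightarrow> \<delta> (fst q) \<le> \<delta>' (fst q)"
  shows "delta_fine \<delta>' P"
  unfolding delta_fine_iff
proof
  fix q assume q: "q \<in> P"
  have "snd q \<subseteq> {fst q - \<delta> (fst q) <..< fst q + \<delta> (fst q)}"
    using assms(1) q by (simp add: delta_fine_iff)
  also have "\<dots> \<subseteq> {fst q - \<delta>' (fst q) <..< fst q + \<delta>' (fst q)}"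
    using assms(2)[OF q] by auto
  finally show "snd q \<subseteq> {fst q - \<delta>' (fst q) <..< fst q + \<delta>' (fst q)}" .
qed

text \<open>Radius 1 off \<open>{0..1}\<close> is a default: library gauges live on the whole line,
  while \<open>gauge01\<close> says nothing outside the interval.\<close>

definition ball_gauge :: "(real \<Rightarrow> real) \<Rightarrow> real \<Rightarrow> real set" where
  "ball_gauge \<delta> t = ball t (if t \<in> {0..1} then \<delta> t else 1)"

lemma gauge_ball_gauge: "gauge01 \<delta> \<Longrightarrow> gauge (ball_gauge \<delta>)"
  by (auto simp: gauge_def gauge01_def ball_gauge_def)

lemma ball_gauge_fine_iff:
  assumes "\<And>q. q \<in> P \<Longrightarrow> fst q \<in> {0..1}"
  shows "ball_gauge \<delta> fine P \<longleftrightarrow> delta_fine \<delta> P"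
proof -
  have "ball_gauge \<delta> (fst q) = {fst q - \<delta> (fst q) <..< fst q + \<delta> (fst q)}" if "q \<in> P" for q
    using assms[OF that] by (simp add: ball_gauge_def ball_eq_greaterThanLessThan)
  moreover have "ball_gauge \<delta> fine P \<longleftrightarrow> (\<forall>q\<in>P. snd q \<subseteq> ball_gauge \<delta> (fst q))"
    unfolding fine_def case_prod_unfold by simp
  ultimately show ?thesis by (simp add: delta_fine_iff)
qed

lemma nonoverlapping_tagged_partial:
  assumes Q: "nonoverlapping Q" and tag: "\<And>q. q \<in> Q \<Longrightarrow> fst q \<in> snd q" "\<And>q. q \<in> Q \<Longrightarrow> snd q \<subseteq> S"
  shows "Q tagged_partial_division_of S"
proof -
  have "\<exists>a b. K = cbox a b" if "(t, K) \<in> Q" for t K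
    using nonoverlapping_interval[OF Q that] by (auto simp: box_real)
  moreover have "interior K \<inter> interior L = {}"
    if "(t, K) \<in> Q" "(s, L) \<in> Q" "(t, K) \<noteq> (s, L)" for t K s L
    using nonoverlapping_disjoint[OF Q that] by simp
  ultimately show ?thesis
    using tag nonoverlapping_finite[OF Q] unfolding tagged_partial_division_of_def
    by (metis fst_conv snd_conv)
qed

text \<open>In the application \<open>T\<close> is the dual unit ball, \<open>h y t\<close> the
  support function of \<open>\<Gamma> t - f t\<close> at \<open>y\<close>, and \<open>b t\<close>
  the supremum of the norms in that set. \<open>b\<close> is only a pointwise bound, assumed neither
  measurable nor integrable.\<close>

locale uniform_henstock =
  fixes T :: "'i set" and h :: "'i \<Rightarrow> real \<Rightarrow> real" and b :: "real \<Rightarrow> real"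
  assumes h_nonneg: "x \<in> T \<Longrightarrow> t \<in> {0..1} \<Longrightarrow> 0 \<le> h x t"
    and h_le: "x \<in> T \<Longrightarrow> t \<in> {0..1} \<Longrightarrow> h x t \<le> b t"
    and b_nonneg: "t \<in> {0..1} \<Longrightarrow> 0 \<le> b t"
    and h_integrable: "x \<in> T \<Longrightarrow> h x integrable_on {0..1}"
    and h_uniform: "\<epsilon> > 0 \<Longrightarrow> \<exists>\<delta>. henstock_gauge T h \<delta> \<epsilon>"
begin

text \<open>Saks-Henstock lemma: what a gauge guarantees for whole Perron partitions it guarantees,
  with the same \<open>\<epsilon>\<close>, for families tagged in their own intervals. One gauge
  serves all \<open>x\<close> in \<open>T\<close>.\<close>

lemma henstock_partial:
  assumes \<delta>: "henstock_gauge T h \<delta> \<epsilon>" "\<epsilon> > 0" and x: "x \<in> T" and Q: "nonoverlapping Q"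
    and tag: "\<And>q. q \<in> Q \<Longrightarrow> fst q \<in> snd q" "\<And>q. q \<in> Q \<Longrightarrow> snd q \<subseteq> {0..1}" and fine: "delta_fine \<delta> Q"
  shows "\<bar>\<Sum>q\<in>Q. len (snd q) * h x (fst q) - integral (snd q) (h x)\<bar> \<le> \<epsilon>"
proof -
  have g01: "gauge01 \<delta>" using \<delta>(1) by (simp add: henstock_gauge_def)
  have "norm (sum (\<lambda>(t,K). len K *\<^sub>R h x t - integral K (h x)) Q) \<le> \<epsilon>"
  proof (rule Henstock_lemma_part1[of _ 0 1 _ "ball_gauge \<delta>"])
    show "h x integrable_on cbox 0 1" using h_integrable[OF x] by (simp add: box_real)
    show "\<epsilon> > 0" by fact
    show "gauge (ball_gauge \<delta>)" by (rule gauge_ball_gauge[OF g01])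
    show "Q tagged_partial_division_of cbox 0 1"
      by (rule nonoverlapping_tagged_partial[OF Q]) (use tag in \<open>auto simp: box_real\<close>)
    have "fst q \<in> {0..1}" if "q \<in> Q" for q using tag[OF that] by blast
    then show "ball_gauge \<delta> fine Q" using fine by (simp add: ball_gauge_fine_iff)
    fix p :: "(real \<times> real set) set" assume p: "p tagged_division_of cbox 0 1" "ball_gauge \<delta> fine p"
    then have pp: "perron_partition01 p" by (simp add: perron_partition01_iff box_real)
    then have "fst q \<in> {0..1}" if "q \<in> p" for q
      using partition01_tag[of p q] that pp by (simp add: perron_partition01_def)
    then have "delta_fine \<delta> p" using p(2) by (simp add: ball_gauge_fine_iff)
    with \<delta>(1) pp x show "norm ((\<Sum>(t,K)\<in>p. len K *\<^sub>R h x t) - integral (cbox 0 1) (h x)) < \<epsilon>"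
      unfolding henstock_gauge_def case_prod_unfold by (simp add: box_real)
  qed
  then show ?thesis by (simp add: case_prod_unfold)
qed

lemma henstock_windows:
  assumes \<delta>: "henstock_gauge T h \<delta> \<epsilon>" "\<epsilon> > 0" and x: "x \<in> T" and A: "finite A"
    and disj: "\<And>v w. v \<in> A \<Longrightarrow> w \<in> A \<Longrightarrow> v \<noteq> w \<Longrightarrow> interior (win v) \<inter> interior (win w) = {}"
    and \<sigma>: "\<And>w. w \<in> A \<Longrightarrow> \<sigma> w \<in> win w" "\<And>w. w \<in> A \<Longrightarrow> win w \<subseteq> {0..1}"
      "\<And>w. w \<in> A \<Longrightarrow> len (win w) < \<delta> (\<sigma> w)"
  shows "\<bar>\<Sum>w\<in>A. len (win w) * h x (\<sigma> w) - integral (win w) (h x)\<bar> \<le> \<epsilon>"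
proof -
  let ?f = "\<lambda>w. (\<sigma> w, win w)"
  have inj: "inj_on ?f A"
  proof (rule inj_onI, rule ccontr)
    fix v w assume "v \<in> A" "w \<in> A" "?f v = ?f w" "v \<noteq> w"
    then show False using disj[of v w] interior_win_nonempty[of v] by simp
  qed
  have "\<bar>\<Sum>q\<in>?f ` A. len (snd q) * h x (fst q) - integral (snd q) (h x)\<bar> \<le> \<epsilon>"
  proof (rule henstock_partial[OF \<delta> x])
    show "nonoverlapping (?f ` A)"
      unfolding nonoverlapping_def
    proof (intro conjI ballI impI)
      show "finite (?f ` A)" using A by simp
      show "\<exists>a b. a \<le> b \<and> snd q = {a..b}" if q: "q \<in> ?f ` A" for q
      proof -
        obtain w where "q = ?f w" using q by blast
        then have "snd q = win w" by simp
        then show ?thesis unfolding win_def by (metis add_increasing2 divide_right_mono order_refl zero_le_numeral zero_le_one zero_le_power)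
      qed
      show "interior (snd q) \<inter> interior (snd r) = {}"
        if qr: "q \<in> ?f ` A" "r \<in> ?f ` A" "q \<noteq> r" for q r
      proof -
        obtain v w where "v \<in> A" "w \<in> A" "q = ?f v" "r = ?f w" using qr(1,2) by (elim imageE) simp
        moreover from this have "v \<noteq> w" using qr(3) by blast
        ultimately show ?thesis using disj by simp
      qed
    qed
    show "delta_fine \<delta> (?f ` A)"
      unfolding delta_fine_iff
    proof
      fix q assume "q \<in> ?f ` A"
      then obtain w where w: "w \<in> A" "q = ?f w" by blast
      have "len (win w) = (real_of_int (snd w) + 1) / 2 ^ fst w - real_of_int (snd w) / 2 ^ fst w"
        unfolding content_win by (simp add: diff_divide_distrib[symmetric])
      then show "snd q \<subseteq> {fst q - \<delta> (fst q)<..<fst q + \<delta> (fst q)}"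
        using \<sigma>(1,3)[OF w(1)] w(2) by (auto simp: win_def)
    qed
    show "fst q \<in> snd q" "snd q \<subseteq> {0..1}" if q: "q \<in> ?f ` A" for q
    proof -
      obtain w where "w \<in> A" "q = ?f w" using q by blast
      then show "fst q \<in> snd q" "snd q \<subseteq> {0..1}" using \<sigma>(1,2)[of w] by simp_all
    qed
  qed
  then show ?thesis by (simp add: sum.reindex[OF inj])
qed

text \<open>\<open>2 ^ fst w\<close> is the reciprocal length of \<open>win w\<close>, so for
  lengths of nonoverlapping intervals inside their windows this is the fraction of the window that
  they occupy. With it as weight, a sum over intervals turns into a weighted sum over
  windows.\<close>

definition load :: "'q set \<Rightarrow> ('q \<Rightarrow> window) \<Rightarrow> ('q \<Rightarrow> real) \<Rightarrow> window \<Rightarrow> real" where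
  "load Q \<omega> l w = 2 ^ fst w * (\<Sum>q | q \<in> Q \<and> \<omega> q = w. l q)"

lemma load_nonneg: "(\<And>q. q \<in> Q \<Longrightarrow> 0 \<le> l q) \<Longrightarrow> 0 \<le> load Q \<omega> l w"
  unfolding load_def by (intro mult_nonneg_nonneg sum_nonneg) auto

text \<open>Two tags in a common window of length below both gauge values can be exchanged: a sum of
  such exchanges over windows that do not overlap is controlled by the Henstock lemma.\<close>

lemma light_exchange_le:
  assumes \<delta>: "henstock_gauge T h \<delta> \<epsilon>" "\<epsilon> > 0" and x: "x \<in> T" and Q: "finite Q" and C: "0 \<le> C"
    and l: "\<And>q. q \<in> Q \<Longrightarrow> 0 \<le> l q" and \<omega>: "\<And>q. q \<in> Q \<Longrightarrow> win (\<omega> q) \<subseteq> {0..1}"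
    and \<alpha>: "\<And>q. q \<in> Q \<Longrightarrow> \<alpha> q \<in> win (\<omega> q) \<and> len (win (\<omega> q)) < \<delta> (\<alpha> q)"
    and \<beta>: "\<And>q. q \<in> Q \<Longrightarrow> \<beta> q \<in> win (\<omega> q) \<and> len (win (\<omega> q)) < \<delta> (\<beta> q)"
  shows "(\<Sum>q | q \<in> Q \<and> \<omega> q \<notin> heavy (\<omega> ` Q) (load Q \<omega> l) C. l q * (h x (\<alpha> q) - h x (\<beta> q)))
    \<le> C * (2 * \<epsilon>)"
proof -
  let ?W = "\<omega> ` Q" and ?p = "load Q \<omega> l"
  let ?H = "heavy ?W ?p C"
  let ?S = "{q. q \<in> Q \<and> \<omega> q \<notin> ?H}"
  define D where "D q = h x (\<alpha> q) - h x (\<beta> q)" for q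
  \<comment> \<open>One exchange per window suffices: since the weights \<open>l q\<close> are
    nonnegative, every gain \<open>D q\<close> in \<open>w\<close> may be replaced by the largest
    one, \<open>D (m w)\<close>.\<close>
  have "\<exists>m. m \<in> Q \<and> \<omega> m = w \<and> (\<forall>q\<in>Q. \<omega> q = w \<longrightarrow> D q \<le> D m)" if "w \<in> ?W" for w
  proof -
    let ?F = "{q \<in> Q. \<omega> q = w}"
    have F: "finite ?F" "?F \<noteq> {}" using Q that by auto
    then have "Max (D ` ?F) \<in> D ` ?F" by (intro Max_in) auto
    then obtain m where m: "m \<in> ?F" "D m = Max (D ` ?F)" by (metis (no_types, lifting) imageE)
    have "D q \<le> D m" if "q \<in> ?F" for q
      unfolding m(2) using F(1) that by (intro Max_ge) auto
    then show ?thesis using m(1) by blast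
  qed
  then have "\<exists>m. \<forall>w\<in>?W. m w \<in> Q \<and> \<omega> (m w) = w \<and> (\<forall>q\<in>Q. \<omega> q = w \<longrightarrow> D q \<le> D (m w))"
    by (intro bchoice ballI)
  then obtain m where mm: "\<forall>w\<in>?W. m w \<in> Q \<and> \<omega> (m w) = w \<and> (\<forall>q\<in>Q. \<omega> q = w \<longrightarrow> D q \<le> D (m w))" ..
  then have m: "m w \<in> Q" "\<omega> (m w) = w" "\<And>q. q \<in> Q \<Longrightarrow> \<omega> q = w \<Longrightarrow> D q \<le> D (m w)"
    if "w \<in> ?W" for w
    using bspec[OF mm that] by simp_all
  define a where "a w = len (win w) * D (m w)" for w
  have "(\<Sum>q\<in>?S. l q * D q) = (\<Sum>w\<in>\<omega> ` ?S. \<Sum>q | q \<in> ?S \<and> \<omega> q = w. l q * D q)"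
    by (rule sum.image_gen) (use Q in simp)
  also have "\<omega> ` ?S = ?W - ?H" by auto
  also have "(\<Sum>w\<in>?W - ?H. \<Sum>q | q \<in> ?S \<and> \<omega> q = w. l q * D q) \<le> (\<Sum>w\<in>?W - ?H. ?p w * a w)"
  proof (rule sum_mono)
    fix w assume w: "w \<in> ?W - ?H"
    have "{q. q \<in> ?S \<and> \<omega> q = w} = {q. q \<in> Q \<and> \<omega> q = w}" using w by auto
    then have "(\<Sum>q | q \<in> ?S \<and> \<omega> q = w. l q * D q) = (\<Sum>q | q \<in> Q \<and> \<omega> q = w. l q * D q)" by simp
    also have "\<dots> \<le> (\<Sum>q | q \<in> Q \<and> \<omega> q = w. l q * D (m w))"
      using w m(3) l by (intro sum_mono mult_left_mono) auto
    also have "\<dots> = ?p w * a w"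
      by (simp add: load_def a_def content_win sum_distrib_right)
    finally show "(\<Sum>q | q \<in> ?S \<and> \<omega> q = w. l q * D q) \<le> ?p w * a w" .
  qed
  also have "\<dots> \<le> C * (2 * \<epsilon>)"
  proof (rule light_sum_le)
    show "finite ?W" using Q by simp
    show "0 \<le> ?p w" for w by (rule load_nonneg) (rule l)
    show "0 \<le> C" "0 \<le> 2 * \<epsilon>" using C \<delta>(2) by simp_all
    fix A assume A: "A \<subseteq> ?W"
      "\<And>v w. v \<in> A \<Longrightarrow> w \<in> A \<Longrightarrow> v \<noteq> w \<Longrightarrow> interior (win v) \<inter> interior (win w) = {}"
    have finA: "finite A" using A(1) Q by (meson finite_imageI finite_subset)
    have mA: "m w \<in> Q" "\<omega> (m w) = w" if "w \<in> A" for w using m(1,2) that A(1) by blast+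
    have *: "\<bar>\<Sum>w\<in>A. len (win w) * h x (\<sigma> (m w)) - integral (win w) (h x)\<bar> \<le> \<epsilon>"
      if "\<And>q. q \<in> Q \<Longrightarrow> \<sigma> q \<in> win (\<omega> q) \<and> len (win (\<omega> q)) < \<delta> (\<sigma> q)" for \<sigma>
    proof (rule henstock_windows[OF \<delta> x finA])
      fix w assume w: "w \<in> A"
      show "\<sigma> (m w) \<in> win w" "win w \<subseteq> {0..1}" "len (win w) < \<delta> (\<sigma> (m w))"
        using that[OF mA(1)[OF w]] \<omega>[OF mA(1)[OF w]] mA(2)[OF w] by simp_all
    qed (rule A(2))
    have "(\<Sum>w\<in>A. a w) = (\<Sum>w\<in>A. len (win w) * h x (\<alpha> (m w)) - integral (win w) (h x))
        - (\<Sum>w\<in>A. len (win w) * h x (\<beta> (m w)) - integral (win w) (h x))"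
      unfolding sum_subtractf[symmetric] by (intro sum.cong) (auto simp: a_def D_def right_diff_distrib)
    also have "\<dots> \<le> 2 * \<epsilon>" using *[of \<alpha>, OF \<alpha>] *[of \<beta>, OF \<beta>] by linarith
    finally show "(\<Sum>w\<in>A. a w) \<le> 2 * \<epsilon>" .
  qed
  finally show ?thesis by (simp add: D_def)
qed

text \<open>With interval lengths as \<open>l\<close>, the right side of
  \<open>measure_heavy_le\<close> is the total length of \<open>Q\<close>, at most 1. So the heavy
  windows cover measure at most \<open>1 / C\<close>, and the intervals assigned to them lie in that
  set.\<close>

lemma heavy_length_le:
  assumes Q: "nonoverlapping Q" and C: "0 < C"
    and \<omega>: "\<And>q. q \<in> Q \<Longrightarrow> snd q \<subseteq> win (\<omega> q) \<and> win (\<omega> q) \<subseteq> {0..1}"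
  shows "(\<Sum>q | q \<in> Q \<and> \<omega> q \<in> heavy (\<omega> ` Q) (load Q \<omega> (\<lambda>q. len (snd q))) C. len (snd q)) \<le> 1 / C"
proof -
  let ?W = "\<omega> ` Q" and ?p = "load Q \<omega> (\<lambda>q. len (snd q))"
  let ?H = "heavy ?W ?p C"
  have fin: "finite Q" by (rule nonoverlapping_finite[OF Q])
  have finH: "finite ?H" using fin by (simp add: heavy_def)
  have "(\<Sum>q | q \<in> Q \<and> \<omega> q \<in> ?H. len (snd q)) \<le> measure lebesgue (\<Union>(win ` ?H))"
  proof (rule nonoverlapping_sum_content_le)
    show "nonoverlapping {q. q \<in> Q \<and> \<omega> q \<in> ?H}" by (rule nonoverlapping_subset[OF Q]) auto
    show "\<Union>(win ` ?H) \<in> lmeasurable"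
      using finH by (intro fmeasurable.finite_UN) (auto simp: win_def)
    show "snd q \<subseteq> \<Union>(win ` ?H)" if "q \<in> {q. q \<in> Q \<and> \<omega> q \<in> ?H}" for q
      using that \<omega> by blast
  qed
  also have "C * \<dots> \<le> (\<Sum>w\<in>?W. ?p w * len (win w))"
  proof (rule measure_heavy_le)
    show "finite ?W" using fin by simp
    show "0 \<le> ?p w" for w by (rule load_nonneg) simp
  qed
  also have "\<dots> = (\<Sum>w\<in>?W. \<Sum>q | q \<in> Q \<and> \<omega> q = w. len (snd q))"
    by (simp add: load_def content_win)
  also have "\<dots> = (\<Sum>q\<in>Q. len (snd q))" by (rule sum.image_gen[OF fin, symmetric])
  also have "\<dots> \<le> measure lebesgue {0..1::real}"
    by (rule nonoverlapping_sum_content_le[OF Q]) (use \<omega> in auto)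
  finally show ?thesis using C by (simp add: field_simps mult_left_mono)
qed

text \<open>The free tag \<open>fst q\<close> is exchanged for the tag \<open>\<sigma> q\<close>
  inside the interval at cost \<open>2 * C * \<epsilon>\<close>; the retagged family is of Perron
  type, and the Henstock lemma adds \<open>\<epsilon>\<close>. Only the intervals \<open>R\<close>
  with heavy windows are left out. \<open>C\<close> is unrelated to \<open>\<epsilon>\<close>, so
  \<open>\<epsilon>\<close> can be chosen after \<open>C\<close>.\<close>

lemma class_comparison:
  assumes \<delta>: "henstock_gauge T h \<delta> \<epsilon>" "\<epsilon> > 0" and Q: "nonoverlapping Q" and C: "0 < C"
    and \<omega>: "\<And>q. q \<in> Q \<Longrightarrow> snd q \<subseteq> win (\<omega> q) \<and> win (\<omega> q) \<subseteq> {0..1} \<and> 0 < len (snd q)"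
    and t: "\<And>q. q \<in> Q \<Longrightarrow> fst q \<in> win (\<omega> q) \<and> len (win (\<omega> q)) < \<delta> (fst q)"
    and \<sigma>: "\<And>q. q \<in> Q \<Longrightarrow> \<sigma> q \<in> snd q \<and> len (win (\<omega> q)) < \<delta> (\<sigma> q)"
  shows "\<exists>R\<subseteq>Q. (\<Sum>q\<in>R. len (snd q)) \<le> 1 / C \<and>
    (\<forall>x\<in>T. \<bar>\<Sum>q\<in>Q - R. len (snd q) * h x (fst q) - integral (snd q) (h x)\<bar> \<le> 2 * C * \<epsilon> + \<epsilon>)"
proof -
  define H where "H = heavy (\<omega> ` Q) (load Q \<omega> (\<lambda>q. len (snd q))) C"
  define R where "R = {q. q \<in> Q \<and> \<omega> q \<in> H}"
  have fin: "finite Q" by (rule nonoverlapping_finite[OF Q])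
  have QR: "Q - R = {q. q \<in> Q \<and> \<omega> q \<notin> H}" by (auto simp: R_def)
  have nQR: "nonoverlapping (Q - R)" by (rule nonoverlapping_subset[OF Q]) auto
  have \<sigma>w: "\<sigma> q \<in> win (\<omega> q) \<and> len (win (\<omega> q)) < \<delta> (\<sigma> q)" if "q \<in> Q" for q
    using \<sigma>[OF that] \<omega>[OF that] by blast
  have "\<bar>\<Sum>q\<in>Q - R. len (snd q) * h x (fst q) - integral (snd q) (h x)\<bar> \<le> 2 * C * \<epsilon> + \<epsilon>"
    if x: "x \<in> T" for x
  proof -
    have 1: "(\<Sum>q\<in>Q - R. len (snd q) * (h x (fst q) - h x (\<sigma> q))) \<le> C * (2 * \<epsilon>)"
      unfolding QR H_def
      by (rule light_exchange_le[OF \<delta> x fin]) (use C t \<sigma>w \<omega> in auto)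
    \<comment> \<open>Exchanging in the opposite direction gives the lower bound. The heavy windows
      involve neither \<open>x\<close> nor the direction of the exchange, so one \<open>R\<close>
      serves throughout.\<close>
    have 2: "(\<Sum>q\<in>Q - R. len (snd q) * (h x (\<sigma> q) - h x (fst q))) \<le> C * (2 * \<epsilon>)"
      unfolding QR H_def
      by (rule light_exchange_le[OF \<delta> x fin]) (use C t \<sigma>w \<omega> in auto)
    have "(\<Sum>q\<in>Q - R. len (snd q) * (h x (\<sigma> q) - h x (fst q)))
        = - (\<Sum>q\<in>Q - R. len (snd q) * (h x (fst q) - h x (\<sigma> q)))"
      unfolding sum_negf[symmetric] by (simp add: algebra_simps)
    with 1 2 have A: "\<bar>\<Sum>q\<in>Q - R. len (snd q) * (h x (fst q) - h x (\<sigma> q))\<bar> \<le> 2 * C * \<epsilon>"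
      by simp
    let ?f = "\<lambda>q. (\<sigma> q, snd q)"
    have neq: "snd q \<noteq> snd r" if "q \<in> Q" "r \<in> Q" "q \<noteq> r" for q r
    proof
      assume eq: "snd q = snd r"
      then have "interior (snd q) = {}" using nonoverlapping_disjoint[OF Q that] by simp
      then have "len (snd q) = 0" using content_interior_empty[OF Q] that(1) by blast
      then show False using \<omega>[OF that(1)] by simp
    qed
    have inj: "inj_on ?f (Q - R)"
    proof (rule inj_onI, rule ccontr)
      fix q r assume "q \<in> Q - R" "r \<in> Q - R" "?f q = ?f r" "q \<noteq> r"
      then show False using neq[of q r] by simp
    qed
    have "\<bar>\<Sum>q\<in>?f ` (Q - R). len (snd q) * h x (fst q) - integral (snd q) (h x)\<bar> \<le> \<epsilon>"
    proof (rule henstock_partial[OF \<delta> x])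
      show "nonoverlapping (?f ` (Q - R))"
        unfolding nonoverlapping_def
      proof (intro conjI ballI impI)
        show "finite (?f ` (Q - R))" using fin by simp
        show "\<exists>a b. a \<le> b \<and> snd q = {a..b}" if q: "q \<in> ?f ` (Q - R)" for q
        proof -
          obtain r where "r \<in> Q" "q = ?f r" using q by blast
          then show ?thesis using nonoverlapping_interval[OF Q] by simp
        qed
        show "interior (snd q) \<inter> interior (snd r) = {}"
          if qr: "q \<in> ?f ` (Q - R)" "r \<in> ?f ` (Q - R)" "q \<noteq> r" for q r
        proof -
          obtain u v where "u \<in> Q" "v \<in> Q" "q = ?f u" "r = ?f v" using qr(1,2) by blast
          moreover from this have "u \<noteq> v" using qr(3) by auto
          ultimately show ?thesis using nonoverlapping_disjoint[OF Q, of u v] by simp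
        qed
      qed
      show "delta_fine \<delta> (?f ` (Q - R))"
        unfolding delta_fine_iff
      proof
        fix q assume "q \<in> ?f ` (Q - R)"
        then obtain r where r: "r \<in> Q" "q = ?f r" by blast
        let ?w = "\<omega> r"
        have "len (win ?w) = (real_of_int (snd ?w) + 1) / 2 ^ fst ?w - real_of_int (snd ?w) / 2 ^ fst ?w"
          unfolding content_win by (simp add: diff_divide_distrib[symmetric])
        then have "win ?w \<subseteq> {\<sigma> r - \<delta> (\<sigma> r)<..<\<sigma> r + \<delta> (\<sigma> r)}"
          using \<sigma>w[OF r(1)] by (auto simp: win_def)
        moreover have "snd r \<subseteq> win ?w" using \<omega>[OF r(1)] by blast
        ultimately show "snd q \<subseteq> {fst q - \<delta> (fst q)<..<fst q + \<delta> (fst q)}"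
          using r(2) by auto
      qed
      show "fst q \<in> snd q" "snd q \<subseteq> {0..1}" if q: "q \<in> ?f ` (Q - R)" for q
      proof -
        obtain r where r: "r \<in> Q" "q = ?f r" using q by blast
        have "snd r \<subseteq> {0..1}" using \<omega>[OF r(1)] by (meson order_trans)
        then show "fst q \<in> snd q" "snd q \<subseteq> {0..1}" using \<sigma>[OF r(1)] r(2) by simp_all
      qed
    qed
    then have B: "\<bar>\<Sum>q\<in>Q - R. len (snd q) * h x (\<sigma> q) - integral (snd q) (h x)\<bar> \<le> \<epsilon>"
      by (simp add: sum.reindex[OF inj])
    have "(\<Sum>q\<in>Q - R. len (snd q) * h x (fst q) - integral (snd q) (h x))
      = (\<Sum>q\<in>Q - R. len (snd q) * (h x (fst q) - h x (\<sigma> q)))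
        + (\<Sum>q\<in>Q - R. len (snd q) * h x (\<sigma> q) - integral (snd q) (h x))"
      unfolding sum.distrib[symmetric] by (intro sum.cong) (auto simp: algebra_simps)
    with A B show ?thesis by linarith
  qed
  moreover have "(\<Sum>q\<in>R. len (snd q)) \<le> 1 / C"
    unfolding R_def H_def by (rule heavy_length_le[OF Q C]) (use \<omega> in blast)
  moreover have "R \<subseteq> Q" by (auto simp: R_def)
  ultimately show ?thesis by (intro exI[of _ R] conjI ballI)
qed

end

section \<open>Dyadic points, outer open sets, and discarding few intervals\<close>

definition dyadics :: "real set" where
  "dyadics = {t \<in> {0..1}. \<exists>n::nat. 2 ^ n * t \<in> \<int>}"

text \<open>A tag that is an endpoint of its window is not interior to it, so no gauge value
  confines its intervals to the window. Countability allows gauge values with summable total at such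
  tags instead.\<close>

lemma countable_dyadics: "countable dyadics"
proof (rule countable_subset)
  show "dyadics \<subseteq> range (\<lambda>(n::nat, j::int). real_of_int j / 2 ^ n)"
  proof
    fix t assume "t \<in> dyadics"
    then obtain n :: nat and j :: int where "2 ^ n * t = real_of_int j"
      by (auto simp: dyadics_def elim!: Ints_cases)
    then have "t = (\<lambda>(n, j). real_of_int j / 2 ^ n) (n, j)" by (simp add: field_simps)
    then show "t \<in> range (\<lambda>(n::nat, j::int). real_of_int j / 2 ^ n)" by blast
  qed
qed auto

lemma win_at_nondyadic:
  assumes "t \<in> {0..1}" "t \<notin> dyadics"
  shows "t \<in> interior (win (win_at n t))" "win (win_at n t) \<subseteq> {0..1}"
proof -
  have int: "t \<in> interior (win (win_at m t))" for m
    by (rule interior_win_at) (use assms in \<open>auto simp: dyadics_def\<close>)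
  then show "t \<in> interior (win (win_at n t))" .
  have "t \<noteq> 0" "t \<noteq> 1"
    using assms(2) by (auto simp: dyadics_def intro!: exI[of _ 0])
  then have "0 < t" "t < 1" using assms(1) by auto
  then have "t \<in> interior (win (0, 0))" by (simp add: mem_interior_win)
  then have "win (win_at n t) \<subseteq> win (0, 0)"
    using int[of n] by (intro win_laminar_le) auto
  then show "win (win_at n t) \<subseteq> {0..1}" by (simp add: win_def)
qed

text \<open>\<open>B\<close> is arbitrary, so \<open>U\<close> is an open superset whose measure is
  within \<open>\<eta>\<close> of the infimum. Removing from \<open>U\<close> a closed
  \<open>V\<close> that misses \<open>B\<close> leaves another competitor, so \<open>V\<close> has
  measure at most \<open>\<eta>\<close>. The fixed ball keeps all measures finite.\<close>

lemma almost_outer_open: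
  fixes B :: "real set"
  assumes B: "B \<subseteq> {0..1}" and \<eta>: "\<eta> > 0"
  obtains U where "open U" "B \<subseteq> U"
    "\<And>V. closed V \<Longrightarrow> V \<subseteq> U \<Longrightarrow> V \<inter> B = {} \<Longrightarrow> measure lebesgue V \<le> \<eta>"
proof -
  let ?\<O> = "{U. open U \<and> B \<subseteq> U \<and> U \<subseteq> ball 0 2}"
  let ?m = "INF U\<in>?\<O>. measure lebesgue U"
  have "{0..1} \<subseteq> ball (0::real) 2" by auto
  then have ne: "?\<O> \<noteq> {}" using B by blast
  have bdd: "bdd_below (measure lebesgue ` ?\<O>)" by (rule bdd_belowI2[of _ 0]) simp
  have "?m < ?m + \<eta>" using \<eta> by simp
  then have "\<exists>U\<in>?\<O>. measure lebesgue U < ?m + \<eta>" by (simp only: cINF_less_iff[OF ne bdd])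
  then obtain U where U: "open U" "B \<subseteq> U" "U \<subseteq> ball 0 2" "measure lebesgue U < ?m + \<eta>" by auto
  have Um: "U \<in> lmeasurable"
    using U(1,3) bounded_subset[OF bounded_ball] by (intro lmeasurable_open) auto
  have "measure lebesgue V \<le> \<eta>" if V: "closed V" "V \<subseteq> U" "V \<inter> B = {}" for V
  proof -
    have Vs: "V \<in> sets lebesgue" using V(1) by (simp add: borel_closed)
    have "open (U - V)" using U(1) V(1) by (rule open_Diff)
    then have "U - V \<in> ?\<O>" using U(2,3) V(3) by blast
    then have "?m \<le> measure lebesgue (U - V)" using bdd by (rule cINF_lower[rotated])
    also have "\<dots> = measure lebesgue U - measure lebesgue V"
      by (rule measurable_measure_Diff[OF Um Vs V(2)])
    finally show ?thesis using U(4) by simp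
  qed
  then show ?thesis using that U by blast
qed

lemma sum_Un_le:
  fixes \<phi> :: "'q \<Rightarrow> real"
  assumes "finite A" "finite B" "\<And>q. 0 \<le> \<phi> q"
  shows "sum \<phi> (A \<union> B) \<le> sum \<phi> A + sum \<phi> B"
proof -
  have "sum \<phi> (A \<union> B) + sum \<phi> (A \<inter> B) = sum \<phi> A + sum \<phi> B"
    by (rule sum.union_inter) (use assms in auto)
  moreover have "0 \<le> sum \<phi> (A \<inter> B)" using assms(3) by (rule sum_nonneg)
  ultimately show ?thesis by linarith
qed

lemma sum_times_product:
  fixes e :: real
  shows "(\<Sum>c\<in>A \<times> B. e * (f (fst c) * g (snd c))) = e * (sum f A * sum g B)"
  unfolding sum_product sum.cartesian_product case_prod_unfold by (rule sum_distrib_left[symmetric])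

context uniform_henstock
begin

text \<open>The classes \<open>k = \<kappa> t\<close> bound \<open>h\<close> by \<open>k\<close> and have their own gauge, so sharp that the errors of
  the window comparison are summable over \<open>k\<close>. Within a class, tags with the same window level
  \<open>n\<close> are enclosed in an open set \<open>U k n\<close> that contains few intervals without such tags.\<close>

lemma good_subfamily:
  assumes "0 < \<epsilon>"
  shows "\<exists>\<delta>. gauge01 \<delta> \<and> (\<forall>P. partition01 P \<and> delta_fine \<delta> P \<longrightarrow>
    (\<exists>S\<subseteq>P. (\<Sum>q\<in>P - S. len (snd q)) \<le> \<epsilon> \<and>
      (\<forall>x\<in>T. \<bar>(\<Sum>q\<in>P. len (snd q) * h x (fst q)) - (\<Sum>q\<in>S. integral (snd q) (h x))\<bar> \<le> \<epsilon>)))"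
proof -
  \<comment> \<open>The cap at 1 is used for \<open>1 \<le> C k\<close>.\<close>
  define e where "e = min \<epsilon> 1"
  have e: "0 < e" "e \<le> \<epsilon>" "e \<le> 1" using assms by (auto simp: e_def)
  \<comment> \<open>Integer classes with \<open>b t \<le> \<kappa> t\<close>; the added 1 also gives
    \<open>1 \<le> \<kappa> t\<close>, so that weighted lengths dominate lengths.\<close>
  define \<kappa> where "\<kappa> t = nat \<lfloor>b t\<rfloor> + 1" for t
  have \<kappa>: "b t \<le> real (\<kappa> t)" "1 \<le> real (\<kappa> t)" for t by (auto simp: \<kappa>_def) linarith
  define C where "C k = (real k + 1) * 2 ^ (k + 4) / e" for k :: nat
  have C: "0 < C k" "1 \<le> C k" "real k / C k \<le> e * (1/2) ^ (k + 4)" for k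
  proof -
    show "0 < C k" using e by (simp add: C_def)
    \<comment> \<open>\<open>C k\<close> is chosen from the loss: heavy intervals of class
      \<open>k\<close> have length at most \<open>1 / C k\<close>, hence contribute at most
      \<open>k / C k\<close>, and the factor \<open>2 ^ (k + 4)\<close> makes these losses
      summable.\<close>
    have "1 * 1 \<le> (real k + 1) * 2 ^ (k + 4)" by (intro mult_mono) auto
    then show "1 \<le> C k" using e unfolding C_def by (simp add: le_divide_eq)
    have "real k / C k = real k / (real k + 1) * (e * (1/2) ^ (k + 4))"
      using e by (simp add: C_def power_divide)
    also have "\<dots> \<le> 1 * (e * (1/2) ^ (k + 4))" using e by (intro mult_right_mono) auto
    finally show "real k / C k \<le> e * (1/2) ^ (k + 4)" by simp
  qed
  \<comment> \<open>The error in \<open>class_comparison\<close> is at most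
    \<open>3 * C k * \<epsilon>k k\<close> since \<open>1 \<le> C k\<close>; hence the 3.\<close>
  define \<epsilon>k where "\<epsilon>k k = e * (1/2) ^ (k + 4) / (3 * C k)" for k
  have \<epsilon>k: "0 < \<epsilon>k k" "2 * C k * \<epsilon>k k + \<epsilon>k k \<le> e * (1/2) ^ (k + 4)" for k
  proof -
    show pos: "0 < \<epsilon>k k" unfolding \<epsilon>k_def using e C(1)[of k] by simp
    have "\<epsilon>k k \<le> C k * \<epsilon>k k" using C(2)[of k] pos by simp
    moreover have "3 * C k * \<epsilon>k k = e * (1/2) ^ (k + 4)" unfolding \<epsilon>k_def using C(1)[of k] by simp
    ultimately show "2 * C k * \<epsilon>k k + \<epsilon>k k \<le> e * (1/2) ^ (k + 4)" by linarith
  qed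
  have "\<forall>k. \<exists>\<delta>. henstock_gauge T h \<delta> (\<epsilon>k k)" using h_uniform[OF \<epsilon>k(1)] by blast
  then obtain \<delta>k where \<delta>k: "\<And>k. henstock_gauge T h (\<delta>k k) (\<epsilon>k k)" by metis
  have "\<exists>n. (1/2) ^ n < \<delta>k (\<kappa> t) t" if "t \<in> {0..1}" for t
    using \<delta>k[of "\<kappa> t"] that by (intro real_arch_pow_inv) (auto simp: henstock_gauge_def gauge01_def)
  then have "\<exists>\<nu>. \<forall>t\<in>{0..1}. (1/2) ^ \<nu> t < \<delta>k (\<kappa> t) t" by (intro bchoice ballI)
  then obtain \<nu> where \<nu>: "\<forall>t\<in>{0..1}. (1/2) ^ \<nu> t < \<delta>k (\<kappa> t) t" ..
  \<comment> \<open>These sets may fail to be measurable, since neither \<open>\<kappa>\<close> nor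
    \<open>\<nu>\<close> has any regularity; hence the recourse to
    \<open>almost_outer_open\<close>.\<close>
  define B where "B k n = {t \<in> {0..1}. t \<notin> dyadics \<and> \<kappa> t = k \<and> \<nu> t = n}" for k n
  define \<eta> where "\<eta> k n = e * (1/2) ^ (k + n + 4) / (real k + 1)" for k n
  have \<eta>: "0 < \<eta> k n" "real k * \<eta> k n \<le> e * (1/2) ^ 4 * ((1/2) ^ k * (1/2) ^ n)" for k n
  proof -
    show "0 < \<eta> k n" using e by (simp add: \<eta>_def)
    have "real k * \<eta> k n = real k / (real k + 1) * (e * (1/2) ^ (k + n + 4))"
      by (simp add: \<eta>_def)
    also have "\<dots> \<le> 1 * (e * (1/2) ^ (k + n + 4))" using e by (intro mult_right_mono) auto
    finally show "real k * \<eta> k n \<le> e * (1/2) ^ 4 * ((1/2) ^ k * (1/2) ^ n)"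
      by (simp add: power_add mult_ac)
  qed
  have "\<exists>U. open U \<and> B k n \<subseteq> U \<and>
      (\<forall>V. closed V \<longrightarrow> V \<subseteq> U \<longrightarrow> V \<inter> B k n = {} \<longrightarrow> measure lebesgue V \<le> \<eta> k n)" for k n
  proof -
    have "B k n \<subseteq> {0..1}" by (auto simp: B_def)
    from almost_outer_open[OF this \<eta>(1)[of k n]] show ?thesis by metis
  qed
  then obtain U where U: "\<And>k n. open (U k n)" "\<And>k n. B k n \<subseteq> U k n"
    "\<And>k n V. closed V \<Longrightarrow> V \<subseteq> U k n \<Longrightarrow> V \<inter> B k n = {} \<Longrightarrow> measure lebesgue V \<le> \<eta> k n"
    by metis
  define g where "g = to_nat_on dyadics"
  have g: "inj_on g dyadics" unfolding g_def by (rule inj_on_to_nat_on[OF countable_dyadics])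
  define \<omega> where "\<omega> t = win_at (\<nu> t) t" for t
  \<comment> \<open>Intervals with a given dyadic tag have total length at most
    \<open>2 * \<delta> t\<close>, whose value weighted by \<open>\<kappa> t\<close> is
    \<open>e * (1/2) ^ (g t + 4)\<close>; this explains the exponent \<open>g t + 5\<close>. At
    other tags the interval is forced into the window of the tag and into the open set of its
    class.\<close>
  have "\<exists>r>0. (t \<in> dyadics \<longrightarrow> r = e * (1/2) ^ (g t + 5) / real (\<kappa> t)) \<and>
      (t \<notin> dyadics \<longrightarrow> ball t r \<subseteq> U (\<kappa> t) (\<nu> t) \<inter> interior (win (\<omega> t)))" if t: "t \<in> {0..1}" for t
  proof (cases "t \<in> dyadics")
    case True
    have "0 < e * (1/2) ^ (g t + 5) / real (\<kappa> t)"
      using e(1) \<kappa>(2)[of t] by (intro divide_pos_pos mult_pos_pos) auto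
    then show ?thesis using True by auto
  next
    case False
    have "t \<in> B (\<kappa> t) (\<nu> t)" using t False by (simp add: B_def)
    then have "t \<in> U (\<kappa> t) (\<nu> t) \<inter> interior (win (\<omega> t))"
      using U(2) win_at_nondyadic(1)[OF t False] unfolding \<omega>_def by blast
    moreover have "open (U (\<kappa> t) (\<nu> t) \<inter> interior (win (\<omega> t)))" using U(1) by (intro open_Int open_interior)
    ultimately obtain r where "r > 0" "ball t r \<subseteq> U (\<kappa> t) (\<nu> t) \<inter> interior (win (\<omega> t))"
      by (meson open_contains_ball)
    then show ?thesis using False by auto
  qed
  then have "\<exists>\<delta>. \<forall>t\<in>{0..1}. \<delta> t > 0 \<and> (t \<in> dyadics \<longrightarrow> \<delta> t = e * (1/2) ^ (g t + 5) / real (\<kappa> t)) \<and>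
      (t \<notin> dyadics \<longrightarrow> ball t (\<delta> t) \<subseteq> U (\<kappa> t) (\<nu> t) \<inter> interior (win (\<omega> t)))"
    by (intro bchoice ballI)
  then obtain \<delta> where \<delta>_all: "\<forall>t\<in>{0..1}. \<delta> t > 0 \<and> (t \<in> dyadics \<longrightarrow> \<delta> t = e * (1/2) ^ (g t + 5) / real (\<kappa> t)) \<and>
      (t \<notin> dyadics \<longrightarrow> ball t (\<delta> t) \<subseteq> U (\<kappa> t) (\<nu> t) \<inter> interior (win (\<omega> t)))" ..
  have \<delta>_pos: "\<delta> t > 0" if "t \<in> {0..1}" for t using bspec[OF \<delta>_all that] by simp
  have \<delta>_dy: "\<delta> t = e * (1/2) ^ (g t + 5) / real (\<kappa> t)" if "t \<in> {0..1}" "t \<in> dyadics" for t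
    using bspec[OF \<delta>_all that(1)] that(2) by simp
  have \<delta>_nd: "ball t (\<delta> t) \<subseteq> U (\<kappa> t) (\<nu> t)" "ball t (\<delta> t) \<subseteq> win (\<omega> t)"
    if "t \<in> {0..1}" "t \<notin> dyadics" for t
    using bspec[OF \<delta>_all that(1)] that(2) interior_subset[of "win (\<omega> t)"] by auto
  have "\<exists>S\<subseteq>P. (\<Sum>q\<in>P - S. len (snd q)) \<le> \<epsilon> \<and>
      (\<forall>x\<in>T. \<bar>(\<Sum>q\<in>P. len (snd q) * h x (fst q)) - (\<Sum>q\<in>S. integral (snd q) (h x))\<bar> \<le> \<epsilon>)"
    if P: "partition01 P" "delta_fine \<delta> P" for P
  proof -
    have nP: "nonoverlapping P" by (rule partition01_nonoverlapping[OF P(1)])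
    have fP: "finite P" by (rule nonoverlapping_finite[OF nP])
    have tag: "fst q \<in> {0..1}" if "q \<in> P" for q by (rule partition01_tag[OF P(1) that])
    have fine: "snd q \<subseteq> ball (fst q) (\<delta> (fst q))" if "q \<in> P" for q
      using P(2) that unfolding delta_fine_iff ball_eq_greaterThanLessThan by blast
    \<comment> \<open>The required point of \<open>B\<close> inside the interval becomes the
      companion tag \<open>\<sigma> q\<close>. It shares class and level with the free tag, so the
      window is short enough for both in the gauge of that class.\<close>
    define G where "G = {q \<in> P. fst q \<notin> dyadics \<and> 0 < len (snd q) \<and>
      snd q \<inter> B (\<kappa> (fst q)) (\<nu> (fst q)) \<noteq> {}}"
    define Q where "Q k = {q \<in> G. \<kappa> (fst q) = k}" for k
    have GP: "q \<in> P" "fst q \<notin> dyadics" "0 < len (snd q)"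
      "snd q \<inter> B (\<kappa> (fst q)) (\<nu> (fst q)) \<noteq> {}" if "q \<in> G" for q
      using that by (auto simp: G_def)
    have "\<exists>s. s \<in> snd q \<inter> B (\<kappa> (fst q)) (\<nu> (fst q))" if "q \<in> G" for q using GP(4)[OF that] by blast
    then have "\<exists>\<sigma>. \<forall>q\<in>G. \<sigma> q \<in> snd q \<inter> B (\<kappa> (fst q)) (\<nu> (fst q))" by (intro bchoice ballI)
    then obtain \<sigma> where \<sigma>_all: "\<forall>q\<in>G. \<sigma> q \<in> snd q \<inter> B (\<kappa> (fst q)) (\<nu> (fst q))" ..
    have len\<omega>: "len (win (\<omega> t)) = (1/2) ^ \<nu> t" for t
      by (simp add: \<omega>_def content_win power_divide)
    have "\<exists>R\<subseteq>Q k. (\<Sum>q\<in>R. len (snd q)) \<le> 1 / C k \<and>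
      (\<forall>x\<in>T. \<bar>\<Sum>q\<in>Q k - R. len (snd q) * h x (fst q) - integral (snd q) (h x)\<bar> \<le> 2 * C k * \<epsilon>k k + \<epsilon>k k)" for k
    proof (rule class_comparison[OF \<delta>k \<epsilon>k(1) _ C(1), where \<omega> = "\<lambda>q. \<omega> (fst q)" and \<sigma> = \<sigma>])
      show "nonoverlapping (Q k)" by (rule nonoverlapping_subset[OF nP]) (auto simp: Q_def G_def)
      fix q assume "q \<in> Q k"
      then have q: "q \<in> G" "\<kappa> (fst q) = k" by (auto simp: Q_def)
      note qP = GP(1)[OF q(1)] and qd = GP(2)[OF q(1)]
      have "snd q \<subseteq> win (\<omega> (fst q))" using fine[OF qP] \<delta>_nd(2)[OF tag[OF qP] qd] by (rule order_trans)
      then show "snd q \<subseteq> win (\<omega> (fst q)) \<and> win (\<omega> (fst q)) \<subseteq> {0..1} \<and> 0 < len (snd q)"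
        using win_at_nondyadic(2)[OF tag[OF qP] qd] GP(3)[OF q(1)] unfolding \<omega>_def by blast
      have "(1/2) ^ \<nu> (fst q) < \<delta>k k (fst q)" using bspec[OF \<nu> tag[OF qP]] q(2) by simp
      then show "fst q \<in> win (\<omega> (fst q)) \<and> len (win (\<omega> (fst q))) < \<delta>k k (fst q)"
        unfolding len\<omega> using in_win_at[of "fst q"] by (simp add: \<omega>_def)
      have \<sigma>: "\<sigma> q \<in> snd q" "\<sigma> q \<in> {0..1}" "\<kappa> (\<sigma> q) = k" "\<nu> (\<sigma> q) = \<nu> (fst q)"
        using bspec[OF \<sigma>_all q(1)] q(2) by (auto simp: B_def)
      have "(1/2) ^ \<nu> (\<sigma> q) < \<delta>k (\<kappa> (\<sigma> q)) (\<sigma> q)" using bspec[OF \<nu> \<sigma>(2)] .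
      then show "\<sigma> q \<in> snd q \<and> len (win (\<omega> (fst q))) < \<delta>k k (\<sigma> q)"
        unfolding len\<omega> using \<sigma> by simp
    qed
    then have "\<exists>R. \<forall>k. R k \<subseteq> Q k \<and> (\<Sum>q\<in>R k. len (snd q)) \<le> 1 / C k \<and>
      (\<forall>x\<in>T. \<bar>\<Sum>q\<in>Q k - R k. len (snd q) * h x (fst q) - integral (snd q) (h x)\<bar>
        \<le> 2 * C k * \<epsilon>k k + \<epsilon>k k)"
      by (intro choice allI)
    then obtain R where R_all: "\<forall>k. R k \<subseteq> Q k \<and> (\<Sum>q\<in>R k. len (snd q)) \<le> 1 / C k \<and>
      (\<forall>x\<in>T. \<bar>\<Sum>q\<in>Q k - R k. len (snd q) * h x (fst q) - integral (snd q) (h x)\<bar>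
        \<le> 2 * C k * \<epsilon>k k + \<epsilon>k k)" ..
    have R: "R k \<subseteq> Q k" "(\<Sum>q\<in>R k. len (snd q)) \<le> 1 / C k"
      "x \<in> T \<Longrightarrow> \<bar>\<Sum>q\<in>Q k - R k. len (snd q) * h x (fst q) - integral (snd q) (h x)\<bar>
        \<le> 2 * C k * \<epsilon>k k + \<epsilon>k k" for k x
      using spec[OF R_all, of k] by simp_all
    define S where "S = {q \<in> G. q \<notin> R (\<kappa> (fst q))}"
    have SP: "S \<subseteq> P" by (auto simp: S_def G_def)
    \<comment> \<open>Dominates both quantities to be estimated: \<open>len (snd q)\<close> because
      \<open>1 \<le> \<kappa>\<close>, and \<open>len (snd q) * h x (fst q)\<close> because
      \<open>h x \<le> b \<le> \<kappa>\<close> at the tag.\<close>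
    define \<phi> where "\<phi> q = len (snd q) * real (\<kappa> (fst q))" for q :: "real \<times> real set"
    have \<phi>: "0 \<le> \<phi> q" for q by (simp add: \<phi>_def)
    define D where "D = {q \<in> P. fst q \<in> dyadics}"
    define N where "N = {q \<in> P. fst q \<notin> dyadics \<and> snd q \<inter> B (\<kappa> (fst q)) (\<nu> (fst q)) = {}}"
    define H where "H = {q \<in> G. q \<in> R (\<kappa> (fst q))}"
    define Z where "Z = {q \<in> P. len (snd q) = 0}"
    have fin: "finite D" "finite N" "finite H" "finite Z"
      using fP by (auto simp: D_def N_def H_def G_def Z_def)
    \<comment> \<open>Four reasons to be discarded: no length, a dyadic tag, no companion point, a
      heavy window. Their weights are bounded by 0, \<open>e / 8\<close>, \<open>e / 4\<close> and
      \<open>e / 8\<close>; the third comes from a double geometric series over class and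
      level.\<close>
    have "P - S \<subseteq> Z \<union> (D \<union> (N \<union> H))"
      by (auto simp: S_def G_def D_def N_def H_def Z_def zero_less_measure_iff)
    then have "sum \<phi> (P - S) \<le> sum \<phi> (Z \<union> (D \<union> (N \<union> H)))"
      using fin \<phi> by (intro sum_mono2) auto
    also have "\<dots> \<le> sum \<phi> Z + (sum \<phi> D + (sum \<phi> N + sum \<phi> H))"
      using fin \<phi> by (intro order_trans[OF sum_Un_le] add_left_mono) auto
    also have "sum \<phi> Z = 0" by (intro sum.neutral) (auto simp: Z_def \<phi>_def)
    also have "sum \<phi> D \<le> e / 8"
    proof -
      have "sum \<phi> D \<le> (\<Sum>t\<in>fst ` D. e * (1/2) ^ 4 * (1/2) ^ g t)"
      proof (rule sum_le_sum_fibres[OF fin(1)])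
        fix t assume "t \<in> fst ` D"
        then have t: "t \<in> {0..1}" "t \<in> dyadics" using tag by (auto simp: D_def)
        have "(\<Sum>q | q \<in> D \<and> fst q = t. \<phi> q) = (\<Sum>q | q \<in> D \<and> fst q = t. len (snd q)) * real (\<kappa> t)"
          unfolding sum_distrib_right by (intro sum.cong) (auto simp: \<phi>_def)
        also have "\<dots> \<le> measure lebesgue (ball t (\<delta> t)) * real (\<kappa> t)"
        proof (intro mult_right_mono nonoverlapping_sum_content_le)
          show "nonoverlapping {q \<in> D. fst q = t}"
            by (rule nonoverlapping_subset[OF nP]) (auto simp: D_def)
          show "snd q \<subseteq> ball t (\<delta> t)" if "q \<in> {q \<in> D. fst q = t}" for q
            using fine[of q] that by (auto simp: D_def)
        qed auto
        also have "measure lebesgue (ball t (\<delta> t)) = 2 * \<delta> t"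
          unfolding ball_eq_greaterThanLessThan using \<delta>_pos[OF t(1)] by simp
        also have "2 * \<delta> t * real (\<kappa> t) = e * (1/2) ^ 4 * (1/2) ^ g t"
          unfolding \<delta>_dy[OF t] using \<kappa>(2)[of t] by (simp add: power_add power_numeral_reduce)
        finally show "(\<Sum>q | q \<in> D \<and> fst q = t. \<phi> q) \<le> e * (1/2) ^ 4 * (1/2) ^ g t" .
      qed
      also have "\<dots> = e * (1/2) ^ 4 * (\<Sum>k\<in>g ` fst ` D. (1/2) ^ k)"
      proof -
        have "inj_on g (fst ` D)" by (rule inj_on_subset[OF g]) (auto simp: D_def)
        then show ?thesis by (simp add: sum_distrib_left sum.reindex)
      qed
      also have "\<dots> \<le> e * (1/2) ^ 4 * 2"
        using e fin by (intro mult_left_mono sum_power_half_le) auto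
      finally show ?thesis by (simp add: power_numeral_reduce)
    qed
    also have "sum \<phi> N \<le> e / 4"
    proof -
      let ?c = "\<lambda>q. (\<kappa> (fst q), \<nu> (fst q))"
      have "sum \<phi> N \<le> (\<Sum>c\<in>?c ` N. e * (1/2) ^ 4 * ((1/2) ^ fst c * (1/2) ^ snd c))"
      proof (rule sum_le_sum_fibres[OF fin(2)])
        fix c assume "c \<in> ?c ` N"
        obtain k n where c: "c = (k, n)" by fastforce
        let ?F = "{q. q \<in> N \<and> ?c q = c}"
        let ?V = "\<Union>(snd ` ?F)"
        have nF: "nonoverlapping ?F" by (rule nonoverlapping_subset[OF nP]) (auto simp: N_def)
        have F: "q \<in> P" "fst q \<notin> dyadics" "snd q \<inter> B k n = {}" "\<kappa> (fst q) = k" "\<nu> (fst q) = n"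
          if "q \<in> ?F" for q using that by (auto simp: N_def c)
        have clV: "closed ?V"
        proof (rule closed_Union)
          show "finite (snd ` ?F)" using nonoverlapping_finite[OF nF] by simp
          show "\<forall>K\<in>snd ` ?F. closed K"
          proof
            fix K assume "K \<in> snd ` ?F"
            then obtain u v where "K = {u..v}" using nonoverlapping_image[OF nF] by blast
            then show "closed K" by simp
          qed
        qed
        have "snd q \<subseteq> U k n" if q: "q \<in> ?F" for q
          using fine[OF F(1)[OF q]] \<delta>_nd(1)[OF tag[OF F(1)[OF q]] F(2)[OF q]] F(4,5)[OF q]
          by auto
        then have "?V \<subseteq> U k n" by blast
        moreover have "?V \<inter> B k n = {}" using F(3) by blast
        ultimately have V: "measure lebesgue ?V \<le> \<eta> k n" using U(3)[OF clV] by blast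
        have "(\<Sum>q\<in>?F. \<phi> q) = real k * (\<Sum>q\<in>?F. len (snd q))"
          unfolding sum_distrib_left by (intro sum.cong) (auto simp: \<phi>_def c)
        also have "\<dots> \<le> real k * \<eta> k n"
        proof (intro mult_left_mono order_trans[OF _ V] nonoverlapping_sum_content_le[OF nF])
          show "?V \<in> lmeasurable" by (rule lmeasurable_division[OF nonoverlapping_division[OF nF]])
        qed auto
        also have "\<dots> \<le> e * (1/2) ^ 4 * ((1/2) ^ fst c * (1/2) ^ snd c)"
          unfolding c fst_conv snd_conv by (rule \<eta>(2))
        finally show "(\<Sum>q\<in>?F. \<phi> q) \<le> e * (1/2) ^ 4 * ((1/2) ^ fst c * (1/2) ^ snd c)" .
      qed
      also have "\<dots> \<le> (\<Sum>c\<in>(fst ` ?c ` N) \<times> (snd ` ?c ` N). e * (1/2) ^ 4 * ((1/2) ^ fst c * (1/2) ^ snd c))"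
      proof (rule sum_mono2)
        show "finite ((fst ` ?c ` N) \<times> (snd ` ?c ` N))" using fin by simp
        show "?c ` N \<subseteq> (fst ` ?c ` N) \<times> (snd ` ?c ` N)" by (simp add: subset_fst_snd)
        show "0 \<le> e * (1/2) ^ 4 * ((1/2) ^ fst c * (1/2) ^ snd c)" for c :: "nat \<times> nat" using e by simp
      qed
      also have "\<dots> = e * (1/2) ^ 4 * ((\<Sum>k\<in>fst ` ?c ` N. (1/2) ^ k) * (\<Sum>n\<in>snd ` ?c ` N. (1/2) ^ n))"
        by (rule sum_times_product)
      also have "\<dots> \<le> e * (1/2) ^ 4 * (2 * 2)"
        using e fin by (intro mult_left_mono mult_mono sum_power_half_le sum_nonneg) auto
      finally show ?thesis by (simp add: power_numeral_reduce)
    qed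
    also have "sum \<phi> H \<le> e / 8"
    proof -
      have "sum \<phi> H \<le> (\<Sum>k\<in>(\<lambda>q. \<kappa> (fst q)) ` H. e * (1/2) ^ 4 * (1/2) ^ k)"
      proof (rule sum_le_sum_fibres[OF fin(3)])
        fix k assume "k \<in> (\<lambda>q. \<kappa> (fst q)) ` H"
        let ?F = "{q. q \<in> H \<and> \<kappa> (fst q) = k}"
        have "finite (Q k)" using fP by (simp add: Q_def G_def)
        with R(1)[of k] have "finite (R k)" by (rule finite_subset)
        have "(\<Sum>q\<in>?F. \<phi> q) = real k * (\<Sum>q\<in>?F. len (snd q))"
          unfolding sum_distrib_left by (intro sum.cong) (auto simp: \<phi>_def)
        also have "\<dots> \<le> real k * (\<Sum>q\<in>R k. len (snd q))"
          using \<open>finite (R k)\<close> by (intro mult_left_mono sum_mono2) (auto simp: H_def)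
        also have "\<dots> \<le> real k * (1 / C k)" by (intro mult_left_mono R(2)) auto
        also have "\<dots> \<le> e * (1/2) ^ 4 * (1/2) ^ k" using C(3)[of k] by (simp add: power_add mult_ac)
        finally show "(\<Sum>q\<in>?F. \<phi> q) \<le> e * (1/2) ^ 4 * (1/2) ^ k" .
      qed
      also have "\<dots> = e * (1/2) ^ 4 * (\<Sum>k\<in>(\<lambda>q. \<kappa> (fst q)) ` H. (1/2) ^ k)"
        by (simp only: sum_distrib_left)
      also have "\<dots> \<le> e * (1/2) ^ 4 * 2"
        using e fin by (intro mult_left_mono sum_power_half_le) auto
      finally show ?thesis by (simp add: power_numeral_reduce)
    qed
    finally have bad: "sum \<phi> (P - S) \<le> e / 2" by simp
    have "(\<Sum>q\<in>P - S. len (snd q)) \<le> sum \<phi> (P - S)"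
      unfolding \<phi>_def using \<kappa>(2) by (intro sum_mono) (simp add: mult_le_cancel_left1)
    then have lenbad: "(\<Sum>q\<in>P - S. len (snd q)) \<le> \<epsilon>" using bad e by linarith
    have "\<bar>(\<Sum>q\<in>P. len (snd q) * h x (fst q)) - (\<Sum>q\<in>S. integral (snd q) (h x))\<bar> \<le> \<epsilon>" if x: "x \<in> T" for x
    proof -
      have split: "(\<Sum>q\<in>P. len (snd q) * h x (fst q))
          = (\<Sum>q\<in>P - S. len (snd q) * h x (fst q)) + (\<Sum>q\<in>S. len (snd q) * h x (fst q))"
        by (rule sum.subset_diff[OF SP fP])
      have hq: "0 \<le> h x (fst q)" "h x (fst q) \<le> real (\<kappa> (fst q))" if "q \<in> P" for q
        using h_nonneg[OF x tag[OF that]] h_le[OF x tag[OF that]] \<kappa>(1)[of "fst q"] by auto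
      have 0: "0 \<le> (\<Sum>q\<in>P - S. len (snd q) * h x (fst q))"
        using hq by (intro sum_nonneg) auto
      have "(\<Sum>q\<in>P - S. len (snd q) * h x (fst q)) \<le> sum \<phi> (P - S)"
        unfolding \<phi>_def using hq by (intro sum_mono mult_left_mono) auto
      then have 1: "(\<Sum>q\<in>P - S. len (snd q) * h x (fst q)) \<le> e / 2" using bad by linarith
      let ?d = "\<lambda>q. len (snd q) * h x (fst q) - integral (snd q) (h x)"
      have fS: "finite S" using SP fP by (rule finite_subset)
      let ?K = "(\<lambda>q. \<kappa> (fst q)) ` S"
      \<comment> \<open>Sorted by class, the kept intervals are the sets \<open>Q k - R k\<close>,
        so the class errors add up geometrically to at most \<open>e / 8\<close>.\<close>
      have "sum ?d S = (\<Sum>k\<in>?K. \<Sum>q | q \<in> S \<and> \<kappa> (fst q) = k. ?d q)"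
        by (rule sum.image_gen[OF fS])
      also have "\<bar>\<dots>\<bar> \<le> (\<Sum>k\<in>?K. \<bar>\<Sum>q | q \<in> S \<and> \<kappa> (fst q) = k. ?d q\<bar>)" by (rule sum_abs)
      also have "\<dots> \<le> (\<Sum>k\<in>?K. e * (1/2) ^ 4 * (1/2) ^ k)"
      proof (rule sum_mono)
        fix k
        have "{q. q \<in> S \<and> \<kappa> (fst q) = k} = Q k - R k" by (auto simp: S_def Q_def)
        then have "\<bar>\<Sum>q | q \<in> S \<and> \<kappa> (fst q) = k. ?d q\<bar> \<le> e * (1/2) ^ (k + 4)"
          using order_trans[OF R(3)[OF x, of k] \<epsilon>k(2)[of k]] by simp
        then show "\<bar>\<Sum>q | q \<in> S \<and> \<kappa> (fst q) = k. ?d q\<bar> \<le> e * (1/2) ^ 4 * (1/2) ^ k"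
          by (simp add: power_add mult_ac)
      qed
      also have "\<dots> = e * (1/2) ^ 4 * (\<Sum>k\<in>?K. (1/2) ^ k)" by (simp only: sum_distrib_left)
      also have "\<dots> \<le> e * (1/2) ^ 4 * 2"
        using e fS by (intro mult_left_mono sum_power_half_le) auto
      finally have "\<bar>sum ?d S\<bar> \<le> e / 8" by (simp add: power_numeral_reduce)
      moreover have "sum ?d S = (\<Sum>q\<in>S. len (snd q) * h x (fst q)) - (\<Sum>q\<in>S. integral (snd q) (h x))"
        by (rule sum_subtractf)
      ultimately show ?thesis using split 0 1 e by linarith
    qed
    with SP lenbad show ?thesis by (intro exI[of _ S] conjI ballI)
  qed
  moreover have "gauge01 \<delta>" using \<delta>_pos by (simp add: gauge01_def)
  ultimately show ?thesis by (intro exI[of _ \<delta>] conjI allI impI) blast+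
qed

end

section \<open>Upper McShane bound, uniform absolute continuity, convergence\<close>

lemma exists_perron_partition01:
  assumes "gauge01 \<delta>"
  obtains P where "perron_partition01 P" "delta_fine \<delta> P"
proof -
  obtain P where P: "P tagged_division_of {0..1}" "ball_gauge \<delta> fine P"
    using fine_division_exists_real[OF gauge_ball_gauge[OF assms]] by blast
  then have pp: "perron_partition01 P" by (simp add: perron_partition01_iff)
  then have "fst q \<in> {0..1}" if "q \<in> P" for q
    using partition01_tag[of P q] that by (simp add: perron_partition01_def)
  then have "delta_fine \<delta> P" using P(2) by (simp add: ball_gauge_fine_iff)
  with pp show ?thesis by (rule that)
qed

lemma tagged_division_nonoverlapping:
  fixes p :: "(real \<times> real set) set"
  assumes "p tagged_division_of S"
  shows "nonoverlapping p" "\<And>q. q \<in> p \<Longrightarrow> fst q \<in> snd q" "\<Union>(snd ` p) = S"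
proof -
  note D = tagged_division_ofD[OF assms]
  show tag: "fst q \<in> snd q" if "q \<in> p" for q using D(2)[of "fst q" "snd q"] that by simp
  have "\<exists>a b. a \<le> b \<and> snd q = {a..b}" if q: "q \<in> p" for q
  proof -
    obtain a b where ab: "snd q = {a..b}" using D(4)[of "fst q" "snd q"] q by (auto simp: box_real)
    then have "a \<le> b" using tag[OF q] by auto
    with ab show ?thesis by blast
  qed
  moreover have "interior (snd q) \<inter> interior (snd r) = {}" if "q \<in> p" "r \<in> p" "q \<noteq> r" for q r
    using D(5)[of "fst q" "snd q" "fst r" "snd r"] that by simp
  ultimately show "nonoverlapping p" using D(1) by (simp add: nonoverlapping_def)
  show "\<Union>(snd ` p) = S" unfolding D(6)[symmetric] by force
qed

lemma exists_fine_tagging: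
  assumes Q: "nonoverlapping Q" and \<delta>: "gauge01 \<delta>" and sub: "\<And>q. q \<in> Q \<Longrightarrow> snd q \<subseteq> {0..1}"
  shows "\<exists>p. nonoverlapping p \<and> (\<forall>q\<in>p. fst q \<in> snd q) \<and>
    \<Union>(snd ` p) = \<Union>(snd ` Q) \<and> delta_fine \<delta> p"
proof -
  obtain p where p: "p tagged_division_of \<Union>(snd ` Q)" "ball_gauge \<delta> fine p"
  proof (rule tagged_division_Union_exists[of "snd ` Q" "ball_gauge \<delta>" "\<Union>(snd ` Q)"])
    show "finite (snd ` Q)" using nonoverlapping_finite[OF Q] by simp
    show "\<forall>K\<in>snd ` Q. \<exists>p. p tagged_division_of K \<and> ball_gauge \<delta> fine p"
    proof
      fix K assume "K \<in> snd ` Q"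
      then obtain a b where "K = {a..b}" using nonoverlapping_image[OF Q] by blast
      moreover obtain p where "p tagged_division_of {a..b}" "ball_gauge \<delta> fine p"
        by (rule fine_division_exists_real[OF gauge_ball_gauge[OF \<delta>]])
      ultimately show "\<exists>p. p tagged_division_of K \<and> ball_gauge \<delta> fine p" by auto
    qed
    show "\<forall>K\<in>snd ` Q. \<forall>L\<in>snd ` Q. K \<noteq> L \<longrightarrow> interior K \<inter> interior L = {}"
      using division_ofD(5)[OF nonoverlapping_division[OF Q]] by simp
  qed (use that in auto)
  note t = tagged_division_nonoverlapping[OF p(1)]
  have "fst q \<in> {0..1}" if q: "q \<in> p" for q
  proof -
    have "snd q \<subseteq> \<Union>(snd ` p)" using q by blast
    also have "\<dots> \<subseteq> {0..1}" unfolding t(3) using sub by blast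
    finally show ?thesis using t(2)[OF q] by blast
  qed
  then have "delta_fine \<delta> p" using p(2) by (simp add: ball_gauge_fine_iff)
  with t show ?thesis by (intro exI[of _ p] conjI ballI)
qed

context uniform_henstock
begin

definition mcshane_bounded :: "(real \<Rightarrow> real) \<Rightarrow> real \<Rightarrow> bool" where
  "mcshane_bounded \<delta> \<epsilon> \<longleftrightarrow> gauge01 \<delta> \<and> (\<forall>P. partition01 P \<and> delta_fine \<delta> P \<longrightarrow>
     (\<forall>x\<in>T. (\<Sum>q\<in>P. len (snd q) * h x (fst q)) \<le> integral {0..1} (h x) + \<epsilon>))"

text \<open>Only an upper bound at this stage: by positivity the integrals over the kept intervals
  stay below the full integral, whereas a lower bound would require those over the discarded ones to
  be small.\<close>

lemma exists_mcshane_bounded: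
  assumes "0 < \<epsilon>"
  obtains \<delta> where "mcshane_bounded \<delta> \<epsilon>"
proof -
  obtain \<delta> where \<delta>: "gauge01 \<delta>" "\<And>P. partition01 P \<Longrightarrow> delta_fine \<delta> P \<Longrightarrow>
    (\<exists>S\<subseteq>P. (\<Sum>q\<in>P - S. len (snd q)) \<le> \<epsilon> \<and>
      (\<forall>x\<in>T. \<bar>(\<Sum>q\<in>P. len (snd q) * h x (fst q)) - (\<Sum>q\<in>S. integral (snd q) (h x))\<bar> \<le> \<epsilon>))"
    using good_subfamily[OF assms] by auto
  have "(\<Sum>q\<in>P. len (snd q) * h x (fst q)) \<le> integral {0..1} (h x) + \<epsilon>"
    if P: "partition01 P" "delta_fine \<delta> P" and x: "x \<in> T" for P x
  proof -
    obtain S where S: "S \<subseteq> P"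
      "\<bar>(\<Sum>q\<in>P. len (snd q) * h x (fst q)) - (\<Sum>q\<in>S. integral (snd q) (h x))\<bar> \<le> \<epsilon>"
      using \<delta>(2)[OF P] x by auto
    have "(\<Sum>q\<in>S. integral (snd q) (h x)) \<le> integral {0..1} (h x)"
    proof (rule nonoverlapping_sum_integral_le)
      show "nonoverlapping S"
        by (rule nonoverlapping_subset[OF partition01_nonoverlapping[OF P(1)] S(1)])
      show "h x integrable_on {0..1}" by (rule h_integrable[OF x])
      show "snd q \<subseteq> {0..1}" if "q \<in> S" for q
        using partition01_Union[OF P(1)] S(1) that by blast
    qed (rule h_nonneg[OF x])
    with S(2) show ?thesis by linarith
  qed
  then show ?thesis using \<delta>(1) by (intro that[of \<delta>]) (simp add: mcshane_bounded_def)
qed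

text \<open>Uniform absolute continuity of the indefinite integrals, from the upper bound alone: keep the
  tags of one Perron partition \<open>P\<^sub>0\<close> off a short exceptional set and retag the exceptional set by a
  fine Perron partition. Its integral is then counted in addition to the full integral.\<close>

lemma integral_small_on_short_families:
  assumes \<delta>: "mcshane_bounded \<delta> \<epsilon>" "henstock_gauge T h \<delta> \<epsilon>" "0 < \<epsilon>"
    and P0: "perron_partition01 P0" "delta_fine \<delta> P0"
    and P: "partition01 P" and S: "S \<subseteq> P"
    and short: "(\<Sum>q\<in>P - S. len (snd q)) * (\<Sum>q\<in>P0. b (fst q)) \<le> \<epsilon>"
    and x: "x \<in> T"
  shows "(\<Sum>q\<in>P - S. integral (snd q) (h x)) \<le> 4 * \<epsilon>"
proof -
  have g: "gauge01 \<delta>" using \<delta>(1) by (simp add: mcshane_bounded_def)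
  have nP: "nonoverlapping P" by (rule partition01_nonoverlapping[OF P])
  have fP: "finite P" by (rule nonoverlapping_finite[OF nP])
  have P0': "partition01 P0" using P0(1) by (simp add: perron_partition01_def)
  have nP0: "nonoverlapping P0" by (rule partition01_nonoverlapping[OF P0'])
  have fP0: "finite P0" by (rule nonoverlapping_finite[OF nP0])
  have nPS: "nonoverlapping (P - S)" by (rule nonoverlapping_subset[OF nP]) auto
  have subP: "snd q \<subseteq> {0..1}" if "q \<in> P" for q using partition01_Union[OF P] that by blast
  have subP0: "snd q \<subseteq> {0..1}" "fst q \<in> {0..1}" if "q \<in> P0" for q
    using partition01_Union[OF P0'] partition01_tag[OF P0' that] that by blast+
  have subPS: "snd q \<subseteq> {0..1}" if "q \<in> P - S" for q using subP that by blast
  obtain p where "nonoverlapping p \<and> (\<forall>q\<in>p. fst q \<in> snd q) \<and>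
    \<Union>(snd ` p) = \<Union>(snd ` (P - S)) \<and> delta_fine \<delta> p"
    using exists_fine_tagging[OF nPS g subPS] ..
  then have p: "nonoverlapping p" "\<And>q. q \<in> p \<Longrightarrow> fst q \<in> snd q"
    "\<Union>(snd ` p) = \<Union>(snd ` (P - S))" "delta_fine \<delta> p" by simp_all
  have subp: "snd q \<subseteq> {0..1}" if q: "q \<in> p" for q
  proof -
    have "snd q \<subseteq> \<Union>(snd ` p)" using q by blast
    also have "\<dots> \<subseteq> {0..1}" unfolding p(3) using subPS by blast
    finally show ?thesis .
  qed
  let ?c = "\<lambda>(q, r). (fst r, snd q \<inter> snd r)"
  \<comment> \<open>Common refinement of the kept intervals with \<open>P0\<close>, tagged from
    \<open>P0\<close>. Such a tag may lie outside the smaller interval, so the refinement need not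
    be a Perron partition, but \<open>mcshane_bounded\<close> admits free tags.\<close>
  define I where "I = {z \<in> S \<times> P0. snd (fst z) \<inter> snd (snd z) \<noteq> {}}"
  define Z where "Z = ?c ` I"
  have fI: "finite I" unfolding I_def using fP fP0 S by (auto intro: finite_subset)
  have Iint: "\<exists>u v. u \<le> v \<and> snd q \<inter> snd r = {u..v}" if "(q, r) \<in> I" for q r
  proof -
    have qr: "q \<in> P" "r \<in> P0" "snd q \<inter> snd r \<noteq> {}" using that S by (auto simp: I_def)
    obtain a1 b1 a2 b2 where "snd q = {a1..b1}" "snd r = {a2..b2}"
      using nonoverlapping_interval[OF nP qr(1)] nonoverlapping_interval[OF nP0 qr(2)] by blast
    then have "snd q \<inter> snd r = {max a1 a2..min b1 b2}" by auto
    then show ?thesis using qr(3) by (intro exI[of _ "max a1 a2"] exI[of _ "min b1 b2"]) auto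
  qed
  have Idisj: "interior (snd q \<inter> snd r) \<inter> interior (snd q' \<inter> snd r') = {}"
    if "(q, r) \<in> I" "(q', r') \<in> I" "(q, r) \<noteq> (q', r')" for q r q' r'
  proof -
    have *: "q \<in> P" "r \<in> P0" "q' \<in> P" "r' \<in> P0" using that(1,2) S by (auto simp: I_def)
    have "interior (snd q) \<inter> interior (snd q') = {} \<or> interior (snd r) \<inter> interior (snd r') = {}"
      using nonoverlapping_disjoint[OF nP *(1,3)] nonoverlapping_disjoint[OF nP0 *(2,4)] that(3) by auto
    then show ?thesis unfolding interior_Int by blast
  qed
  have nZ: "nonoverlapping Z"
    unfolding nonoverlapping_def
  proof (intro conjI ballI impI)
    show "finite Z" using fI by (simp add: Z_def)
    show "\<exists>u v. u \<le> v \<and> snd z = {u..v}" if z: "z \<in> Z" for z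
    proof -
      obtain q r where "(q, r) \<in> I" "z = ?c (q, r)" using z unfolding Z_def by auto
      then show ?thesis using Iint[of q r] by simp
    qed
    show "interior (snd z) \<inter> interior (snd z') = {}" if z: "z \<in> Z" "z' \<in> Z" "z \<noteq> z'" for z z'
    proof -
      obtain q r q' r' where *: "(q, r) \<in> I" "z = ?c (q, r)" "(q', r') \<in> I" "z' = ?c (q', r')"
        using z(1,2) unfolding Z_def by auto
      then have "(q, r) \<noteq> (q', r')" using z(3) by auto
      then show ?thesis using Idisj[OF *(1,3)] *(2,4) by simp
    qed
  qed
  have Zsub: "\<Union>(snd ` Z) \<subseteq> \<Union>(snd ` S)" by (auto simp: Z_def I_def)
  have disjSp: "interior K \<inter> interior L = {}" if KL: "K \<in> snd ` Z" "L \<in> snd ` p" for K L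
  proof -
    obtain q r where "(q, r) \<in> I" "K = snd q \<inter> snd r" using KL(1) unfolding Z_def by auto
    then have q: "q \<in> S" "K \<subseteq> snd q" by (auto simp: I_def)
    have "interior (snd q) \<inter> interior (\<Union>(snd ` (P - S))) = {}"
    proof (rule Int_interior_Union_intervals)
      show "finite (snd ` (P - S))" using fP by simp
      show "open (interior (snd q))" by simp
      show "\<exists>a b. T = cbox a b" if "T \<in> snd ` (P - S)" for T
        using nonoverlapping_image[OF nPS that] by (auto simp: box_real)
      show "interior (snd q) \<inter> interior T = {}" if "T \<in> snd ` (P - S)" for T
        using that nonoverlapping_disjoint[OF nP, of q] q(1) S by blast
    qed
    moreover have "L \<subseteq> \<Union>(snd ` (P - S))" using KL(2) p(3) by blast
    ultimately show ?thesis using interior_mono[OF q(2)] interior_mono[of L] by blast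
  qed
  have nZp: "nonoverlapping (Z \<union> p)"
    unfolding nonoverlapping_def
  proof (intro conjI ballI impI)
    show "finite (Z \<union> p)" using nonoverlapping_finite nZ p(1) by blast
    show "\<exists>u v. u \<le> v \<and> snd z = {u..v}" if "z \<in> Z \<union> p" for z
      using that nonoverlapping_interval[OF nZ] nonoverlapping_interval[OF p(1)] by blast
    show "interior (snd z) \<inter> interior (snd z') = {}" if z: "z \<in> Z \<union> p" "z' \<in> Z \<union> p" "z \<noteq> z'" for z z'
    proof -
      consider "z \<in> Z" "z' \<in> Z" | "z \<in> p" "z' \<in> p" | "z \<in> Z" "z' \<in> p" | "z \<in> p" "z' \<in> Z"
        using z(1,2) by blast
      then show ?thesis
      proof cases
        case 1 then show ?thesis using nonoverlapping_disjoint[OF nZ] z(3) by simp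
      next
        case 2 then show ?thesis using nonoverlapping_disjoint[OF p(1)] z(3) by simp
      next
        case 3 then show ?thesis using disjSp by simp
      next
        case 4 then show ?thesis using disjSp[of "snd z'" "snd z"] by (simp add: Int_commute)
      qed
    qed
  qed
  have UZ: "\<Union>(snd ` Z) = \<Union>(snd ` S)"
  proof
    show "\<Union>(snd ` S) \<subseteq> \<Union>(snd ` Z)"
    proof
      fix s assume "s \<in> \<Union>(snd ` S)"
      then obtain q where q: "q \<in> S" "s \<in> snd q" by blast
      then have "s \<in> \<Union>(snd ` P0)" using subP S partition01_Union[OF P0'] by blast
      then obtain r where r: "r \<in> P0" "s \<in> snd r" by blast
      then have "(q, r) \<in> I" "s \<in> snd (?c (q, r))" using q by (auto simp: I_def)
      then have "?c (q, r) \<in> Z" "s \<in> snd (?c (q, r))" unfolding Z_def by blast+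
      then show "s \<in> \<Union>(snd ` Z)" by blast
    qed
  qed (rule Zsub)
  have part: "partition01 (Z \<union> p)"
  proof (rule partition01I[OF nZp])
    show "fst z \<in> {0..1}" if z: "z \<in> Z \<union> p" for z
    proof (cases "z \<in> p")
      case True then show ?thesis using p(2)[OF True] subp[OF True] by blast
    next
      case False
      then have "z \<in> Z" using z by blast
      then obtain q r where "(q, r) \<in> I" "z = ?c (q, r)" unfolding Z_def by auto
      then have "r \<in> P0" "fst z = fst r" by (auto simp: I_def)
      then show ?thesis using subP0(2) by simp
    qed
    have "\<Union>(snd ` (Z \<union> p)) = \<Union>(snd ` S) \<union> \<Union>(snd ` (P - S))"
      unfolding image_Un Union_Un_distrib UZ p(3) ..
    also have "\<dots> = \<Union>(snd ` P)" using S by blast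
    finally show "\<Union>(snd ` (Z \<union> p)) = {0..1}" using partition01_Union[OF P] by simp
  qed
  have "delta_fine \<delta> Z"
    unfolding delta_fine_iff
  proof
    fix z assume "z \<in> Z"
    then obtain q r where "(q, r) \<in> I" "z = ?c (q, r)" unfolding Z_def by auto
    then have r: "r \<in> P0" "z = (fst r, snd q \<inter> snd r)" by (auto simp: I_def)
    then have "snd r \<subseteq> {fst r - \<delta> (fst r)<..<fst r + \<delta> (fst r)}"
      using P0(2) by (simp add: delta_fine_iff)
    then show "snd z \<subseteq> {fst z - \<delta> (fst z)<..<fst z + \<delta> (fst z)}" using r(2) by auto
  qed
  then have fineZp: "delta_fine \<delta> (Z \<union> p)" using p(4) by (auto simp: delta_fine_iff)
  let ?s = "\<lambda>q. len (snd q) * h x (fst q)"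
  have upper: "sum ?s (Z \<union> p) \<le> integral {0..1} (h x) + \<epsilon>"
    using \<delta>(1) part fineZp x by (simp add: mcshane_bounded_def)
  have zero: "?s z = 0" if "z \<in> Z \<inter> p" for z
  proof -
    have "interior (snd z) = {}" using disjSp[of "snd z" "snd z"] that by simp
    then have "len (snd z) = 0" using content_interior_empty[OF p(1)] that by blast
    then show ?thesis by simp
  qed
  have "sum ?s (Z \<union> p) + sum ?s (Z \<inter> p) = sum ?s Z + sum ?s p"
    by (rule sum.union_inter) (use nonoverlapping_finite nZ p(1) in auto)
  moreover have "sum ?s (Z \<inter> p) = 0" using zero by (rule sum.neutral[OF ballI])
  ultimately have sum_Zp: "sum ?s (Z \<union> p) = sum ?s Z + sum ?s p" by simp
  have hP0: "0 \<le> h x (fst r)" "h x (fst r) \<le> b (fst r)" if "r \<in> P0" for r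
    using h_nonneg[OF x] h_le[OF x] subP0(2)[OF that] by auto
  have sumZ: "sum ?s P0 - \<epsilon> \<le> sum ?s Z"
  proof -
    have "sum ?s Z = sum (?s \<circ> ?c) I"
      unfolding Z_def
    proof (rule sum.reindex_nontrivial[OF fI])
      fix z z' assume z: "z \<in> I" "z' \<in> I" "z \<noteq> z'" "?c z = ?c z'"
      obtain q r where 1: "z = (q, r)" by (rule prod.exhaust)
      obtain q' r' where 2: "z' = (q', r')" by (rule prod.exhaust)
      note * = 1 2
      have "interior (snd q \<inter> snd r) \<inter> interior (snd q' \<inter> snd r') = {}"
        by (rule Idisj) (use z * in auto)
      moreover have "snd q' \<inter> snd r' = snd q \<inter> snd r" using z(4) * by simp
      ultimately have "interior (snd q \<inter> snd r) = {}" by (simp only: Int_absorb)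
      moreover obtain u v where "snd q \<inter> snd r = cbox u v" using Iint[of q r] z(1) * by (auto simp: box_real)
      ultimately have "len (snd q \<inter> snd r) = 0" by (simp add: content_eq_0_interior)
      then show "?s (?c z) = 0" using * by simp
    qed
    also have "\<dots> = (\<Sum>z\<in>S \<times> P0. len (snd (fst z) \<inter> snd (snd z)) * h x (fst (snd z)))"
    proof (rule sum.mono_neutral_cong_left)
      show "finite (S \<times> P0)" using fP fP0 S by (auto intro: finite_subset)
    qed (auto simp: I_def case_prod_unfold)
    also have "\<dots> = (\<Sum>q\<in>S. \<Sum>r\<in>P0. len (snd q \<inter> snd r) * h x (fst r))"
      by (simp add: sum.cartesian_product case_prod_unfold)
    also have "\<dots> = (\<Sum>r\<in>P0. \<Sum>q\<in>S. len (snd q \<inter> snd r) * h x (fst r))" by (rule sum.swap)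
    also have "\<dots> = (\<Sum>r\<in>P0. (\<Sum>q\<in>S. len (snd q \<inter> snd r)) * h x (fst r))"
      by (simp add: sum_distrib_right)
    \<comment> \<open>Each interval of \<open>P0\<close> loses at most the total length of
      \<open>P - S\<close>; multiplied by the values \<open>h x (fst r) \<le> b (fst r)\<close>, the
      loss is bounded through \<open>short\<close>.\<close>
    also have "\<dots> \<ge> (\<Sum>r\<in>P0. (len (snd r) - (\<Sum>q\<in>P - S. len (snd q))) * h x (fst r))"
    proof (intro sum_mono mult_right_mono hP0)
      fix r assume r: "r \<in> P0"
      have borel: "snd q \<in> sets lborel" if "q \<in> P" for q
        using nonoverlapping_interval[OF nP that] by auto
      have borelr: "snd r \<in> sets lborel" using nonoverlapping_interval[OF nP0 r] by auto
      have "snd r = (\<Union>q\<in>P. snd q \<inter> snd r)" using subP0(1)[OF r] partition01_Union[OF P] by blast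
      then have "len (snd r) = len (\<Union>q\<in>P. snd q \<inter> snd r)" by simp
      also have "\<dots> \<le> (\<Sum>q\<in>P. len (snd q \<inter> snd r))"
        by (rule measure_UNION_le[OF fP]) (use borel borelr in auto)
      also have "\<dots> = (\<Sum>q\<in>P - S. len (snd q \<inter> snd r)) + (\<Sum>q\<in>S. len (snd q \<inter> snd r))"
        by (rule sum.subset_diff[OF S fP])
      also have "(\<Sum>q\<in>P - S. len (snd q \<inter> snd r)) \<le> (\<Sum>q\<in>P - S. len (snd q))"
      proof (rule sum_mono)
        fix q assume "q \<in> P - S"
        then have q: "q \<in> P" by simp
        obtain a c where "snd q = cbox a c" using nonoverlapping_interval[OF nP q] by (auto simp: box_real)
        then have "snd q \<in> fmeasurable lborel" by (simp only: fmeasurable_cbox)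
        then show "len (snd q \<inter> snd r) \<le> len (snd q)"
          using borel[OF q] borelr by (intro measure_mono_fmeasurable) auto
      qed
      finally show "len (snd r) - (\<Sum>q\<in>P - S. len (snd q)) \<le> (\<Sum>q\<in>S. len (snd q \<inter> snd r))" by linarith
    qed
    moreover have "(\<Sum>r\<in>P0. (len (snd r) - (\<Sum>q\<in>P - S. len (snd q))) * h x (fst r))
        = sum ?s P0 - (\<Sum>q\<in>P - S. len (snd q)) * (\<Sum>r\<in>P0. h x (fst r))"
      by (simp add: left_diff_distrib sum_subtractf sum_distrib_left)
    moreover have "(\<Sum>q\<in>P - S. len (snd q)) * (\<Sum>r\<in>P0. h x (fst r))
        \<le> (\<Sum>q\<in>P - S. len (snd q)) * (\<Sum>r\<in>P0. b (fst r))"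
      using hP0 by (intro mult_left_mono sum_mono sum_nonneg) auto
    ultimately show ?thesis using short by linarith
  qed
  have sumP0: "integral {0..1} (h x) - \<epsilon> \<le> sum ?s P0"
  proof -
    have "\<bar>sum ?s P0 - integral {0..1} (h x)\<bar> < \<epsilon>"
      using \<delta>(2) P0 x by (simp add: henstock_gauge_def)
    then show ?thesis by linarith
  qed
  have "\<bar>\<Sum>q\<in>p. len (snd q) * h x (fst q) - integral (snd q) (h x)\<bar> \<le> \<epsilon>"
    by (rule henstock_partial[OF \<delta>(2,3) x p(1,2) subp p(4)])
  then have "(\<Sum>q\<in>p. integral (snd q) (h x)) - \<epsilon> \<le> sum ?s p"
    unfolding sum_subtractf by linarith
  moreover have "(\<Sum>q\<in>p. integral (snd q) (h x)) = (\<Sum>q\<in>P - S. integral (snd q) (h x))"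
    using nonoverlapping_sum_integral[OF p(1) h_integrable[OF x] subp]
      nonoverlapping_sum_integral[OF nPS h_integrable[OF x] subPS]
    unfolding p(3) by (rule has_integral_unique)
  \<comment> \<open>One \<open>\<epsilon>\<close> each from the upper bound, from shortness, from
    the Henstock sum over \<open>P0\<close>, and from the Henstock lemma for \<open>p\<close>; the
    full integral cancels.\<close>
  ultimately show ?thesis using upper sum_Zp sumZ sumP0 by linarith
qed

text \<open>\<open>P0\<close> is fixed before the final gauge: the length allowed for discarded
  intervals depends on \<open>b\<close> at its tags, and \<open>good_subfamily\<close> can then be
  applied with that precision. The discarded integrals cost \<open>4 * e\<close> and the comparison
  \<open>\<eta> \<le> e\<close>, a strict margin below \<open>6 * e\<close>.\<close>

theorem uniform_mcshane:
  assumes "0 < \<epsilon>"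
  obtains \<delta> where "gauge01 \<delta>"
    "\<And>P x. partition01 P \<Longrightarrow> delta_fine \<delta> P \<Longrightarrow> x \<in> T \<Longrightarrow>
      \<bar>(\<Sum>q\<in>P. len (snd q) * h x (fst q)) - integral {0..1} (h x)\<bar> < \<epsilon>"
proof -
  define e where "e = \<epsilon> / 6"
  have e: "0 < e" using assms by (simp add: e_def)
  obtain \<delta>1 where \<delta>1: "mcshane_bounded \<delta>1 e" by (rule exists_mcshane_bounded[OF e])
  obtain \<delta>2 where \<delta>2: "henstock_gauge T h \<delta>2 e" using h_uniform[OF e] by blast
  define \<delta>0 where "\<delta>0 t = min (\<delta>1 t) (\<delta>2 t)" for t
  have g0: "gauge01 \<delta>0"
    using \<delta>1 \<delta>2 by (simp add: \<delta>0_def mcshane_bounded_def henstock_gauge_def gauge01_def)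
  have fine0: "delta_fine \<delta>1 P" "delta_fine \<delta>2 P" if "delta_fine \<delta>0 P" for P
    using delta_fine_mono[OF that] by (simp_all add: \<delta>0_def)
  have mb: "mcshane_bounded \<delta>0 e"
    using \<delta>1 g0 fine0(1) unfolding mcshane_bounded_def by blast
  have hg: "henstock_gauge T h \<delta>0 e"
    using \<delta>2 g0 fine0(2) unfolding henstock_gauge_def by blast
  obtain P0 where P0: "perron_partition01 P0" "delta_fine \<delta>0 P0"
    by (rule exists_perron_partition01[OF g0])
  define \<beta> where "\<beta> = (\<Sum>q\<in>P0. b (fst q))"
  have "0 \<le> \<beta>"
    unfolding \<beta>_def using P0(1) partition01_tag[of P0] b_nonneg
    by (intro sum_nonneg) (simp add: perron_partition01_def)
  define \<eta> where "\<eta> = min e (e / (\<beta> + 1))"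
  have \<eta>: "0 < \<eta>" "\<eta> \<le> e" "\<eta> * \<beta> \<le> e"
  proof -
    show "0 < \<eta>" "\<eta> \<le> e" using e \<open>0 \<le> \<beta>\<close> by (auto simp: \<eta>_def)
    have "\<eta> * \<beta> \<le> e / (\<beta> + 1) * \<beta>" using \<open>0 \<le> \<beta>\<close> by (intro mult_right_mono) (auto simp: \<eta>_def)
    also have "\<dots> \<le> e" using e \<open>0 \<le> \<beta>\<close> by (simp add: field_simps)
    finally show "\<eta> * \<beta> \<le> e" .
  qed
  obtain \<delta> where \<delta>: "gauge01 \<delta>" "\<And>P. partition01 P \<Longrightarrow> delta_fine \<delta> P \<Longrightarrow>
    (\<exists>S\<subseteq>P. (\<Sum>q\<in>P - S. len (snd q)) \<le> \<eta> \<and>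
      (\<forall>x\<in>T. \<bar>(\<Sum>q\<in>P. len (snd q) * h x (fst q)) - (\<Sum>q\<in>S. integral (snd q) (h x))\<bar> \<le> \<eta>))"
    using good_subfamily[OF \<eta>(1)] by auto
  have "\<bar>(\<Sum>q\<in>P. len (snd q) * h x (fst q)) - integral {0..1} (h x)\<bar> < \<epsilon>"
    if P: "partition01 P" "delta_fine \<delta> P" and x: "x \<in> T" for P x
  proof -
    obtain S where S: "S \<subseteq> P" "(\<Sum>q\<in>P - S. len (snd q)) \<le> \<eta>"
      "\<bar>(\<Sum>q\<in>P. len (snd q) * h x (fst q)) - (\<Sum>q\<in>S. integral (snd q) (h x))\<bar> \<le> \<eta>"
      using \<delta>(2)[OF P] x by auto
    have nP: "nonoverlapping P" by (rule partition01_nonoverlapping[OF P(1)])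
    have sub: "snd q \<subseteq> {0..1}" if "q \<in> P" for q using partition01_Union[OF P(1)] that by blast
    have "(\<Sum>q\<in>P - S. len (snd q)) * \<beta> \<le> \<eta> * \<beta>"
      using S(2) \<open>0 \<le> \<beta>\<close> by (rule mult_right_mono)
    then have "(\<Sum>q\<in>P - S. len (snd q)) * \<beta> \<le> e" using \<eta>(3) by linarith
    then have "(\<Sum>q\<in>P - S. len (snd q)) * (\<Sum>q\<in>P0. b (fst q)) \<le> e" by (simp only: \<beta>_def)
    then have 4: "(\<Sum>q\<in>P - S. integral (snd q) (h x)) \<le> 4 * e"
      by (rule integral_small_on_short_families[OF mb hg e P0 P(1) S(1) _ x])
    have nPS: "nonoverlapping (P - S)" by (rule nonoverlapping_subset[OF nP]) auto
    have 0: "0 \<le> (\<Sum>q\<in>P - S. integral (snd q) (h x))"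
    proof (intro sum_nonneg)
      fix q assume "q \<in> P - S"
      then have q: "snd q \<subseteq> {0..1}" "q \<in> P" using sub by auto
      obtain a c where "snd q = {a..c}" using nonoverlapping_interval[OF nP q(2)] by blast
      then show "0 \<le> integral (snd q) (h x)"
        using q(1) h_nonneg[OF x] integrable_subinterval_real[OF h_integrable[OF x]]
        by (intro integral_nonneg) auto
    qed
    have "(h x has_integral (\<Sum>q\<in>P. integral (snd q) (h x))) {0..1}"
      using nonoverlapping_sum_integral[OF nP h_integrable[OF x] sub] partition01_Union[OF P(1)] by simp
    then have "integral {0..1} (h x) = (\<Sum>q\<in>P. integral (snd q) (h x))" by (rule integral_unique)
    also have "\<dots> = (\<Sum>q\<in>P - S. integral (snd q) (h x)) + (\<Sum>q\<in>S. integral (snd q) (h x))"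
      by (rule sum.subset_diff[OF S(1) nonoverlapping_finite[OF nP]])
    finally show ?thesis using 0 4 S(3) \<eta>(2) e unfolding e_def by linarith
  qed
  with \<delta>(1) show ?thesis by (rule that)
qed

end

section \<open>Support functions and the Hausdorff distance\<close>

definition supp :: "('a::real_normed_vector \<Rightarrow>\<^sub>L real) \<Rightarrow> 'a set \<Rightarrow> real" where
  "supp y A = (SUP a\<in>A. y a)"

lemma bdd_above_blinfun_image:
  fixes A :: "'a::real_normed_vector set" and y :: "'a \<Rightarrow>\<^sub>L real"
  assumes "bounded A"
  shows "bdd_above (blinfun_apply y ` A)"
proof -
  obtain c where c: "\<And>a. a \<in> A \<Longrightarrow> norm a \<le> c" using assms by (auto simp: bounded_iff)
  have "y a \<le> norm y * c" if "a \<in> A" for a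
    using abs_blinfun_le[OF order_refl c[OF that], of y] by simp
  then show ?thesis by (intro bdd_aboveI2)
qed

lemma le_supp:
  fixes A :: "'a::real_normed_vector set"
  assumes "bounded A" "a \<in> A"
  shows "blinfun_apply y a \<le> supp y A"
  unfolding supp_def by (rule cSUP_upper[OF assms(2) bdd_above_blinfun_image[OF assms(1)]])

lemma supp_le:
  fixes A :: "'a::real_normed_vector set"
  assumes "A \<noteq> {}" "\<And>a. a \<in> A \<Longrightarrow> blinfun_apply y a \<le> s"
  shows "supp y A \<le> s"
  unfolding supp_def by (rule cSUP_least[OF assms])

lemma supp_translation:
  fixes A :: "'a::real_normed_vector set"
  assumes "bounded A" "A \<noteq> {}"
  shows "supp y ((\<lambda>x. x + c) ` A) = supp y A + blinfun_apply y c"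
proof (rule antisym)
  show "supp y ((\<lambda>x. x + c) ` A) \<le> supp y A + y c"
    by (rule supp_le) (use assms le_supp[OF assms(1)] in \<open>auto simp: blinfun.add_right\<close>)
  have "bounded ((\<lambda>x. x + c) ` A)"
    using bounded_translation[OF assms(1), of c] by (simp add: add.commute)
  note le = le_supp[OF this]
  have "supp y A \<le> supp y ((\<lambda>x. x + c) ` A) - y c"
  proof (rule supp_le[OF assms(2)])
    fix a assume "a \<in> A"
    then have "y (a + c) \<le> supp y ((\<lambda>x. x + c) ` A)" by (intro le) auto
    then show "y a \<le> supp y ((\<lambda>x. x + c) ` A) - y c" by (simp add: blinfun.add_right)
  qed
  then show "supp y A + y c \<le> supp y ((\<lambda>x. x + c) ` A)" by simp
qed

lemma supp_scaleR:
  fixes A :: "'a::real_normed_vector set"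
  assumes "bounded A" "A \<noteq> {}" "0 \<le> c"
  shows "supp y ((\<lambda>x. c *\<^sub>R x) ` A) = c * supp y A"
proof (cases "c = 0")
  case True
  then have "(\<lambda>x. c *\<^sub>R x) ` A = {0}" using assms(2) by auto
  then show ?thesis using True by (simp add: supp_def)
next
  case False
  then have c: "0 < c" using assms(3) by simp
  have bd: "bounded ((\<lambda>x. c *\<^sub>R x) ` A)" by (rule bounded_scaling[OF assms(1)])
  show ?thesis
  proof (rule antisym)
    show "supp y ((\<lambda>x. c *\<^sub>R x) ` A) \<le> c * supp y A"
      by (rule supp_le) (use assms c le_supp[OF assms(1)] in \<open>auto simp: blinfun.scaleR_right\<close>)
    have "supp y A \<le> supp y ((\<lambda>x. c *\<^sub>R x) ` A) / c"
    proof (rule supp_le[OF assms(2)])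
      fix a assume "a \<in> A"
      then have "y (c *\<^sub>R a) \<le> supp y ((\<lambda>x. c *\<^sub>R x) ` A)" by (intro le_supp[OF bd]) auto
      then show "y a \<le> supp y ((\<lambda>x. c *\<^sub>R x) ` A) / c"
        using c by (simp add: blinfun.scaleR_right pos_le_divide_eq mult.commute)
    qed
    then show "c * supp y A \<le> supp y ((\<lambda>x. c *\<^sub>R x) ` A)"
      using c by (simp add: pos_le_divide_eq mult.commute)
  qed
qed

lemma bounded_set_plus:
  fixes A B :: "'a::real_normed_vector set"
  assumes "bounded A" "bounded B"
  shows "bounded (A + B)"
proof -
  have "A + B = (\<Union>x\<in>A. \<Union>y\<in>B. {x + y})" by (auto simp: set_plus_def)
  then show ?thesis using bounded_sums[OF assms] by simp
qed

lemma supp_plus: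
  fixes A B :: "'a::real_normed_vector set"
  assumes A: "bounded A" "A \<noteq> {}" and B: "bounded B" "B \<noteq> {}"
  shows "supp y (A + B) = supp y A + supp y B"
proof (rule antisym)
  have ne: "A + B \<noteq> {}" using A B by (auto simp: set_plus_def)
  show "supp y (A + B) \<le> supp y A + supp y B"
  proof (rule supp_le[OF ne])
    fix z assume "z \<in> A + B"
    then obtain a b where "a \<in> A" "b \<in> B" "z = a + b" by (auto simp: set_plus_def)
    then show "y z \<le> supp y A + supp y B"
      using le_supp[OF A(1)] le_supp[OF B(1)] by (simp add: blinfun.add_right add_mono)
  qed
  have "supp y A \<le> supp y (A + B) - supp y B"
  proof (rule supp_le[OF A(2)])
    fix a assume a: "a \<in> A"
    have "supp y B \<le> supp y (A + B) - y a"
    proof (rule supp_le[OF B(2)])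
      fix b assume "b \<in> B"
      then have "y (a + b) \<le> supp y (A + B)"
        using a by (intro le_supp bounded_set_plus A B) auto
      then show "y b \<le> supp y (A + B) - y a" by (simp add: blinfun.add_right)
    qed
    then show "y a \<le> supp y (A + B) - supp y B" by simp
  qed
  then show "supp y A + supp y B \<le> supp y (A + B)" by simp
qed

section \<open>Riemann sums of sets\<close>

lemma riemann_sum_insert:
  assumes "finite P" "q \<notin> P"
  shows "riemann_sum \<Gamma> (insert q P) = (\<lambda>x. len (snd q) *\<^sub>R x) ` \<Gamma> (fst q) + riemann_sum \<Gamma> P"
  unfolding riemann_sum_def using assms by (simp add: case_prod_unfold)

lemma riemann_sum_empty: "riemann_sum \<Gamma> {} = {0}"
  by (simp add: riemann_sum_def set_zero)

text \<open>One induction for all claims, since additivity of the support function needs the partial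
  sum to be bounded and nonempty.\<close>

lemma riemann_sum_facts:
  fixes \<Gamma> :: "real \<Rightarrow> 'a::real_normed_vector set"
  assumes "finite P"
    and "\<And>q. q \<in> P \<Longrightarrow> bounded (\<Gamma> (fst q)) \<and> \<Gamma> (fst q) \<noteq> {} \<and> convex (\<Gamma> (fst q))"
  shows "bounded (riemann_sum \<Gamma> P) \<and> riemann_sum \<Gamma> P \<noteq> {} \<and> convex (riemann_sum \<Gamma> P) \<and>
    (\<forall>y. supp y (riemann_sum \<Gamma> P) = (\<Sum>q\<in>P. len (snd q) * supp y (\<Gamma> (fst q)))) \<and>
    (\<forall>f. (\<forall>q\<in>P. f (fst q) \<in> \<Gamma> (fst q)) \<longrightarrow> (\<Sum>q\<in>P. len (snd q) *\<^sub>R f (fst q)) \<in> riemann_sum \<Gamma> P)"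
  using assms
proof (induction P rule: finite_induct)
  case empty
  then show ?case by (simp add: riemann_sum_empty supp_def)
next
  case (insert q P)
  define R where "R = riemann_sum \<Gamma> P"
  define L where "L = (\<lambda>x. len (snd q) *\<^sub>R x) ` \<Gamma> (fst q)"
  have \<Gamma>: "bounded (\<Gamma> (fst q))" "\<Gamma> (fst q) \<noteq> {}" "convex (\<Gamma> (fst q))"
    using insert.prems[of q] by simp_all
  have L: "bounded L" "L \<noteq> {}" "convex L"
    unfolding L_def using \<Gamma> by (auto intro: bounded_scaling convex_scaling)
  have supL: "supp y L = len (snd q) * supp y (\<Gamma> (fst q))" for y
    unfolding L_def by (rule supp_scaleR[OF \<Gamma>(1,2)]) simp
  have IH: "bounded R" "R \<noteq> {}" "convex R"
    "\<And>y. supp y R = (\<Sum>q\<in>P. len (snd q) * supp y (\<Gamma> (fst q)))"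
    "\<And>f. (\<forall>q\<in>P. f (fst q) \<in> \<Gamma> (fst q)) \<Longrightarrow> (\<Sum>q\<in>P. len (snd q) *\<^sub>R f (fst q)) \<in> R"
    using insert.IH insert.prems unfolding R_def by simp_all
  have eq: "riemann_sum \<Gamma> (insert q P) = L + R"
    unfolding L_def R_def by (rule riemann_sum_insert[OF insert.hyps])
  have "L + R \<noteq> {}" using L(2) IH(2) by (auto simp: set_plus_def)
  moreover have "(\<Sum>q\<in>insert q P. len (snd q) *\<^sub>R f (fst q)) \<in> L + R"
    if f: "\<forall>q\<in>insert q P. f (fst q) \<in> \<Gamma> (fst q)" for f
  proof -
    have "len (snd q) *\<^sub>R f (fst q) \<in> L" unfolding L_def using f by (intro imageI) simp
    moreover have "(\<Sum>q\<in>P. len (snd q) *\<^sub>R f (fst q)) \<in> R" using f by (intro IH(5)) simp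
    ultimately show ?thesis using insert.hyps by (simp add: set_plus_intro)
  qed
  ultimately show ?case
    unfolding eq using supp_plus[OF L(1,2) IH(1,2)] supL IH(4) insert.hyps
      bounded_set_plus[OF L(1) IH(1)] convex_set_plus[OF L(3) IH(3)] by simp
qed

section \<open>The Hausdorff distance through support functions\<close>

lemma infdist_lessE:
  assumes "A \<noteq> {}" "infdist x A < e"
  obtains a where "a \<in> A" "dist x a < e"
proof -
  have "bdd_below (dist x ` A)" by (rule bdd_belowI2[of _ 0]) simp
  then have "\<exists>a\<in>A. dist x a < e"
    using assms by (simp add: infdist_notempty cINF_less_iff)
  then show ?thesis using that by blast
qed

lemma infdist_le_hausdorff_dist:
  fixes A B :: "'a::real_normed_vector set"
  assumes A: "bounded A" and B: "bounded B" "B \<noteq> {}" and a: "a \<in> A"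
  shows "infdist a B \<le> hausdorff_dist A B"
proof -
  obtain b where b: "b \<in> B" using B(2) by blast
  obtain c where c: "\<And>x. x \<in> A \<Longrightarrow> norm x \<le> c" using A by (auto simp: bounded_iff)
  have "infdist x B \<le> c + norm b" if "x \<in> A" for x
  proof -
    have "infdist x B \<le> dist x b" by (rule infdist_le[OF b])
    also have "\<dots> \<le> c + norm b" using c[OF that] norm_triangle_ineq4[of x b] by (simp add: dist_norm)
    finally show ?thesis .
  qed
  then have "bdd_above ((\<lambda>x. infdist x B) ` A)" by (intro bdd_aboveI2)
  then have "infdist a B \<le> (SUP x\<in>A. infdist x B)" by (rule cSUP_upper[OF a])
  then show ?thesis by (simp add: hausdorff_dist_def)
qed

lemma hausdorff_dist_commute: "hausdorff_dist A B = hausdorff_dist B A"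
  by (simp add: hausdorff_dist_def max.commute)

text \<open>Half of Hormander's formula: between a point of \<open>A\<close> and a nearly closest
  point of \<open>B\<close>, a functional in the unit ball changes by at most their
  distance.\<close>

lemma supp_diff_le_hausdorff_dist:
  fixes A B :: "'a::real_normed_vector set"
  assumes A: "bounded A" "A \<noteq> {}" and B: "bounded B" "B \<noteq> {}" and y: "norm y \<le> 1"
  shows "\<bar>supp y A - supp y B\<bar> \<le> hausdorff_dist A B"
proof -
  have *: "supp y A \<le> supp y B + hausdorff_dist A B"
    if A: "bounded A" "A \<noteq> {}" and B: "bounded B" "B \<noteq> {}" for A B :: "'a set"
  proof (rule supp_le[OF A(2)])
    fix a assume a: "a \<in> A"
    show "y a \<le> supp y B + hausdorff_dist A B"
    proof (rule field_le_epsilon)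
      fix e :: real assume "0 < e"
      then have "infdist a B < hausdorff_dist A B + e"
        using infdist_le_hausdorff_dist[OF A(1) B a] by simp
      then obtain b where b: "b \<in> B" "dist a b < hausdorff_dist A B + e"
        by (rule infdist_lessE[OF B(2)])
      have "y (a - b) \<le> dist a b"
        using abs_blinfun_le_norm[OF y, of "a - b"] by (simp add: dist_norm)
      moreover have "y b \<le> supp y B" by (rule le_supp[OF B(1) b(1)])
      ultimately show "y a \<le> supp y B + hausdorff_dist A B + e"
        using b(2) by (simp add: blinfun.diff_right)
    qed
  qed
  from *[OF A B] *[OF B A] show ?thesis by (simp add: hausdorff_dist_commute[of B A])
qed

text \<open>The converse half. The convex set \<open>a - B\<close> keeps distance
  \<open>infdist a B\<close> from 0; a functional in the unit ball that is at least this large on it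
  satisfies \<open>supp y B + infdist a B \<le> y a \<le> supp y A\<close>.\<close>

lemma hausdorff_dist_le_supp:
  fixes A B :: "'a::real_normed_vector set"
  assumes A: "bounded A" "A \<noteq> {}" "convex A" and B: "bounded B" "B \<noteq> {}" "convex B"
    and le: "\<And>y. norm y \<le> 1 \<Longrightarrow> \<bar>supp y A - supp y B\<bar> \<le> \<epsilon>"
  shows "hausdorff_dist A B \<le> \<epsilon>"
proof -
  have *: "infdist a B \<le> \<epsilon>"
    if A: "bounded A" and B: "bounded B" "B \<noteq> {}" "convex B" and a: "a \<in> A"
      and le: "\<And>y. norm y \<le> 1 \<Longrightarrow> supp y A \<le> supp y B + \<epsilon>" for A B :: "'a set" and a
  proof -
    let ?C = "(\<lambda>b. a - b) ` B"
    have conv: "convex ?C"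
    proof -
      have "?C = (\<lambda>z. a + z) ` (uminus ` B)" by (simp add: image_image)
      then show ?thesis using B(3) by (simp only: convex_translation convex_negations)
    qed
    have le_norm: "infdist a B \<le> norm c" if "c \<in> ?C" for c
      using that infdist_le[of _ B a] by (auto simp: dist_norm)
    have "?C \<noteq> {}" using B(2) by simp
    obtain y :: "'a \<Rightarrow>\<^sub>L real" where y: "norm y \<le> 1" "\<And>c. c \<in> ?C \<Longrightarrow> infdist a B \<le> y c"
      by (rule separation_by_blinfun[OF conv \<open>?C \<noteq> {}\<close> le_norm]) blast+
    have "supp y B \<le> y a - infdist a B"
    proof (rule supp_le[OF B(2)])
      fix b assume "b \<in> B"
      then have "infdist a B \<le> y (a - b)" by (intro y(2)) blast
      then show "y b \<le> y a - infdist a B" by (simp add: blinfun.diff_right)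
    qed
    moreover have "y a \<le> supp y A" by (rule le_supp[OF A a])
    ultimately show ?thesis using le[OF y(1)] by linarith
  qed
  have "(SUP a\<in>A. infdist a B) \<le> \<epsilon>"
  proof (rule cSUP_least[OF A(2)])
    fix a assume "a \<in> A"
    then show "infdist a B \<le> \<epsilon>"
      by (rule *[OF A(1) B]) (use le in \<open>fastforce simp: abs_le_iff\<close>)
  qed
  moreover have "(SUP b\<in>B. infdist b A) \<le> \<epsilon>"
  proof (rule cSUP_least[OF B(2)])
    fix b assume "b \<in> B"
    then show "infdist b A \<le> \<epsilon>"
      by (rule *[OF B(1) A]) (use le in \<open>fastforce simp: abs_le_iff\<close>)
  qed
  ultimately show ?thesis by (simp add: hausdorff_dist_def)
qed

lemma has_integral_gauge01I:
  fixes f :: "real \<Rightarrow> real"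
  assumes "\<And>\<epsilon>. 0 < \<epsilon> \<Longrightarrow> \<exists>\<delta>. gauge01 \<delta> \<and> (\<forall>P. perron_partition01 P \<and> delta_fine \<delta> P \<longrightarrow>
    \<bar>(\<Sum>q\<in>P. len (snd q) * f (fst q)) - I\<bar> < \<epsilon>)"
  shows "(f has_integral I) {0..1}"
  unfolding has_integral[of f I 0 1, unfolded box_real]
proof (intro allI impI)
  fix \<epsilon> :: real assume "0 < \<epsilon>"
  then obtain \<delta> where \<delta>: "gauge01 \<delta>"
    "\<And>P. perron_partition01 P \<Longrightarrow> delta_fine \<delta> P \<Longrightarrow> \<bar>(\<Sum>q\<in>P. len (snd q) * f (fst q)) - I\<bar> < \<epsilon>"
    using assms by meson
  have "norm ((\<Sum>(x, K)\<in>P. len K *\<^sub>R f x) - I) < \<epsilon>"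
    if P: "P tagged_division_of {0..1}" "ball_gauge \<delta> fine P" for P
  proof -
    have pp: "perron_partition01 P" using P(1) by (simp add: perron_partition01_iff)
    then have "fst q \<in> {0..1}" if "q \<in> P" for q
      using partition01_tag[of P q] that by (simp add: perron_partition01_def)
    then have "delta_fine \<delta> P" using P(2) by (simp add: ball_gauge_fine_iff)
    with \<delta>(2)[OF pp] show ?thesis by (simp add: case_prod_unfold)
  qed
  then show "\<exists>\<gamma>. gauge \<gamma> \<and> (\<forall>\<D>. \<D> tagged_division_of {0..1} \<and> \<gamma> fine \<D> \<longrightarrow>
      norm ((\<Sum>(x, K)\<in>\<D>. len K *\<^sub>R f x) - I) < \<epsilon>)"
    using gauge_ball_gauge[OF \<delta>(1)] by (intro exI[of _ "ball_gauge \<delta>"]) auto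
qed

section \<open>Selections and the equivalence\<close>

lemma perron_partition01_imp_partition01: "perron_partition01 P \<Longrightarrow> partition01 P"
  by (simp add: perron_partition01_def)

lemma min_gauge:
  assumes "gauge01 \<delta>1" "gauge01 \<delta>2"
  shows "gauge01 (\<lambda>t. min (\<delta>1 t) (\<delta>2 t))"
    "delta_fine (\<lambda>t. min (\<delta>1 t) (\<delta>2 t)) P \<Longrightarrow> delta_fine \<delta>1 P"
    "delta_fine (\<lambda>t. min (\<delta>1 t) (\<delta>2 t)) P \<Longrightarrow> delta_fine \<delta>2 P"
  using assms delta_fine_mono[of "\<lambda>t. min (\<delta>1 t) (\<delta>2 t)" P] by (simp_all add: gauge01_def)

lemma riemann_sum_cwk_valued:
  fixes \<Gamma> :: "real \<Rightarrow> 'a::real_normed_vector set"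
  assumes \<Gamma>: "\<forall>t\<in>{0..1}. \<Gamma> t \<in> cwk" and P: "partition01 P"
  shows "bounded (riemann_sum \<Gamma> P)" "riemann_sum \<Gamma> P \<noteq> {}" "convex (riemann_sum \<Gamma> P)"
    "supp y (riemann_sum \<Gamma> P) = (\<Sum>q\<in>P. len (snd q) * supp y (\<Gamma> (fst q)))"
    "(\<And>t. t \<in> {0..1} \<Longrightarrow> f t \<in> \<Gamma> t) \<Longrightarrow> (\<Sum>q\<in>P. len (snd q) *\<^sub>R f (fst q)) \<in> riemann_sum \<Gamma> P"
proof -
  have "bounded (\<Gamma> (fst q)) \<and> \<Gamma> (fst q) \<noteq> {} \<and> convex (\<Gamma> (fst q))" if "q \<in> P" for q
    using bspec[OF \<Gamma> partition01_tag[OF P that]] cwk_bounded cwk_nonempty cwk_convex by blast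
  note * = riemann_sum_facts[where \<Gamma> = \<Gamma>, OF nonoverlapping_finite[OF partition01_nonoverlapping[OF P]] this]
  show "bounded (riemann_sum \<Gamma> P)" "riemann_sum \<Gamma> P \<noteq> {}" "convex (riemann_sum \<Gamma> P)"
    "supp y (riemann_sum \<Gamma> P) = (\<Sum>q\<in>P. len (snd q) * supp y (\<Gamma> (fst q)))"
    using * by simp_all
  show "(\<Sum>q\<in>P. len (snd q) *\<^sub>R f (fst q)) \<in> riemann_sum \<Gamma> P"
    if "\<And>t. t \<in> {0..1} \<Longrightarrow> f t \<in> \<Gamma> t"
    using * that partition01_tag[OF P] by simp
qed

context
  fixes \<Gamma> :: "real \<Rightarrow> 'a::banach set"
  assumes \<Gamma>: "\<forall>t\<in>{0..1}. \<Gamma> t \<in> cwk"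
begin

text \<open>Let \<open>y\<close> strongly expose the integral \<open>\<Phi>\<close> at \<open>p\<close> and let \<open>f t\<close> maximise \<open>y\<close> over \<open>\<Gamma> t\<close>. Riemann sums
  of \<open>f\<close> then maximise \<open>y\<close> over those of \<open>\<Gamma>\<close>, hence lie close to a slice of \<open>\<Phi>\<close> at \<open>p\<close>.\<close>

lemma exists_henstock_selection:
  assumes "henstock_integrable \<Gamma>"
  shows "henstock_selections \<Gamma> \<noteq> {}"
proof -
  obtain \<Phi> where \<Phi>: "\<Phi> \<in> cwk" and lim: "\<And>\<epsilon>. \<epsilon> > 0 \<Longrightarrow> \<exists>\<delta>. gauge01 \<delta> \<and>
      (\<forall>P. perron_partition01 P \<and> delta_fine \<delta> P \<longrightarrow> hausdorff_dist \<Phi> (riemann_sum \<Gamma> P) < \<epsilon>)"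
    using assms unfolding henstock_integrable_def by auto
  obtain y :: "'a \<Rightarrow>\<^sub>L real" and p where p: "p \<in> \<Phi>" "\<And>k. k \<in> \<Phi> \<Longrightarrow> y k \<le> y p"
    "\<And>\<epsilon>. \<epsilon> > 0 \<Longrightarrow> \<exists>\<alpha>>0. \<forall>u\<in>\<Phi>. y p \<le> y u + \<alpha> \<longrightarrow> norm (u - p) \<le> \<epsilon>"
    by (rule exists_strongly_exposing[OF cwk_weakly_compact[OF \<Phi>] cwk_nonempty[OF \<Phi>]]) blast
  have "\<exists>m. m \<in> \<Gamma> t \<and> (\<forall>k\<in>\<Gamma> t. y k \<le> y m)" if "t \<in> {0..1}" for t
  proof -
    have \<Gamma>t: "\<Gamma> t \<in> cwk" using \<Gamma> that by blast
    obtain m where "m \<in> \<Gamma> t" "\<And>k. k \<in> \<Gamma> t \<Longrightarrow> y k \<le> y m"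
      by (rule weakly_compact_attains_sup[OF cwk_weakly_compact[OF \<Gamma>t] cwk_nonempty[OF \<Gamma>t], of y]) blast
    then show ?thesis by blast
  qed
  then have "\<exists>f. \<forall>t\<in>{0..1}. f t \<in> \<Gamma> t \<and> (\<forall>k\<in>\<Gamma> t. y k \<le> y (f t))" by (intro bchoice ballI)
  then obtain f where f: "\<forall>t\<in>{0..1}. f t \<in> \<Gamma> t \<and> (\<forall>k\<in>\<Gamma> t. y k \<le> y (f t))" ..
  have supf: "supp y (\<Gamma> t) = y (f t)" if "t \<in> {0..1}" for t
  proof (rule antisym)
    have \<Gamma>t: "\<Gamma> t \<in> cwk" using \<Gamma> that by blast
    show "supp y (\<Gamma> t) \<le> y (f t)"
      by (rule supp_le[OF cwk_nonempty[OF \<Gamma>t]]) (use bspec[OF f that] in blast)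
    show "y (f t) \<le> supp y (\<Gamma> t)"
      by (rule le_supp[OF cwk_bounded[OF \<Gamma>t]]) (use bspec[OF f that] in blast)
  qed
  have "\<exists>\<delta>. gauge01 \<delta> \<and> (\<forall>P. perron_partition01 P \<and> delta_fine \<delta> P \<longrightarrow>
      norm (p - (\<Sum>(t, K)\<in>P. len K *\<^sub>R f t)) < \<epsilon>)" if \<epsilon>: "\<epsilon> > 0" for \<epsilon>
  proof -
    obtain \<alpha> where \<alpha>: "\<alpha> > 0" "\<forall>u\<in>\<Phi>. y p \<le> y u + \<alpha> \<longrightarrow> norm (u - p) \<le> \<epsilon> / 2"
      using p(3)[of "\<epsilon> / 2"] \<epsilon> by auto
    \<comment> \<open>The values of \<open>y\<close> at \<open>p\<close> and \<open>u\<close> are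
      compared through two approximations, each off by at most \<open>norm y * \<eta>\<close>;
      together they stay within \<open>\<alpha>\<close>, the width of the slice. The added 1 covers
      \<open>y = 0\<close>.\<close>
    define \<eta> where "\<eta> = min (\<epsilon> / 2) (\<alpha> / (2 * norm y + 1))"
    have ny: "0 < 2 * norm y + 1" by (simp add: add_nonneg_pos)
    have \<eta>: "0 < \<eta>" "\<eta> \<le> \<epsilon> / 2"
      unfolding \<eta>_def using \<epsilon> \<alpha>(1) ny by (simp, intro min.cobounded1)
    have "2 * norm y * \<eta> \<le> (2 * norm y + 1) * \<eta>" using \<eta>(1) by (simp add: distrib_right)
    also have "\<dots> \<le> (2 * norm y + 1) * (\<alpha> / (2 * norm y + 1))"
      using ny by (intro mult_left_mono) (auto simp: \<eta>_def)
    also have "\<dots> = \<alpha>" using ny by simp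
    finally have \<eta>\<alpha>: "2 * norm y * \<eta> \<le> \<alpha>" .
    obtain \<delta> where \<delta>: "gauge01 \<delta>" "\<And>P. perron_partition01 P \<Longrightarrow> delta_fine \<delta> P \<Longrightarrow>
      hausdorff_dist \<Phi> (riemann_sum \<Gamma> P) < \<eta>"
      using lim[OF \<eta>(1)] by auto
    have "norm (p - (\<Sum>q\<in>P. len (snd q) *\<^sub>R f (fst q))) < \<epsilon>"
      if P: "perron_partition01 P" "delta_fine \<delta> P" for P
    proof -
      have part: "partition01 P" by (rule perron_partition01_imp_partition01[OF P(1)])
      let ?R = "riemann_sum \<Gamma> P"
      note R = riemann_sum_cwk_valued[OF \<Gamma> part]
      define z where "z = (\<Sum>q\<in>P. len (snd q) *\<^sub>R f (fst q))"
      have zR: "z \<in> ?R" unfolding z_def by (rule R(5)) (use f in blast)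
      have yz: "y z = supp y ?R"
        unfolding z_def R(4) blinfun.sum_right blinfun.scaleR_right
        using supf partition01_tag[OF part] by (intro sum.cong) auto
      have h: "hausdorff_dist \<Phi> ?R < \<eta>" by (rule \<delta>(2)[OF P])
      have "infdist z \<Phi> < \<eta>"
        using infdist_le_hausdorff_dist[OF R(1) cwk_bounded[OF \<Phi>] cwk_nonempty[OF \<Phi>] zR] h
        by (simp add: hausdorff_dist_commute[of ?R])
      then obtain u where u: "u \<in> \<Phi>" "dist z u < \<eta>" by (rule infdist_lessE[OF cwk_nonempty[OF \<Phi>]])
      have "infdist p ?R < \<eta>"
        using infdist_le_hausdorff_dist[OF cwk_bounded[OF \<Phi>] R(1,2) p(1)] h by simp
      then obtain v where v: "v \<in> ?R" "dist p v < \<eta>" by (rule infdist_lessE[OF R(2)])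
      \<comment> \<open>\<open>v\<close> is near \<open>p\<close>, \<open>z\<close> maximises
        \<open>y\<close> over the Riemann sum containing \<open>v\<close>, and \<open>u\<close> in
        \<open>\<Phi>\<close> is near \<open>z\<close>: so \<open>y u\<close> is almost
        \<open>y p\<close>, and strong exposure makes \<open>u\<close> close to
        \<open>p\<close>.\<close>
      have "y v \<le> y z" unfolding yz by (rule le_supp[OF R(1) v(1)])
      moreover have "\<bar>y (p - v)\<bar> \<le> norm y * \<eta>"
        by (rule abs_blinfun_le) (use v(2) in \<open>auto simp: dist_norm\<close>)
      moreover have "\<bar>y (z - u)\<bar> \<le> norm y * \<eta>"
        by (rule abs_blinfun_le) (use u(2) in \<open>auto simp: dist_norm\<close>)
      ultimately have "y p \<le> y u + \<alpha>" using \<eta>\<alpha> by (simp add: blinfun.diff_right)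
      then have "norm (u - p) \<le> \<epsilon> / 2" using \<alpha>(2) u(1) by blast
      moreover have "norm (z - u) < \<epsilon> / 2" using u(2) \<eta>(2) by (simp add: dist_norm)
      moreover have "norm (p - z) \<le> norm (u - p) + norm (z - u)"
        using norm_triangle_ineq[of "u - p" "z - u"] by (simp add: norm_minus_commute)
      ultimately show ?thesis unfolding z_def[symmetric] by linarith
    qed
    with \<delta>(1) show ?thesis unfolding case_prod_unfold by blast
  qed
  then have "f integrable_on {0..1}" unfolding integrable_on_iff_gauge01 by blast
  then have "f \<in> henstock_selections \<Gamma>" using f by (simp add: henstock_selections_def)
  then show ?thesis by blast
qed

context
  fixes f :: "real \<Rightarrow> 'a"
  assumes f: "f \<in> henstock_selections \<Gamma>"
begin

lemma selection_integral:
  obtains c where "\<And>\<epsilon>. \<epsilon> > 0 \<Longrightarrow> \<exists>\<delta>. gauge01 \<delta> \<and> (\<forall>P. perron_partition01 P \<and> delta_fine \<delta> P \<longrightarrow>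
    norm (c - (\<Sum>q\<in>P. len (snd q) *\<^sub>R f (fst q))) < \<epsilon>)"
proof -
  have "f integrable_on {0..1}" using f by (simp add: henstock_selections_def)
  then show ?thesis unfolding integrable_on_iff_gauge01 case_prod_unfold using that by blast
qed

lemma multi_diff_eq: "multi_diff \<Gamma> f t = (\<lambda>x. x + (- f t)) ` \<Gamma> t"
  by (auto simp: multi_diff_def)

lemma multi_diff_cwk: "\<forall>t\<in>{0..1}. multi_diff \<Gamma> f t \<in> cwk"
  unfolding multi_diff_eq using \<Gamma> cwk_translation by blast

lemma supp_multi_diff:
  assumes "t \<in> {0..1}"
  shows "supp y (multi_diff \<Gamma> f t) = supp y (\<Gamma> t) - y (f t)"
proof -
  have "\<Gamma> t \<in> cwk" using \<Gamma> assms by blast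
  then show ?thesis
    unfolding multi_diff_eq
    using supp_translation[OF cwk_bounded cwk_nonempty, of "\<Gamma> t" y "- f t"] by (simp add: blinfun.minus_right)
qed

lemma zero_in_multi_diff: "t \<in> {0..1} \<Longrightarrow> 0 \<in> multi_diff \<Gamma> f t"
  using f unfolding multi_diff_def henstock_selections_def by force

lemma sum_supp_multi_diff:
  assumes "partition01 P"
  shows "(\<Sum>q\<in>P. len (snd q) * supp y (multi_diff \<Gamma> f (fst q)))
    = supp y (riemann_sum \<Gamma> P) - y (\<Sum>q\<in>P. len (snd q) *\<^sub>R f (fst q))"
proof -
  have "(\<Sum>q\<in>P. len (snd q) * supp y (multi_diff \<Gamma> f (fst q)))
      = (\<Sum>q\<in>P. len (snd q) * supp y (\<Gamma> (fst q)) - len (snd q) * y (f (fst q)))"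
    using partition01_tag[OF assms] supp_multi_diff
    by (intro sum.cong) (simp_all add: right_diff_distrib)
  then show ?thesis
    by (simp add: sum_subtractf riemann_sum_cwk_valued(4)[OF \<Gamma> assms] blinfun.sum_right blinfun.scaleR_right)
qed

text \<open>The candidate integral is \<open>\<Phi> - c\<close>, with \<open>c\<close> the integral
  of \<open>f\<close>. Hausdorff convergence controls all support functions on the dual unit ball
  with one gauge, and \<open>hausdorff_dist_le_supp\<close> turns the uniform McShane estimate back
  into convergence of sets.\<close>

lemma multi_diff_mcshane:
  assumes "henstock_integrable \<Gamma>"
  shows "mcshane_integrable (multi_diff \<Gamma> f)"
proof -
  obtain \<Phi> where \<Phi>: "\<Phi> \<in> cwk" and lim: "\<And>\<epsilon>. \<epsilon> > 0 \<Longrightarrow> \<exists>\<delta>. gauge01 \<delta> \<and>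
      (\<forall>P. perron_partition01 P \<and> delta_fine \<delta> P \<longrightarrow> hausdorff_dist \<Phi> (riemann_sum \<Gamma> P) < \<epsilon>)"
    using assms unfolding henstock_integrable_def by auto
  obtain c where c: "\<And>\<epsilon>. \<epsilon> > 0 \<Longrightarrow> \<exists>\<delta>. gauge01 \<delta> \<and> (\<forall>P. perron_partition01 P \<and> delta_fine \<delta> P \<longrightarrow>
    norm (c - (\<Sum>q\<in>P. len (snd q) *\<^sub>R f (fst q))) < \<epsilon>)"
    by (rule selection_integral) blast
  define G where "G = multi_diff \<Gamma> f"
  define T where "T = {y :: 'a \<Rightarrow>\<^sub>L real. norm y \<le> 1}"
  define h where "h y t = supp y (G t)" for y t
  define b where "b t = (SUP x\<in>G t. norm x)" for t
  have Gc: "\<forall>t\<in>{0..1}. G t \<in> cwk" unfolding G_def by (rule multi_diff_cwk)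
  have Gb: "bounded (G t)" if "t \<in> {0..1}" for t using Gc that cwk_bounded by blast
  have G0: "0 \<in> G t" if "t \<in> {0..1}" for t unfolding G_def by (rule zero_in_multi_diff[OF that])
  have norm_le_b: "norm x \<le> b t" if "t \<in> {0..1}" "x \<in> G t" for x t
  proof -
    have "bdd_above (norm ` G t)"
      using Gb[OF that(1)] by (auto simp: bounded_iff bdd_above_def)
    then show ?thesis unfolding b_def by (rule cSUP_upper[OF that(2)])
  qed
  define \<Phi>' where "\<Phi>' = (\<lambda>x. x + (- c)) ` \<Phi>"
  have \<Phi>': "\<Phi>' \<in> cwk" unfolding \<Phi>'_def by (rule cwk_translation[OF \<Phi>])
  have supp\<Phi>': "supp y \<Phi>' = supp y \<Phi> - y c" for y
    unfolding \<Phi>'_def supp_translation[OF cwk_bounded[OF \<Phi>] cwk_nonempty[OF \<Phi>]]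
    by (simp add: blinfun.minus_right)
  have unif: "\<exists>\<delta>. gauge01 \<delta> \<and> (\<forall>P. perron_partition01 P \<and> delta_fine \<delta> P \<longrightarrow>
      (\<forall>y\<in>T. \<bar>(\<Sum>q\<in>P. len (snd q) * h y (fst q)) - supp y \<Phi>'\<bar> < \<epsilon>))" if \<epsilon>: "\<epsilon> > 0" for \<epsilon>
  proof -
    have \<epsilon>2: "\<epsilon> / 2 > 0" using \<epsilon> by simp
    obtain \<delta>1 where \<delta>1: "gauge01 \<delta>1" "\<And>P. perron_partition01 P \<Longrightarrow> delta_fine \<delta>1 P \<Longrightarrow>
      hausdorff_dist \<Phi> (riemann_sum \<Gamma> P) < \<epsilon> / 2"
      using lim[OF \<epsilon>2] by auto
    obtain \<delta>2 where \<delta>2: "gauge01 \<delta>2" "\<And>P. perron_partition01 P \<Longrightarrow> delta_fine \<delta>2 P \<Longrightarrow>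
      norm (c - (\<Sum>q\<in>P. len (snd q) *\<^sub>R f (fst q))) < \<epsilon> / 2"
      using c[OF \<epsilon>2] by auto
    note g = min_gauge[OF \<delta>1(1) \<delta>2(1)]
    have "\<bar>(\<Sum>q\<in>P. len (snd q) * h y (fst q)) - supp y \<Phi>'\<bar> < \<epsilon>"
      if P: "perron_partition01 P" "delta_fine (\<lambda>t. min (\<delta>1 t) (\<delta>2 t)) P" and y: "y \<in> T" for P y
    proof -
      have part: "partition01 P" by (rule perron_partition01_imp_partition01[OF P(1)])
      note R = riemann_sum_cwk_valued[OF \<Gamma> part]
      define z where "z = (\<Sum>q\<in>P. len (snd q) *\<^sub>R f (fst q))"
      have y1: "norm y \<le> 1" using y by (simp add: T_def)
      have "\<bar>supp y \<Phi> - supp y (riemann_sum \<Gamma> P)\<bar> < \<epsilon> / 2"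
        using supp_diff_le_hausdorff_dist[OF cwk_bounded[OF \<Phi>] cwk_nonempty[OF \<Phi>] R(1,2) y1]
          \<delta>1(2)[OF P(1) g(2)[OF P(2)]] by linarith
      moreover have "\<bar>y (c - z)\<bar> < \<epsilon> / 2"
        using abs_blinfun_le_norm[OF y1, of "c - z"] \<delta>2(2)[OF P(1) g(3)[OF P(2)]]
        unfolding z_def by linarith
      moreover have "(\<Sum>q\<in>P. len (snd q) * h y (fst q)) = supp y (riemann_sum \<Gamma> P) - y z"
        unfolding h_def G_def z_def by (rule sum_supp_multi_diff[OF part])
      ultimately show ?thesis unfolding supp\<Phi>' blinfun.diff_right by linarith
    qed
    with g(1) show ?thesis by blast
  qed
  have hI: "(h y has_integral supp y \<Phi>') {0..1}" if "y \<in> T" for y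
    by (rule has_integral_gauge01I) (use unif that in blast)
  \<comment> \<open>Nonnegativity is the gain from subtracting a selection:
    \<open>0 \<in> G t\<close> makes every support function of \<open>G t\<close> at least
    0.\<close>
  interpret uniform_henstock T h b
  proof
    fix y t assume y: "y \<in> T" and t: "t \<in> {0..1::real}"
    show "0 \<le> h y t"
      using le_supp[OF Gb[OF t] G0[OF t], of y] by (simp add: h_def)
    show "h y t \<le> b t"
      unfolding h_def
    proof (rule supp_le)
      show "G t \<noteq> {}" using G0[OF t] by blast
      fix x assume "x \<in> G t"
      then show "y x \<le> b t"
        using abs_blinfun_le_norm[of y x] norm_le_b[OF t, of x] y by (simp add: T_def)
    qed
  next
    fix t assume "t \<in> {0..1::real}"
    then show "0 \<le> b t" using norm_le_b[of t 0] G0 by simp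
  next
    fix y assume "y \<in> T"
    then show "h y integrable_on {0..1}" using hI by blast
  next
    fix \<epsilon> :: real assume "0 < \<epsilon>"
    then show "\<exists>\<delta>. henstock_gauge T h \<delta> \<epsilon>"
      using unif[of \<epsilon>] integral_unique[OF hI] unfolding henstock_gauge_def by auto
  qed
  have "\<exists>\<delta>. gauge01 \<delta> \<and> (\<forall>P. partition01 P \<and> delta_fine \<delta> P \<longrightarrow>
      hausdorff_dist \<Phi>' (riemann_sum G P) < \<epsilon>)" if \<epsilon>: "\<epsilon> > 0" for \<epsilon>
  proof -
    have \<epsilon>2: "0 < \<epsilon> / 2" using \<epsilon> by simp
    obtain \<delta> where \<delta>: "gauge01 \<delta>" "\<And>P y. partition01 P \<Longrightarrow> delta_fine \<delta> P \<Longrightarrow> y \<in> T \<Longrightarrow>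
      \<bar>(\<Sum>q\<in>P. len (snd q) * h y (fst q)) - integral {0..1} (h y)\<bar> < \<epsilon> / 2"
      by (rule uniform_mcshane[OF \<epsilon>2]) blast
    have "hausdorff_dist \<Phi>' (riemann_sum G P) < \<epsilon>" if P: "partition01 P" "delta_fine \<delta> P" for P
    proof -
      note RG = riemann_sum_cwk_valued[OF Gc P(1)]
      have "hausdorff_dist \<Phi>' (riemann_sum G P) \<le> \<epsilon> / 2"
      proof (rule hausdorff_dist_le_supp)
        show "bounded \<Phi>'" "\<Phi>' \<noteq> {}" "convex \<Phi>'"
          using \<Phi>' by (simp_all add: cwk_bounded cwk_nonempty cwk_convex)
        show "bounded (riemann_sum G P)" "riemann_sum G P \<noteq> {}" "convex (riemann_sum G P)"
          by (rule RG)+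
        fix y :: "'a \<Rightarrow>\<^sub>L real" assume "norm y \<le> 1"
        then have y: "y \<in> T" by (simp add: T_def)
        have "supp y (riemann_sum G P) = (\<Sum>q\<in>P. len (snd q) * h y (fst q))"
          unfolding RG(4) h_def ..
        then show "\<bar>supp y \<Phi>' - supp y (riemann_sum G P)\<bar> \<le> \<epsilon> / 2"
          using \<delta>(2)[OF P y] integral_unique[OF hI[OF y]] by linarith
      qed
      then show ?thesis using \<epsilon> by simp
    qed
    with \<delta>(1) show ?thesis by blast
  qed
  then show ?thesis unfolding mcshane_integrable_def G_def using \<Phi>' by blast
qed

text \<open>A Perron partition is in particular a partition, so the minimum of a McShane gauge of
  \<open>\<Gamma> - f\<close> and a Henstock gauge of \<open>f\<close> works; translating back by
  the integral \<open>c\<close> of \<open>f\<close> gives the integral of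
  \<open>\<Gamma>\<close>.\<close>

lemma henstock_if_multi_diff_mcshane:
  assumes "mcshane_integrable (multi_diff \<Gamma> f)"
  shows "henstock_integrable \<Gamma>"
proof -
  define G where "G = multi_diff \<Gamma> f"
  obtain \<Phi> where \<Phi>: "\<Phi> \<in> cwk" and lim: "\<And>\<epsilon>. \<epsilon> > 0 \<Longrightarrow> \<exists>\<delta>. gauge01 \<delta> \<and>
      (\<forall>P. partition01 P \<and> delta_fine \<delta> P \<longrightarrow> hausdorff_dist \<Phi> (riemann_sum G P) < \<epsilon>)"
    using assms unfolding mcshane_integrable_def G_def by auto
  obtain c where c: "\<And>\<epsilon>. \<epsilon> > 0 \<Longrightarrow> \<exists>\<delta>. gauge01 \<delta> \<and> (\<forall>P. perron_partition01 P \<and> delta_fine \<delta> P \<longrightarrow>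
    norm (c - (\<Sum>q\<in>P. len (snd q) *\<^sub>R f (fst q))) < \<epsilon>)"
    by (rule selection_integral) blast
  have Gc: "\<forall>t\<in>{0..1}. G t \<in> cwk" unfolding G_def by (rule multi_diff_cwk)
  define \<Phi>' where "\<Phi>' = (\<lambda>x. x + c) ` \<Phi>"
  have \<Phi>': "\<Phi>' \<in> cwk" unfolding \<Phi>'_def by (rule cwk_translation[OF \<Phi>])
  have supp\<Phi>': "supp y \<Phi>' = supp y \<Phi> + y c" for y
    unfolding \<Phi>'_def by (simp add: supp_translation cwk_bounded[OF \<Phi>] cwk_nonempty[OF \<Phi>])
  have "\<exists>\<delta>. gauge01 \<delta> \<and> (\<forall>P. perron_partition01 P \<and> delta_fine \<delta> P \<longrightarrow>
      hausdorff_dist \<Phi>' (riemann_sum \<Gamma> P) < \<epsilon>)" if \<epsilon>: "\<epsilon> > 0" for \<epsilon>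
  proof -
    have \<epsilon>3: "0 < \<epsilon> / 3" using \<epsilon> by simp
    obtain \<delta>1 where \<delta>1: "gauge01 \<delta>1" "\<And>P. partition01 P \<Longrightarrow> delta_fine \<delta>1 P \<Longrightarrow>
      hausdorff_dist \<Phi> (riemann_sum G P) < \<epsilon> / 3"
      using lim[OF \<epsilon>3] by auto
    obtain \<delta>2 where \<delta>2: "gauge01 \<delta>2" "\<And>P. perron_partition01 P \<Longrightarrow> delta_fine \<delta>2 P \<Longrightarrow>
      norm (c - (\<Sum>q\<in>P. len (snd q) *\<^sub>R f (fst q))) < \<epsilon> / 3"
      using c[OF \<epsilon>3] by auto
    note g = min_gauge[OF \<delta>1(1) \<delta>2(1)]
    have "hausdorff_dist \<Phi>' (riemann_sum \<Gamma> P) < \<epsilon>"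
      if P: "perron_partition01 P" "delta_fine (\<lambda>t. min (\<delta>1 t) (\<delta>2 t)) P" for P
    proof -
      have part: "partition01 P" by (rule perron_partition01_imp_partition01[OF P(1)])
      note R = riemann_sum_cwk_valued[OF \<Gamma> part]
      note RG = riemann_sum_cwk_valued[OF Gc part]
      define z where "z = (\<Sum>q\<in>P. len (snd q) *\<^sub>R f (fst q))"
      \<comment> \<open>Two errors of \<open>\<epsilon> / 3\<close>; the third part is a margin,
        because the supremum over functionals loses strictness.\<close>
      have "hausdorff_dist \<Phi>' (riemann_sum \<Gamma> P) \<le> 2 * (\<epsilon> / 3)"
      proof (rule hausdorff_dist_le_supp[OF _ _ _ R(1-3)])
        show "bounded \<Phi>'" "\<Phi>' \<noteq> {}" "convex \<Phi>'"
          using \<Phi>' by (simp_all add: cwk_bounded cwk_nonempty cwk_convex)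
        fix y :: "'a \<Rightarrow>\<^sub>L real" assume y: "norm y \<le> 1"
        have "\<bar>supp y \<Phi> - supp y (riemann_sum G P)\<bar> < \<epsilon> / 3"
          using supp_diff_le_hausdorff_dist[OF cwk_bounded[OF \<Phi>] cwk_nonempty[OF \<Phi>] RG(1,2) y]
            \<delta>1(2)[OF part g(2)[OF P(2)]] by linarith
        moreover have "\<bar>y (c - z)\<bar> < \<epsilon> / 3"
          using abs_blinfun_le_norm[OF y, of "c - z"] \<delta>2(2)[OF P(1) g(3)[OF P(2)]]
          unfolding z_def by linarith
        moreover have "supp y (riemann_sum G P) = supp y (riemann_sum \<Gamma> P) - y z"
          using sum_supp_multi_diff[OF part, of y] RG(4)[of y] unfolding G_def z_def by linarith
        ultimately show "\<bar>supp y \<Phi>' - supp y (riemann_sum \<Gamma> P)\<bar> \<le> 2 * (\<epsilon> / 3)"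
          unfolding supp\<Phi>' blinfun.diff_right by linarith
      qed
      then show ?thesis using \<epsilon> by simp
    qed
    with g(1) show ?thesis by blast
  qed
  then show ?thesis unfolding henstock_integrable_def using \<Phi>' by blast
qed

end

end

theorem theorem3p2:
  fixes \<Gamma> :: "real \<Rightarrow> 'a::banach set"
  assumes "\<forall>t\<in>{0..1}. \<Gamma> t \<in> cwk"
  shows "(henstock_integrable \<Gamma> \<longleftrightarrow>
            henstock_selections \<Gamma> \<noteq> {} \<and>
            (\<forall>f\<in>henstock_selections \<Gamma>. mcshane_integrable (multi_diff \<Gamma> f)))
       \<and> (henstock_integrable \<Gamma> \<longleftrightarrow>
            (\<exists>f\<in>henstock_selections \<Gamma>. mcshane_integrable (multi_diff \<Gamma> f)))"
  using exists_henstock_selection[OF assms] multi_diff_mcshane[OF assms]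
    henstock_if_multi_diff_mcshane[OF assms] by blast

end
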